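(* Let $\mathcal{C}$ be a Markov category. Then $\mathsf{ProDet}(\mathcal{C})$ is a Markov category, and its deterministic subcategory is $\mathsf{Pro}(\mathsf{det}(\mathcal{C}))$.
   Context: A Markov category is a symmetric monoidal category in which the monoidal unit is terminal and every object $X$ carries a commutative comonoid structure $\mathsf{copy}_X : X\to X\otimes X$, $\mathsf{del}_X : X\to 1$, compatible with the monoidal product. A morphism $f:X\to Y$ is deterministic if $\mathsf{copy}_Y\circ f=(f\otimes f)\circ \mathsf{copy}_X$. $\mathsf{det}(\mathcal{C})$ is the wide subcategory of deterministic morphisms of $\mathcal{C}$; it is cartesian monoidal. $\mathsf{Pro}(-)$ denotes the category of pro-objects, i.e. the free completion under (small) cofiltered limits; its morphisms are $\mathsf{Pro}(\mathcal{C})(\lim_i X_i,\lim_j Y_j)=\lim_j\operatorname{colim}_i\mathcal{C}(X_i,Y_j)$. $\mathsf{ProDet}(\mathcal{C})$ is the full subcategory of $\mathsf{Pro}(\mathcal{C})$ on the limits of cofiltered diagrams that factorize through $\mathsf{det}(\mathcal{C})$; equivalently, it is the full image of the functor $\mathsf{Pro}(\mathsf{det}(\mathcal{C}))\to\mathsf{Pro}(\mathcal{C})$. The category $\mathsf{Pro}(\mathsf{det}(\mathcal{C}))$ is cartesian monoidal. In $\mathsf{ProDet}(\mathcal{C})$, the tensor is $$X\otimes Y=\lim_{X\to X',\ Y\to Y'} X'\otimes Y',$$ where $X\to X'$ and $Y\to Y'$ range over maps in $\mathsf{Pro}(\mathsf{det}(\mathcal{C}))$ with $X',Y'$ objects of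 $\mathcal{C}$; i.e. it is the cartesian product of $X$ and $Y$ in $\mathsf{Pro}(\mathsf{det}(\mathcal{C}))$. The tensor of morphisms is determined by tensoring representatives $f':X'\to Y'$ in $\mathcal{C}$ of the components. The monoidal unit is the terminal object $1\in\mathcal{C}$. The copy map of $X$ is the map $X\to X\otimes X$ whose components are $X\to X'\xrightarrow{\mathsf{copy}}X'\otimes X'$ for each $X\to X'$ in $\mathsf{Pro}(\mathsf{det}(\mathcal{C}))$ with $X'\in\mathcal{C}$. *)

theory Defs
  imports Main "HOL-Library.FuncSet" "HOL-Library.Infinite_Typeclass"
begin

section \<open>Categories\<close>

record ('o, 'a) cat =
  Obj :: "'o set"
  Arr :: "'a set"
  Dom :: "'a \<Rightarrow> 'o"
  Cod :: "'a \<Rightarrow> 'o"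
  Ident :: "'o \<Rightarrow> 'a"
  Comp :: "'a \<Rightarrow> 'a \<Rightarrow> 'a" (infixr \<open>\<cdot>\<index>\<close> 65)

definition hom :: "('o, 'a, 'm) cat_scheme \<Rightarrow> 'o \<Rightarrow> 'o \<Rightarrow> 'a set" where
  "hom C x y = {f \<in> Arr C. Dom C f = x \<and> Cod C f = y}"

locale category =
  fixes C :: "('o, 'a, 'm) cat_scheme" (structure)
  assumes dom_obj: "f \<in> Arr C \<Longrightarrow> Dom C f \<in> Obj C"
    and cod_obj: "f \<in> Arr C \<Longrightarrow> Cod C f \<in> Obj C"
    and ident_hom: "x \<in> Obj C \<Longrightarrow> Ident C x \<in> hom C x x"
    and comp_hom: "\<lbrakk>f \<in> hom C x y; g \<in> hom C y z\<rbrakk> \<Longrightarrow> g \<cdot> f \<in> hom C x z"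
    and comp_ident_left: "f \<in> hom C x y \<Longrightarrow> Ident C y \<cdot> f = f"
    and comp_ident_right: "f \<in> hom C x y \<Longrightarrow> f \<cdot> Ident C x = f"
    and comp_assoc: "\<lbrakk>f \<in> hom C w x; g \<in> hom C x y; h \<in> hom C y z\<rbrakk>
      \<Longrightarrow> (h \<cdot> g) \<cdot> f = h \<cdot> (g \<cdot> f)"

definition inverse_arrows :: "('o, 'a, 'm) cat_scheme \<Rightarrow> 'a \<Rightarrow> 'a \<Rightarrow> bool" where
  "inverse_arrows C f g \<longleftrightarrow> f \<in> Arr C \<and> g \<in> hom C (Cod C f) (Dom C f) \<and>
     g \<cdot>\<^bsub>C\<^esub> f = Ident C (Dom C f) \<and> f \<cdot>\<^bsub>C\<^esub> g = Ident C (Cod C f)"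

definition iso_arr :: "('o, 'a, 'm) cat_scheme \<Rightarrow> 'a \<Rightarrow> bool" where
  "iso_arr C f \<longleftrightarrow> (\<exists>g. inverse_arrows C f g)"

definition inverse_arr :: "('o, 'a, 'm) cat_scheme \<Rightarrow> 'a \<Rightarrow> 'a" where
  "inverse_arr C f = (THE g. inverse_arrows C f g)"

definition terminal_obj :: "('o, 'a, 'm) cat_scheme \<Rightarrow> 'o \<Rightarrow> bool" where
  "terminal_obj C t \<longleftrightarrow> t \<in> Obj C \<and> (\<forall>x\<in>Obj C. \<exists>!f. f \<in> hom C x t)"

definition is_functor ::
  "('o, 'a, 'm) cat_scheme \<Rightarrow> ('p, 'b, 'n) cat_scheme \<Rightarrow> ('o \<Rightarrow> 'p) \<Rightarrow> ('a \<Rightarrow> 'b) \<Rightarrow> bool" where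
  "is_functor A B F\<^sub>0 F\<^sub>1 \<longleftrightarrow> category A \<and> category B \<and>
     (\<forall>x\<in>Obj A. F\<^sub>0 x \<in> Obj B \<and> F\<^sub>1 (Ident A x) = Ident B (F\<^sub>0 x)) \<and>
     (\<forall>f\<in>Arr A. F\<^sub>1 f \<in> hom B (F\<^sub>0 (Dom A f)) (F\<^sub>0 (Cod A f))) \<and>
     (\<forall>f\<in>Arr A. \<forall>g\<in>Arr A. Dom A g = Cod A f \<longrightarrow> F\<^sub>1 (g \<cdot>\<^bsub>A\<^esub> f) = F\<^sub>1 g \<cdot>\<^bsub>B\<^esub> F\<^sub>1 f)"

definition is_cat_iso ::
  "('o, 'a, 'm) cat_scheme \<Rightarrow> ('p, 'b, 'n) cat_scheme \<Rightarrow> ('o \<Rightarrow> 'p) \<Rightarrow> ('a \<Rightarrow> 'b) \<Rightarrow> bool" where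
  "is_cat_iso A B F\<^sub>0 F\<^sub>1 \<longleftrightarrow> is_functor A B F\<^sub>0 F\<^sub>1 \<and>
     bij_betw F\<^sub>0 (Obj A) (Obj B) \<and> bij_betw F\<^sub>1 (Arr A) (Arr B)"

definition full_subcat :: "('o, 'a, 'm) cat_scheme \<Rightarrow> 'o set \<Rightarrow> ('o, 'a) cat" where
  "full_subcat C S =
    \<lparr>Obj = Obj C \<inter> S, Arr = {f \<in> Arr C. Dom C f \<in> S \<and> Cod C f \<in> S},
     Dom = Dom C, Cod = Cod C, Ident = Ident C, Comp = Comp C\<rparr>"


section \<open>Markov categories\<close>

record ('o, 'a) smc = "('o, 'a) cat" +
  TensorObj :: "'o \<Rightarrow> 'o \<Rightarrow> 'o" (infixr \<open>\<otimes>\<index>\<close> 70)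
  TensorArr :: "'a \<Rightarrow> 'a \<Rightarrow> 'a" (infixr \<open>\<boxtimes>\<index>\<close> 70)
  Unit :: "'o"
  Assoc :: "'o \<Rightarrow> 'o \<Rightarrow> 'o \<Rightarrow> 'a"
  LUnit :: "'o \<Rightarrow> 'a"
  RUnit :: "'o \<Rightarrow> 'a"
  Swap :: "'o \<Rightarrow> 'o \<Rightarrow> 'a"

locale monoidal_category = category C
  for C :: "('o, 'a, 'm) smc_scheme" (structure) +
  assumes tensor_obj: "\<lbrakk>a \<in> Obj C; b \<in> Obj C\<rbrakk> \<Longrightarrow> a \<otimes> b \<in> Obj C"
    and tensor_hom: "\<lbrakk>f \<in> hom C a b; g \<in> hom C c d\<rbrakk> \<Longrightarrow> f \<boxtimes> g \<in> hom C (a \<otimes> c) (b \<otimes> d)"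
    and tensor_ident:
      "\<lbrakk>a \<in> Obj C; b \<in> Obj C\<rbrakk> \<Longrightarrow> Ident C a \<boxtimes> Ident C b = Ident C (a \<otimes> b)"
    and tensor_comp:
      "\<lbrakk>f \<in> hom C a b; g \<in> hom C b c; f' \<in> hom C a' b'; g' \<in> hom C b' c'\<rbrakk>
       \<Longrightarrow> (g \<cdot> f) \<boxtimes> (g' \<cdot> f') = (g \<boxtimes> g') \<cdot> (f \<boxtimes> f')"
    and unit_obj: "Unit C \<in> Obj C"
    and assoc_hom: "\<lbrakk>a \<in> Obj C; b \<in> Obj C; c \<in> Obj C\<rbrakk>
      \<Longrightarrow> Assoc C a b c \<in> hom C ((a \<otimes> b) \<otimes> c) (a \<otimes> (b \<otimes> c))"
    and assoc_iso: "\<lbrakk>a \<in> Obj C; b \<in> Obj C; c \<in> Obj C\<rbrakk> \<Longrightarrow> iso_arr C (Assoc C a b c)"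
    and assoc_natural: "\<lbrakk>f \<in> hom C a a'; g \<in> hom C b b'; h \<in> hom C c c'\<rbrakk>
      \<Longrightarrow> Assoc C a' b' c' \<cdot> ((f \<boxtimes> g) \<boxtimes> h) = (f \<boxtimes> (g \<boxtimes> h)) \<cdot> Assoc C a b c"
    and lunit_hom: "a \<in> Obj C \<Longrightarrow> LUnit C a \<in> hom C (Unit C \<otimes> a) a"
    and lunit_iso: "a \<in> Obj C \<Longrightarrow> iso_arr C (LUnit C a)"
    and lunit_natural:
      "f \<in> hom C a b \<Longrightarrow> LUnit C b \<cdot> (Ident C (Unit C) \<boxtimes> f) = f \<cdot> LUnit C a"
    and runit_hom: "a \<in> Obj C \<Longrightarrow> RUnit C a \<in> hom C (a \<otimes> Unit C) a"
    and runit_iso: "a \<in> Obj C \<Longrightarrow> iso_arr C (RUnit C a)"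
    and runit_natural:
      "f \<in> hom C a b \<Longrightarrow> RUnit C b \<cdot> (f \<boxtimes> Ident C (Unit C)) = f \<cdot> RUnit C a"
    and pentagon: "\<lbrakk>a \<in> Obj C; b \<in> Obj C; c \<in> Obj C; d \<in> Obj C\<rbrakk>
      \<Longrightarrow> Assoc C a b (c \<otimes> d) \<cdot> Assoc C (a \<otimes> b) c d =
          (Ident C a \<boxtimes> Assoc C b c d) \<cdot> Assoc C a (b \<otimes> c) d \<cdot> (Assoc C a b c \<boxtimes> Ident C d)"
    and triangle: "\<lbrakk>a \<in> Obj C; b \<in> Obj C\<rbrakk>
      \<Longrightarrow> (Ident C a \<boxtimes> LUnit C b) \<cdot> Assoc C a (Unit C) b = RUnit C a \<boxtimes> Ident C b"

locale symmetric_monoidal_category = monoidal_category C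
  for C :: "('o, 'a, 'm) smc_scheme" (structure) +
  assumes swap_hom: "\<lbrakk>a \<in> Obj C; b \<in> Obj C\<rbrakk> \<Longrightarrow> Swap C a b \<in> hom C (a \<otimes> b) (b \<otimes> a)"
    and swap_natural: "\<lbrakk>f \<in> hom C a a'; g \<in> hom C b b'\<rbrakk>
      \<Longrightarrow> Swap C a' b' \<cdot> (f \<boxtimes> g) = (g \<boxtimes> f) \<cdot> Swap C a b"
    and swap_swap:
      "\<lbrakk>a \<in> Obj C; b \<in> Obj C\<rbrakk> \<Longrightarrow> Swap C b a \<cdot> Swap C a b = Ident C (a \<otimes> b)"
    and hexagon: "\<lbrakk>a \<in> Obj C; b \<in> Obj C; c \<in> Obj C\<rbrakk>
      \<Longrightarrow> Assoc C b c a \<cdot> Swap C a (b \<otimes> c) \<cdot> Assoc C a b c =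
          (Ident C b \<boxtimes> Swap C a c) \<cdot> Assoc C b a c \<cdot> (Swap C a b \<boxtimes> Ident C c)"

text \<open>The canonical arrow
  \<open>(a \<otimes> a') \<otimes> (b \<otimes> b') \<rightarrow> (a \<otimes> b) \<otimes> (a' \<otimes> b')\<close> exchanging the two inner factors.\<close>

definition interchange :: "('o, 'a, 'm) smc_scheme \<Rightarrow> 'o \<Rightarrow> 'o \<Rightarrow> 'o \<Rightarrow> 'o \<Rightarrow> 'a" where
  "interchange C a a' b b' =
     inverse_arr C (Assoc C a b (a' \<otimes>\<^bsub>C\<^esub> b')) \<cdot>\<^bsub>C\<^esub>
     (Ident C a \<boxtimes>\<^bsub>C\<^esub>
       (Assoc C b a' b' \<cdot>\<^bsub>C\<^esub> (Swap C a' b \<boxtimes>\<^bsub>C\<^esub> Ident C b') \<cdot>\<^bsub>C\<^esub>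
        inverse_arr C (Assoc C a' b b'))) \<cdot>\<^bsub>C\<^esub>
     Assoc C a a' (b \<otimes>\<^bsub>C\<^esub> b')"

record ('o, 'a) markov = "('o, 'a) smc" +
  Copy :: "'o \<Rightarrow> 'a"
  Del :: "'o \<Rightarrow> 'a"

locale markov_category = symmetric_monoidal_category C
  for C :: "('o, 'a, 'm) markov_scheme" (structure) +
  assumes unit_terminal: "terminal_obj C (Unit C)"
    and copy_hom: "a \<in> Obj C \<Longrightarrow> Copy C a \<in> hom C a (a \<otimes> a)"
    and del_hom: "a \<in> Obj C \<Longrightarrow> Del C a \<in> hom C a (Unit C)"
    and copy_coassoc: "a \<in> Obj C
      \<Longrightarrow> Assoc C a a a \<cdot> (Copy C a \<boxtimes> Ident C a) \<cdot> Copy C a = (Ident C a \<boxtimes> Copy C a) \<cdot> Copy C a"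
    and copy_counit_left:
      "a \<in> Obj C \<Longrightarrow> LUnit C a \<cdot> (Del C a \<boxtimes> Ident C a) \<cdot> Copy C a = Ident C a"
    and copy_counit_right:
      "a \<in> Obj C \<Longrightarrow> RUnit C a \<cdot> (Ident C a \<boxtimes> Del C a) \<cdot> Copy C a = Ident C a"
    and copy_commute: "a \<in> Obj C \<Longrightarrow> Swap C a a \<cdot> Copy C a = Copy C a"
    and copy_tensor: "\<lbrakk>a \<in> Obj C; b \<in> Obj C\<rbrakk>
      \<Longrightarrow> Copy C (a \<otimes> b) = interchange C a a b b \<cdot> (Copy C a \<boxtimes> Copy C b)"
    and del_tensor: "\<lbrakk>a \<in> Obj C; b \<in> Obj C\<rbrakk>
      \<Longrightarrow> Del C (a \<otimes> b) = LUnit C (Unit C) \<cdot> (Del C a \<boxtimes> Del C b)"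
    and copy_unit: "Copy C (Unit C) = inverse_arr C (LUnit C (Unit C))"
    and del_unit: "Del C (Unit C) = Ident C (Unit C)"

definition deterministic :: "('o, 'a, 'm) markov_scheme \<Rightarrow> 'a \<Rightarrow> bool" where
  "deterministic C f \<longleftrightarrow>
     Copy C (Cod C f) \<cdot>\<^bsub>C\<^esub> f = (f \<boxtimes>\<^bsub>C\<^esub> f) \<cdot>\<^bsub>C\<^esub> Copy C (Dom C f)"

definition det :: "('o, 'a, 'm) markov_scheme \<Rightarrow> ('o, 'a) cat" where
  "det C = \<lparr>Obj = Obj C, Arr = {f \<in> Arr C. deterministic C f},
     Dom = Dom C, Cod = Cod C, Ident = Ident C, Comp = Comp C\<rparr>"


section \<open>Pro-objects\<close>

text \<open>A small category is one whose objects and arrows are drawn from a fixed index type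
  \<open>'i\<close>.  An object of \<open>Pro(C)\<close> is a cofiltered diagram in \<open>C\<close> of small shape, regarded as its
  formal limit.\<close>

definition cofiltered :: "('o, 'a, 'm) cat_scheme \<Rightarrow> bool" where
  "cofiltered J \<longleftrightarrow> category J \<and> Obj J \<noteq> {} \<and>
     (\<forall>x\<in>Obj J. \<forall>y\<in>Obj J. \<exists>z u v. u \<in> hom J z x \<and> v \<in> hom J z y) \<and>
     (\<forall>x y. \<forall>u\<in>hom J x y. \<forall>v\<in>hom J x y. \<exists>w e. e \<in> hom J w x \<and> u \<cdot>\<^bsub>J\<^esub> e = v \<cdot>\<^bsub>J\<^esub> e)"

record ('i, 'o, 'a) diagram =
  Shape :: "('i, 'i) cat"
  ObjMap :: "'i \<Rightarrow> 'o"
  ArrMap :: "'i \<Rightarrow> 'a"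

definition pro_objects :: "('o, 'a, 'm) cat_scheme \<Rightarrow> ('i, 'o, 'a) diagram set" where
  "pro_objects C =
     {X. cofiltered (Shape X) \<and> is_functor (Shape X) C (ObjMap X) (ArrMap X)}"

text \<open>The set \<open>colim\<^sub>i C(X\<^sub>i, c)\<close> is the quotient of the disjoint union of the hom-sets by the
  equivalence generated by \<open>(i, f) \<sim> (k, f \<cdot> X\<^sub>u)\<close> for \<open>u : k \<rightarrow> i\<close>.\<close>

definition colim_carrier ::
  "('o, 'a, 'm) cat_scheme \<Rightarrow> ('i, 'o, 'a) diagram \<Rightarrow> 'o \<Rightarrow> ('i \<times> 'a) set" where
  "colim_carrier C X c = {(i, f). i \<in> Obj (Shape X) \<and> f \<in> hom C (ObjMap X i) c}"

definition colim_step ::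
  "('o, 'a, 'm) cat_scheme \<Rightarrow> ('i, 'o, 'a) diagram \<Rightarrow> 'o \<Rightarrow> (('i \<times> 'a) \<times> ('i \<times> 'a)) set" where
  "colim_step C X c =
     {((i, f), (k, f \<cdot>\<^bsub>C\<^esub> ArrMap X u)) | i f k u. (i, f) \<in> colim_carrier C X c \<and> u \<in> hom (Shape X) k i}"

definition colim_rel ::
  "('o, 'a, 'm) cat_scheme \<Rightarrow> ('i, 'o, 'a) diagram \<Rightarrow> 'o \<Rightarrow> (('i \<times> 'a) \<times> ('i \<times> 'a)) set" where
  "colim_rel C X c = (colim_step C X c \<union> (colim_step C X c)\<inverse>)\<^sup>*"

definition colim ::
  "('o, 'a, 'm) cat_scheme \<Rightarrow> ('i, 'o, 'a) diagram \<Rightarrow> 'o \<Rightarrow> ('i \<times> 'a) set set" where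
  "colim C X c = colim_carrier C X c // colim_rel C X c"

text \<open>Elements of a colimit are classes of representatives, and all operations below are given on
  representatives: \<open>colim_class C X c S\<close> is the class spanned by a set \<open>S\<close> of (equivalent)
  representatives.\<close>

abbreviation colim_class ::
  "('o, 'a, 'm) cat_scheme \<Rightarrow> ('i, 'o, 'a) diagram \<Rightarrow> 'o \<Rightarrow> ('i \<times> 'a) set \<Rightarrow> ('i \<times> 'a) set" where
  "colim_class C X c S \<equiv> colim_rel C X c `` S"

definition pro_hom ::
  "('o, 'a, 'm) cat_scheme \<Rightarrow> ('i, 'o, 'a) diagram \<Rightarrow> ('i, 'o, 'a) diagram
    \<Rightarrow> ('i \<Rightarrow> ('i \<times> 'a) set) set" where
  "pro_hom C X Y =
     {F \<in> (\<Pi>\<^sub>E j\<in>Obj (Shape Y). colim C X (ObjMap Y j)).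
       \<forall>j j'. \<forall>v\<in>hom (Shape Y) j j'.
         colim_class C X (ObjMap Y j') {(i, ArrMap Y v \<cdot>\<^bsub>C\<^esub> f) | i f. (i, f) \<in> F j} = F j'}"

type_synonym ('i, 'o, 'a) pro_arrow =
  "('i, 'o, 'a) diagram \<times> ('i, 'o, 'a) diagram \<times> ('i \<Rightarrow> ('i \<times> 'a) set)"

text \<open>\<open>pro_arr C X Y S\<close> is the arrow whose component at \<open>j\<close> is represented by the elements
  of \<open>S j\<close>.\<close>

definition pro_arr ::
  "('o, 'a, 'm) cat_scheme \<Rightarrow> ('i, 'o, 'a) diagram \<Rightarrow> ('i, 'o, 'a) diagram
    \<Rightarrow> ('i \<Rightarrow> ('i \<times> 'a) set) \<Rightarrow> ('i, 'o, 'a) pro_arrow" where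
  "pro_arr C X Y S = (X, Y, \<lambda>j\<in>Obj (Shape Y). colim_class C X (ObjMap Y j) (S j))"

definition pro ::
  "('o, 'a, 'm) cat_scheme \<Rightarrow> (('i, 'o, 'a) diagram, ('i, 'o, 'a) pro_arrow) cat" where
  "pro C =
    \<lparr>Obj = pro_objects C,
     Arr = {(X, Y, F). X \<in> pro_objects C \<and> Y \<in> pro_objects C \<and> F \<in> pro_hom C X Y},
     Dom = (\<lambda>(X, Y, F). X),
     Cod = (\<lambda>(X, Y, F). Y),
     Ident = (\<lambda>X. pro_arr C X X (\<lambda>i. {(i, Ident C (ObjMap X i))})),
     Comp = (\<lambda>(Y', Z, G) (X, Y, F).
       pro_arr C X Z (\<lambda>k. {(i, g \<cdot>\<^bsub>C\<^esub> f) | i f j g. (j, g) \<in> G k \<and> (i, f) \<in> F j}))\<rparr>"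


section \<open>The category ProDet\<close>

text \<open>The index type is assumed infinite where products of shapes are formed, so that
  \<open>idx_pair\<close> is injective.\<close>

definition idx_pair :: "'i \<times> 'i \<Rightarrow> 'i" where
  "idx_pair = (SOME p. inj p)"

definition idx_fst :: "'i \<Rightarrow> 'i" where
  "idx_fst l = fst (inv idx_pair l)"

definition idx_snd :: "'i \<Rightarrow> 'i" where
  "idx_snd l = snd (inv idx_pair l)"

definition idx_star :: "'i" where
  "idx_star = (SOME l. True)"

definition prod_shape :: "('i, 'i) cat \<Rightarrow> ('i, 'i) cat \<Rightarrow> ('i, 'i) cat" where
  "prod_shape I J =
    \<lparr>Obj = idx_pair ` (Obj I \<times> Obj J),
     Arr = idx_pair ` (Arr I \<times> Arr J),
     Dom = (\<lambda>w. idx_pair (Dom I (idx_fst w), Dom J (idx_snd w))),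
     Cod = (\<lambda>w. idx_pair (Cod I (idx_fst w), Cod J (idx_snd w))),
     Ident = (\<lambda>l. idx_pair (Ident I (idx_fst l), Ident J (idx_snd l))),
     Comp = (\<lambda>w' w. idx_pair (idx_fst w' \<cdot>\<^bsub>I\<^esub> idx_fst w, idx_snd w' \<cdot>\<^bsub>J\<^esub> idx_snd w))\<rparr>"

definition unit_shape :: "('i, 'i) cat" where
  "unit_shape = \<lparr>Obj = {idx_star}, Arr = {idx_star}, Dom = (\<lambda>_. idx_star), Cod = (\<lambda>_. idx_star),
     Ident = (\<lambda>_. idx_star), Comp = (\<lambda>_ _. idx_star)\<rparr>"

definition const_diagram :: "('o, 'a, 'm) cat_scheme \<Rightarrow> 'o \<Rightarrow> ('i, 'o, 'a) diagram" where
  "const_diagram C c =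
    \<lparr>Shape = unit_shape, ObjMap = (\<lambda>_. c), ArrMap = (\<lambda>_. Ident C c)\<rparr>"

text \<open>The limit of \<open>X' \<otimes> Y'\<close> over all pairs \<open>X \<rightarrow> X'\<close>, \<open>Y \<rightarrow> Y'\<close> is presented by the
  small diagram \<open>(i, j) \<mapsto> X\<^sub>i \<otimes> Y\<^sub>j\<close>, the canonical projections \<open>X \<rightarrow> X\<^sub>i\<close> and
  \<open>Y \<rightarrow> Y\<^sub>j\<close> being initial among all such pairs.  See \<open>prodet_tensor_limit\<close> below.\<close>

definition pro_tensor ::
  "('o, 'a, 'm) markov_scheme \<Rightarrow> ('i, 'o, 'a) diagram \<Rightarrow> ('i, 'o, 'a) diagram
    \<Rightarrow> ('i, 'o, 'a) diagram" where
  "pro_tensor C X Y =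
    \<lparr>Shape = prod_shape (Shape X) (Shape Y),
     ObjMap = (\<lambda>l. ObjMap X (idx_fst l) \<otimes>\<^bsub>C\<^esub> ObjMap Y (idx_snd l)),
     ArrMap = (\<lambda>w. ArrMap X (idx_fst w) \<boxtimes>\<^bsub>C\<^esub> ArrMap Y (idx_snd w))\<rparr>"

text \<open>The full subcategory of \<open>Pro(C)\<close> on the formal limits of diagrams that factorize
  through \<open>det C\<close>.\<close>

definition prodet_cat ::
  "('o, 'a, 'm) markov_scheme
    \<Rightarrow> (('i, 'o, 'a) diagram, ('i, 'o, 'a) pro_arrow) cat" where
  "prodet_cat C =
     full_subcat (pro C)
       {X. is_functor (Shape X) (det C) (ObjMap X) (ArrMap X)}"

definition pro_tensor_arr ::
  "('o, 'a, 'm) markov_scheme \<Rightarrow> ('i, 'o, 'a) pro_arrow \<Rightarrow> ('i, 'o, 'a) pro_arrow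
    \<Rightarrow> ('i, 'o, 'a) pro_arrow" where
  "pro_tensor_arr C = (\<lambda>(X, Y, F) (X', Y', F').
     pro_arr C (pro_tensor C X X') (pro_tensor C Y Y')
       (\<lambda>l. {(idx_pair (i, i'), f \<boxtimes>\<^bsub>C\<^esub> f') | i f i' f'.
              (i, f) \<in> F (idx_fst l) \<and> (i', f') \<in> F' (idx_snd l)}))"

definition pro_unit :: "('o, 'a, 'm) markov_scheme \<Rightarrow> ('i, 'o, 'a) diagram" where
  "pro_unit C = const_diagram C (Unit C)"

definition pro_assoc ::
  "('o, 'a, 'm) markov_scheme \<Rightarrow> ('i, 'o, 'a) diagram \<Rightarrow> ('i, 'o, 'a) diagram
    \<Rightarrow> ('i, 'o, 'a) diagram \<Rightarrow> ('i, 'o, 'a) pro_arrow" where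
  "pro_assoc C X Y Z =
     pro_arr C (pro_tensor C (pro_tensor C X Y) Z) (pro_tensor C X (pro_tensor C Y Z))
       (\<lambda>l. let i = idx_fst l; j = idx_fst (idx_snd l); k = idx_snd (idx_snd l)
            in {(idx_pair (idx_pair (i, j), k),
                 Assoc C (ObjMap X i) (ObjMap Y j) (ObjMap Z k))})"

definition pro_lunit ::
  "('o, 'a, 'm) markov_scheme \<Rightarrow> ('i, 'o, 'a) diagram \<Rightarrow> ('i, 'o, 'a) pro_arrow" where
  "pro_lunit C X = pro_arr C (pro_tensor C (pro_unit C) X) X
     (\<lambda>i. {(idx_pair (idx_star, i), LUnit C (ObjMap X i))})"

definition pro_runit ::
  "('o, 'a, 'm) markov_scheme \<Rightarrow> ('i, 'o, 'a) diagram \<Rightarrow> ('i, 'o, 'a) pro_arrow" where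
  "pro_runit C X = pro_arr C (pro_tensor C X (pro_unit C)) X
     (\<lambda>i. {(idx_pair (i, idx_star), RUnit C (ObjMap X i))})"

definition pro_swap ::
  "('o, 'a, 'm) markov_scheme \<Rightarrow> ('i, 'o, 'a) diagram \<Rightarrow> ('i, 'o, 'a) diagram
    \<Rightarrow> ('i, 'o, 'a) pro_arrow" where
  "pro_swap C X Y = pro_arr C (pro_tensor C X Y) (pro_tensor C Y X)
     (\<lambda>l. let j = idx_fst l; i = idx_snd l
          in {(idx_pair (i, j), Swap C (ObjMap X i) (ObjMap Y j))})"

text \<open>The component of the copy map at the index \<open>(i, i')\<close> of \<open>X \<otimes> X\<close> is represented by
  \<open>(X\<^sub>u \<boxtimes> X\<^sub>v) \<cdot> copy\<close> for any \<open>u : k \<rightarrow> i\<close> and \<open>v : k \<rightarrow> i'\<close>; at \<open>(i, i)\<close> it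
  is the projection \<open>X \<rightarrow> X\<^sub>i\<close> followed by \<open>copy\<close>.  See \<open>prodet_copy_component\<close> below.\<close>

definition pro_copy ::
  "('o, 'a, 'm) markov_scheme \<Rightarrow> ('i, 'o, 'a) diagram \<Rightarrow> ('i, 'o, 'a) pro_arrow" where
  "pro_copy C X = pro_arr C X (pro_tensor C X X)
     (\<lambda>l. {(k, (ArrMap X u \<boxtimes>\<^bsub>C\<^esub> ArrMap X v) \<cdot>\<^bsub>C\<^esub> Copy C (ObjMap X k)) | k u v.
            u \<in> hom (Shape X) k (idx_fst l) \<and> v \<in> hom (Shape X) k (idx_snd l)})"

definition pro_del ::
  "('o, 'a, 'm) markov_scheme \<Rightarrow> ('i, 'o, 'a) diagram \<Rightarrow> ('i, 'o, 'a) pro_arrow" where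
  "pro_del C X = pro_arr C X (pro_unit C)
     (\<lambda>_. {(i, Del C (ObjMap X i)) | i. i \<in> Obj (Shape X)})"

definition prodet ::
  "('o, 'a, 'm) markov_scheme
    \<Rightarrow> (('i, 'o, 'a) diagram, ('i, 'o, 'a) pro_arrow) markov" where
  "prodet C =
    \<lparr>Obj = Obj (prodet_cat C), Arr = Arr (prodet_cat C),
     Dom = Dom (prodet_cat C), Cod = Cod (prodet_cat C),
     Ident = Ident (prodet_cat C), Comp = Comp (prodet_cat C),
     TensorObj = pro_tensor C, TensorArr = pro_tensor_arr C, Unit = pro_unit C,
     Assoc = pro_assoc C, LUnit = pro_lunit C, RUnit = pro_runit C, Swap = pro_swap C,
     Copy = pro_copy C, Del = pro_del C\<rparr>"

text \<open>The action on arrows of the canonical functor \<open>Pro(det C) \<rightarrow> Pro(C)\<close>, which is the identity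
  on diagrams.\<close>

definition pro_det_incl ::
  "('o, 'a, 'm) markov_scheme \<Rightarrow> ('i, 'o, 'a) pro_arrow \<Rightarrow> ('i, 'o, 'a) pro_arrow" where
  "pro_det_incl C = (\<lambda>(X, Y, F). pro_arr C X Y F)"

section \<open>The tensor as a limit\<close>

text \<open>The embedding of \<open>C\<close> into \<open>Pro(C)\<close> on arrows; on objects it is
  \<open>const_diagram\<close>.\<close>

definition pro_const_arr :: "('o, 'a, 'm) cat_scheme \<Rightarrow> 'a \<Rightarrow> ('i, 'o, 'a) pro_arrow" where
  "pro_const_arr C a =
     pro_arr C (const_diagram C (Dom C a)) (const_diagram C (Cod C a)) (\<lambda>_. {(idx_star, a)})"

text \<open>The projection \<open>X \<otimes> Y \<rightarrow> c \<otimes> d\<close> determined by \<open>X \<rightarrow> c\<close> and \<open>Y \<rightarrow> d\<close>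
  in \<open>Pro(det C)\<close>.\<close>

definition tensor_leg ::
  "('o, 'a, 'm) markov_scheme \<Rightarrow> 'o \<Rightarrow> 'o \<Rightarrow> ('i, 'o, 'a) pro_arrow \<Rightarrow> ('i, 'o, 'a) pro_arrow
    \<Rightarrow> ('i, 'o, 'a) pro_arrow" where
  "tensor_leg C c d = (\<lambda>(X, _, F) (Y, _, G).
     pro_arr C (pro_tensor C X Y) (const_diagram C (c \<otimes>\<^bsub>C\<^esub> d))
       (\<lambda>l. {(idx_pair (i, j), f \<boxtimes>\<^bsub>C\<^esub> g) | i f j g. (i, f) \<in> F l \<and> (j, g) \<in> G l}))"

lemma homI: "f \<in> Arr C \<Longrightarrow> Dom C f = x \<Longrightarrow> Cod C f = y \<Longrightarrow> f \<in> hom C x y"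
  by (simp add: hom_def)

lemma pro_object_shape:
  assumes "X \<in> pro_objects C"
  shows "category (Shape X)" "category C"
    "i \<in> Obj (Shape X) \<Longrightarrow> ObjMap X i \<in> Obj C"
    "u \<in> hom (Shape X) k i \<Longrightarrow> ArrMap X u \<in> hom C (ObjMap X k) (ObjMap X i)"
    "u \<in> hom (Shape X) k i \<Longrightarrow> v \<in> hom (Shape X) l k
      \<Longrightarrow> ArrMap X (u \<cdot>\<^bsub>Shape X\<^esub> v) = ArrMap X u \<cdot>\<^bsub>C\<^esub> ArrMap X v"
    "i \<in> Obj (Shape X) \<Longrightarrow> ArrMap X (Ident (Shape X) i) = Ident C (ObjMap X i)"
  using assms by (auto simp: pro_objects_def is_functor_def hom_def)

lemma hom_obj:
  assumes "category C" "f \<in> hom C x y"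
  shows "x \<in> Obj C" "y \<in> Obj C"
  using assms category.dom_obj category.cod_obj by (fastforce simp: hom_def)+

lemma pro_object_cofiltered:
  assumes "X \<in> pro_objects C"
  shows "Obj (Shape X) \<noteq> {}"
    "x \<in> Obj (Shape X) \<Longrightarrow> y \<in> Obj (Shape X)
      \<Longrightarrow> \<exists>z u v. u \<in> hom (Shape X) z x \<and> v \<in> hom (Shape X) z y"
    "u \<in> hom (Shape X) x y \<Longrightarrow> v \<in> hom (Shape X) x y
      \<Longrightarrow> \<exists>w e. e \<in> hom (Shape X) w x \<and> u \<cdot>\<^bsub>Shape X\<^esub> e = v \<cdot>\<^bsub>Shape X\<^esub> e"
  using assms unfolding pro_objects_def cofiltered_def by blast+

definition refines ::
  "('o, 'a, 'm) cat_scheme \<Rightarrow> ('i, 'o, 'a) diagram \<Rightarrow> 'i \<times> 'a \<Rightarrow> 'i \<times> 'a \<Rightarrow> bool" where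
  "refines C X p q \<longleftrightarrow> (\<exists>k u v. u \<in> hom (Shape X) k (fst p) \<and> v \<in> hom (Shape X) k (fst q) \<and>
     snd p \<cdot>\<^bsub>C\<^esub> ArrMap X u = snd q \<cdot>\<^bsub>C\<^esub> ArrMap X v)"

lemma refines_sym: "refines C X p q \<Longrightarrow> refines C X q p"
  unfolding refines_def by metis

lemma colim_step_carrier:
  assumes X: "X \<in> pro_objects C" and s: "(p, q) \<in> colim_step C X c"
  shows "p \<in> colim_carrier C X c" "q \<in> colim_carrier C X c" "refines C X p q"
proof -
  note P = pro_object_shape[OF X]
  from s obtain i f k u where pq: "p = (i, f)" "q = (k, f \<cdot>\<^bsub>C\<^esub> ArrMap X u)"
    and c: "(i, f) \<in> colim_carrier C X c" and u: "u \<in> hom (Shape X) k i"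
    by (auto simp: colim_step_def)
  have f: "f \<in> hom C (ObjMap X i) c" using c by (simp add: colim_carrier_def)
  have k: "k \<in> Obj (Shape X)" using hom_obj[OF P(1) u] by simp
  show "p \<in> colim_carrier C X c" using c pq by simp
  have fu: "f \<cdot>\<^bsub>C\<^esub> ArrMap X u \<in> hom C (ObjMap X k) c"
    using category.comp_hom[OF P(2) P(4)[OF u] f] .
  show "q \<in> colim_carrier C X c"
    using pq k fu by (simp add: colim_carrier_def)
  have "(f \<cdot>\<^bsub>C\<^esub> ArrMap X u) \<cdot>\<^bsub>C\<^esub> ArrMap X (Ident (Shape X) k) = f \<cdot>\<^bsub>C\<^esub> ArrMap X u"
    using P(6)[OF k] category.comp_ident_right[OF P(2) fu] by simp
  then show "refines C X p q"
    unfolding refines_def pq using u category.ident_hom[OF P(1) k] by force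
qed

lemma refines_trans:
  assumes X: "X \<in> pro_objects C"
    and p: "p \<in> colim_carrier C X c" and q: "q \<in> colim_carrier C X c" and r: "r \<in> colim_carrier C X c"
    and "refines C X p q" "refines C X q r"
  shows "refines C X p r"
proof -
  note P = pro_object_shape[OF X]
  note as = category.comp_assoc[OF P(2)] category.comp_assoc[OF P(1)]
  note ch = category.comp_hom[OF P(1)]
  obtain k u v where k: "u \<in> hom (Shape X) k (fst p)" "v \<in> hom (Shape X) k (fst q)"
     "snd p \<cdot>\<^bsub>C\<^esub> ArrMap X u = snd q \<cdot>\<^bsub>C\<^esub> ArrMap X v" using assms(5) by (auto simp: refines_def)
  obtain k' u' v' where k': "u' \<in> hom (Shape X) k' (fst q)" "v' \<in> hom (Shape X) k' (fst r)"
     "snd q \<cdot>\<^bsub>C\<^esub> ArrMap X u' = snd r \<cdot>\<^bsub>C\<^esub> ArrMap X v'" using assms(6) by (auto simp: refines_def)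
  obtain z a b where z: "a \<in> hom (Shape X) z k" "b \<in> hom (Shape X) z k'"
    using pro_object_cofiltered(2)[OF X] hom_obj[OF P(1) k(1)] hom_obj[OF P(1) k'(1)] by blast
  obtain w e where e: "e \<in> hom (Shape X) w z"
      "(v \<cdot>\<^bsub>Shape X\<^esub> a) \<cdot>\<^bsub>Shape X\<^esub> e = (u' \<cdot>\<^bsub>Shape X\<^esub> b) \<cdot>\<^bsub>Shape X\<^esub> e"
    using pro_object_cofiltered(3)[OF X ch[OF z(1) k(2)] ch[OF z(2) k'(1)]] by blast
  have sp: "snd p \<in> hom C (ObjMap X (fst p)) c" "snd q \<in> hom C (ObjMap X (fst q)) c"
     "snd r \<in> hom C (ObjMap X (fst r)) c"
    using p q r by (auto simp: colim_carrier_def)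
  define a' where "a' = a \<cdot>\<^bsub>Shape X\<^esub> e"
  define b' where "b' = b \<cdot>\<^bsub>Shape X\<^esub> e"
  have ab: "a' \<in> hom (Shape X) w k" "b' \<in> hom (Shape X) w k'"
    using ch[OF e(1) z(1)] ch[OF e(1) z(2)] by (simp_all add: a'_def b'_def)
  have eq: "v \<cdot>\<^bsub>Shape X\<^esub> a' = u' \<cdot>\<^bsub>Shape X\<^esub> b'"
    using e(2) as(2)[OF e(1) z(1) k(2)] as(2)[OF e(1) z(2) k'(1)] by (simp add: a'_def b'_def)
  have "snd p \<cdot>\<^bsub>C\<^esub> ArrMap X (u \<cdot>\<^bsub>Shape X\<^esub> a') = (snd p \<cdot>\<^bsub>C\<^esub> ArrMap X u) \<cdot>\<^bsub>C\<^esub> ArrMap X a'"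
    using P(5)[OF k(1) ab(1)] as(1)[OF P(4)[OF ab(1)] P(4)[OF k(1)] sp(1)] by simp
  also have "\<dots> = snd q \<cdot>\<^bsub>C\<^esub> ArrMap X (v \<cdot>\<^bsub>Shape X\<^esub> a')"
    using k(3) P(5)[OF k(2) ab(1)] as(1)[OF P(4)[OF ab(1)] P(4)[OF k(2)] sp(2)] by simp
  also have "\<dots> = (snd q \<cdot>\<^bsub>C\<^esub> ArrMap X u') \<cdot>\<^bsub>C\<^esub> ArrMap X b'"
    using eq P(5)[OF k'(1) ab(2)] as(1)[OF P(4)[OF ab(2)] P(4)[OF k'(1)] sp(2)] by simp
  also have "\<dots> = snd r \<cdot>\<^bsub>C\<^esub> ArrMap X (v' \<cdot>\<^bsub>Shape X\<^esub> b')"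
    using k'(3) P(5)[OF k'(2) ab(2)] as(1)[OF P(4)[OF ab(2)] P(4)[OF k'(2)] sp(3)] by simp
  finally show ?thesis
    unfolding refines_def using ch[OF ab(1) k(1)] ch[OF ab(2) k'(2)] by blast
qed

lemma refines_refl:
  assumes X: "X \<in> pro_objects C" and p: "p \<in> colim_carrier C X c"
  shows "refines C X p p"
proof -
  have "fst p \<in> Obj (Shape X)" using p by (auto simp: colim_carrier_def)
  then show ?thesis
    unfolding refines_def using category.ident_hom[OF pro_object_shape(1)[OF X]] by metis
qed

lemma colim_rel_iff:
  assumes X: "X \<in> pro_objects C" and p: "p \<in> colim_carrier C X c"
  shows "(p, q) \<in> colim_rel C X c \<longleftrightarrow> q \<in> colim_carrier C X c \<and> refines C X p q"
proof
  assume "(p, q) \<in> colim_rel C X c"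
  then show "q \<in> colim_carrier C X c \<and> refines C X p q"
    unfolding colim_rel_def
  proof (induction rule: rtrancl_induct)
    case base
    then show ?case using p refines_refl[OF X p] by simp
  next
    case (step y z)
    have "y \<in> colim_carrier C X c" "z \<in> colim_carrier C X c" "refines C X y z"
      using step.hyps(2) colim_step_carrier[OF X] refines_sym by (metis Un_iff converse_iff)+
    then show ?case using refines_trans[OF X p] step.IH by blast
  qed
next
  assume a: "q \<in> colim_carrier C X c \<and> refines C X p q"
  then obtain k u v where k: "u \<in> hom (Shape X) k (fst p)" "v \<in> hom (Shape X) k (fst q)"
    and e: "snd p \<cdot>\<^bsub>C\<^esub> ArrMap X u = snd q \<cdot>\<^bsub>C\<^esub> ArrMap X v" by (auto simp: refines_def)
  have 1: "(p, (k, snd p \<cdot>\<^bsub>C\<^esub> ArrMap X u)) \<in> colim_step C X c"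
    using p k(1) unfolding colim_step_def by force
  have 2: "(q, (k, snd q \<cdot>\<^bsub>C\<^esub> ArrMap X v)) \<in> colim_step C X c"
    using a k(2) unfolding colim_step_def by force
  show "(p, q) \<in> colim_rel C X c"
    unfolding colim_rel_def
  proof (rule converse_rtrancl_into_rtrancl)
    show "(p, (k, snd p \<cdot>\<^bsub>C\<^esub> ArrMap X u)) \<in> colim_step C X c \<union> (colim_step C X c)\<inverse>" using 1 by blast
    show "((k, snd p \<cdot>\<^bsub>C\<^esub> ArrMap X u), q) \<in> (colim_step C X c \<union> (colim_step C X c)\<inverse>)\<^sup>*"
      using 2 e by auto
  qed
qed

abbreviation cls where "cls C X c p \<equiv> colim_rel C X c `` {p}"

lemma colim_rel_sym: "sym (colim_rel C X c)"
  unfolding colim_rel_def by (intro sym_rtrancl sym_Un_converse)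

lemma colim_rel_trans: "trans (colim_rel C X c)"
  unfolding colim_rel_def by (rule trans_rtrancl)

lemma colim_rel_refl: "(p, p) \<in> colim_rel C X c"
  unfolding colim_rel_def by simp

lemma cls_eq: "cls C X c p = cls C X c q \<longleftrightarrow> (p, q) \<in> colim_rel C X c"
proof -
  have "equiv UNIV (colim_rel C X c)"
    by (rule equivI) (use colim_rel_sym colim_rel_trans colim_rel_refl in \<open>auto simp: refl_on_def\<close>)
  then show ?thesis by (simp add: equiv_class_eq_iff[of UNIV])
qed

lemma class_eqI:
  assumes "p \<in> S" "\<And>q. q \<in> S \<Longrightarrow> (q, p) \<in> colim_rel C X c"
  shows "colim_class C X c S = cls C X c p"
proof
  show "colim_class C X c S \<subseteq> cls C X c p"
  proof
    fix r assume "r \<in> colim_class C X c S"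
    then obtain q where q: "q \<in> S" "(q, r) \<in> colim_rel C X c" by blast
    have "(p, q) \<in> colim_rel C X c" using assms(2)[OF q(1)] colim_rel_sym[of C X c] by (rule symD[rotated])
    then have "(p, r) \<in> colim_rel C X c" using transD[OF colim_rel_trans _ q(2)] by blast
    then show "r \<in> cls C X c p" by simp
  qed
qed (use assms(1) in blast)

lemma cls_in_colim: "p \<in> colim_carrier C X c \<Longrightarrow> cls C X c p \<in> colim C X c"
  unfolding colim_def by (rule quotientI)

lemma colimE:
  assumes "S \<in> colim C X c"
  obtains i f where "(i, f) \<in> colim_carrier C X c" "S = cls C X c (i, f)"
  using assms unfolding colim_def by (auto elim!: quotientE)

lemma in_cls: "p \<in> cls C X c q \<longleftrightarrow> (q, p) \<in> colim_rel C X c" by simp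

lemma colim_rel_post:
  assumes X: "X \<in> pro_objects C" and r: "((i, f), (i', f')) \<in> colim_rel C X c"
    and c: "(i, f) \<in> colim_carrier C X c" and g: "g \<in> hom C c d"
  shows "((i, g \<cdot>\<^bsub>C\<^esub> f), (i', g \<cdot>\<^bsub>C\<^esub> f')) \<in> colim_rel C X d"
proof -
  note P = pro_object_shape[OF X]
  have c': "(i', f') \<in> colim_carrier C X c" "refines C X (i, f) (i', f')"
    using r colim_rel_iff[OF X c] by auto
  then obtain k u v where k: "u \<in> hom (Shape X) k i" "v \<in> hom (Shape X) k i'"
     "f \<cdot>\<^bsub>C\<^esub> ArrMap X u = f' \<cdot>\<^bsub>C\<^esub> ArrMap X v" by (auto simp: refines_def)
  have f: "f \<in> hom C (ObjMap X i) c" "f' \<in> hom C (ObjMap X i') c" "i \<in> Obj (Shape X)" "i' \<in> Obj (Shape X)"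
    using c c' by (auto simp: colim_carrier_def)
  have "(g \<cdot>\<^bsub>C\<^esub> f) \<cdot>\<^bsub>C\<^esub> ArrMap X u = (g \<cdot>\<^bsub>C\<^esub> f') \<cdot>\<^bsub>C\<^esub> ArrMap X v"
    using category.comp_assoc[OF P(2) P(4)[OF k(1)] f(1) g] category.comp_assoc[OF P(2) P(4)[OF k(2)] f(2) g] k(3)
    by simp
  then have "refines C X (i, g \<cdot>\<^bsub>C\<^esub> f) (i', g \<cdot>\<^bsub>C\<^esub> f')" unfolding refines_def using k by auto
  moreover have "(i, g \<cdot>\<^bsub>C\<^esub> f) \<in> colim_carrier C X d" "(i', g \<cdot>\<^bsub>C\<^esub> f') \<in> colim_carrier C X d"
    using f category.comp_hom[OF P(2) _ g] by (auto simp: colim_carrier_def)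
  ultimately show ?thesis using colim_rel_iff[OF X] by blast
qed

lemma carrier_post:
  assumes "category C" "(i, f) \<in> colim_carrier C X c" "g \<in> hom C c d"
  shows "(i, g \<cdot>\<^bsub>C\<^esub> f) \<in> colim_carrier C X d"
  using assms category.comp_hom[OF assms(1)] by (auto simp: colim_carrier_def)

lemma push_cls:
  assumes X: "X \<in> pro_objects C" and c: "(i, f) \<in> colim_carrier C X c" and g: "g \<in> hom C c d"
  shows "colim_class C X d {(i', g \<cdot>\<^bsub>C\<^esub> f') | i' f'. (i', f') \<in> cls C X c (i, f)} = cls C X d (i, g \<cdot>\<^bsub>C\<^esub> f)"
proof (rule class_eqI)
  show "(i, g \<cdot>\<^bsub>C\<^esub> f) \<in> {(i', g \<cdot>\<^bsub>C\<^esub> f') | i' f'. (i', f') \<in> cls C X c (i, f)}"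
    using colim_rel_refl[of "(i, f)" C X c] by auto
  fix q assume "q \<in> {(i', g \<cdot>\<^bsub>C\<^esub> f') | i' f'. (i', f') \<in> cls C X c (i, f)}"
  then obtain i' f' where q: "q = (i', g \<cdot>\<^bsub>C\<^esub> f')" and r: "((i, f), (i', f')) \<in> colim_rel C X c"
    by auto
  show "(q, (i, g \<cdot>\<^bsub>C\<^esub> f)) \<in> colim_rel C X d"
    unfolding q by (rule symD[OF colim_rel_sym colim_rel_post[OF X r c g]])
qed

lemma pro_hom_component:
  assumes "F \<in> pro_hom C X Y" "j \<in> Obj (Shape Y)"
  obtains i f where "(i, f) \<in> colim_carrier C X (ObjMap Y j)" "F j = cls C X (ObjMap Y j) (i, f)"
  using assms by (auto simp: pro_hom_def elim!: colimE dest!: PiE_mem)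

lemma pro_hom_push:
  assumes X: "X \<in> pro_objects C" and Y: "Y \<in> pro_objects C" and F: "F \<in> pro_hom C X Y"
    and v: "v \<in> hom (Shape Y) j j'"
    and c: "(i, f) \<in> colim_carrier C X (ObjMap Y j)" and e: "F j = cls C X (ObjMap Y j) (i, f)"
  shows "F j' = cls C X (ObjMap Y j') (i, ArrMap Y v \<cdot>\<^bsub>C\<^esub> f)"
proof -
  have "F j' = colim_class C X (ObjMap Y j') {(i, ArrMap Y v \<cdot>\<^bsub>C\<^esub> f) | i f. (i, f) \<in> F j}"
    using F v by (auto simp: pro_hom_def)
  then show ?thesis using push_cls[OF X c pro_object_shape(4)[OF Y v]] e by simp
qed

lemma pro_homI:
  assumes X: "X \<in> pro_objects C" and Y: "Y \<in> pro_objects C"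
    and ext: "F \<in> extensional (Obj (Shape Y))"
    and rep: "\<And>j. j \<in> Obj (Shape Y) \<Longrightarrow> r j \<in> colim_carrier C X (ObjMap Y j) \<and> F j = cls C X (ObjMap Y j) (r j)"
    and cmp: "\<And>j j' v. v \<in> hom (Shape Y) j j' \<Longrightarrow>
      (r j', (fst (r j), ArrMap Y v \<cdot>\<^bsub>C\<^esub> snd (r j))) \<in> colim_rel C X (ObjMap Y j')"
  shows "F \<in> pro_hom C X Y"
proof -
  have "colim_class C X (ObjMap Y j') {(i, ArrMap Y v \<cdot>\<^bsub>C\<^esub> f) | i f. (i, f) \<in> F j} = F j'"
    if v: "v \<in> hom (Shape Y) j j'" for j j' v
  proof -
    have j: "j \<in> Obj (Shape Y)" "j' \<in> Obj (Shape Y)" using hom_obj[OF pro_object_shape(1)[OF Y] v] by auto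
    have "colim_class C X (ObjMap Y j') {(i, ArrMap Y v \<cdot>\<^bsub>C\<^esub> f) | i f. (i, f) \<in> F j} =
       cls C X (ObjMap Y j') (fst (r j), ArrMap Y v \<cdot>\<^bsub>C\<^esub> snd (r j))"
      using push_cls[OF X _ pro_object_shape(4)[OF Y v], of "fst (r j)" "snd (r j)"] rep[OF j(1)] by simp
    also have "\<dots> = cls C X (ObjMap Y j') (r j')"
      by (rule sym) (simp only: cls_eq cmp[OF v])
    finally show ?thesis using rep[OF j(2)] by simp
  qed
  moreover have "F j \<in> colim C X (ObjMap Y j)" if "j \<in> Obj (Shape Y)" for j
    using rep[OF that] cls_in_colim[of "r j" C X "ObjMap Y j"] by simp
  then have "F \<in> (\<Pi>\<^sub>E j\<in>Obj (Shape Y). colim C X (ObjMap Y j))"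
    using ext by (simp add: PiE_iff)
  ultimately show ?thesis unfolding pro_hom_def by blast
qed

lemma pro_comp_component:
  assumes X: "X \<in> pro_objects C" and Y: "Y \<in> pro_objects C"
    and F: "F \<in> pro_hom C X Y"
    and cg: "(j, g) \<in> colim_carrier C Y d" and G: "G = cls C Y d (j, g)"
    and cf: "(i, f) \<in> colim_carrier C X (ObjMap Y j)" and Fj: "F j = cls C X (ObjMap Y j) (i, f)"
  shows "colim_class C X d {(i, g \<cdot>\<^bsub>C\<^esub> f) | i f j g. (j, g) \<in> G \<and> (i, f) \<in> F j} = cls C X d (i, g \<cdot>\<^bsub>C\<^esub> f)"
proof (rule class_eqI)
  note PX = pro_object_shape[OF X] and PY = pro_object_shape[OF Y]
  show "(i, g \<cdot>\<^bsub>C\<^esub> f) \<in> {(i, g \<cdot>\<^bsub>C\<^esub> f) | i f j g. (j, g) \<in> G \<and> (i, f) \<in> F j}"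
    using G Fj colim_rel_refl[of "(j, g)" C Y d] colim_rel_refl[of "(i, f)" C X "ObjMap Y j"] by auto
  fix q assume "q \<in> {(i, g \<cdot>\<^bsub>C\<^esub> f) | i f j g. (j, g) \<in> G \<and> (i, f) \<in> F j}"
  then obtain i' f' j' g' where q: "q = (i', g' \<cdot>\<^bsub>C\<^esub> f')" and g': "(j', g') \<in> G" and f': "(i', f') \<in> F j'"
    by auto
  have cg': "(j', g') \<in> colim_carrier C Y d" and "refines C Y (j, g) (j', g')"
    using g' G colim_rel_iff[OF Y cg] by auto
  then obtain m u v where m: "u \<in> hom (Shape Y) m j" "v \<in> hom (Shape Y) m j'"
     "g \<cdot>\<^bsub>C\<^esub> ArrMap Y u = g' \<cdot>\<^bsub>C\<^esub> ArrMap Y v" by (auto simp: refines_def)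
  have mO: "m \<in> Obj (Shape Y)" using hom_obj[OF PY(1) m(1)] by simp
  obtain l h where lh: "(l, h) \<in> colim_carrier C X (ObjMap Y m)" "F m = cls C X (ObjMap Y m) (l, h)"
    using pro_hom_component[OF F mO] by blast
  have h: "h \<in> hom C (ObjMap X l) (ObjMap Y m)" using lh by (simp add: colim_carrier_def)
  have gh: "g \<in> hom C (ObjMap Y j) d" "g' \<in> hom C (ObjMap Y j') d"
    using cg cg' by (auto simp: colim_carrier_def)
  have 1: "F j = cls C X (ObjMap Y j) (l, ArrMap Y u \<cdot>\<^bsub>C\<^esub> h)" using pro_hom_push[OF X Y F m(1) lh] .
  have 2: "F j' = cls C X (ObjMap Y j') (l, ArrMap Y v \<cdot>\<^bsub>C\<^esub> h)" using pro_hom_push[OF X Y F m(2) lh] .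
  have r1: "((l, ArrMap Y u \<cdot>\<^bsub>C\<^esub> h), (i, f)) \<in> colim_rel C X (ObjMap Y j)" using 1 Fj cls_eq by metis
  have r2: "((l, ArrMap Y v \<cdot>\<^bsub>C\<^esub> h), (i', f')) \<in> colim_rel C X (ObjMap Y j')" using 2 f' by simp
  have c1: "(l, ArrMap Y u \<cdot>\<^bsub>C\<^esub> h) \<in> colim_carrier C X (ObjMap Y j)"
    using carrier_post[OF PX(2) lh(1) PY(4)[OF m(1)]] .
  have c2: "(l, ArrMap Y v \<cdot>\<^bsub>C\<^esub> h) \<in> colim_carrier C X (ObjMap Y j')"
    using carrier_post[OF PX(2) lh(1) PY(4)[OF m(2)]] .
  have e: "g \<cdot>\<^bsub>C\<^esub> (ArrMap Y u \<cdot>\<^bsub>C\<^esub> h) = g' \<cdot>\<^bsub>C\<^esub> (ArrMap Y v \<cdot>\<^bsub>C\<^esub> h)"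
    using category.comp_assoc[OF PX(2) h PY(4)[OF m(1)] gh(1)]
      category.comp_assoc[OF PX(2) h PY(4)[OF m(2)] gh(2)] m(3) by simp
  have "((l, g \<cdot>\<^bsub>C\<^esub> (ArrMap Y u \<cdot>\<^bsub>C\<^esub> h)), (i, g \<cdot>\<^bsub>C\<^esub> f)) \<in> colim_rel C X d"
    using colim_rel_post[OF X r1 c1 gh(1)] .
  moreover have "((l, g' \<cdot>\<^bsub>C\<^esub> (ArrMap Y v \<cdot>\<^bsub>C\<^esub> h)), q) \<in> colim_rel C X d"
    using colim_rel_post[OF X r2 c2 gh(2)] q by simp
  ultimately show "(q, (i, g \<cdot>\<^bsub>C\<^esub> f)) \<in> colim_rel C X d"
    using e by (metis symD[OF colim_rel_sym] transD[OF colim_rel_trans])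
qed

lemma inj_idx_pair: "inj (idx_pair :: 'i::infinite \<times> 'i \<Rightarrow> 'i)"
proof -
  have "(card_of (UNIV \<times> UNIV :: ('i \<times> 'i) set), card_of (UNIV :: 'i set)) \<in> ordIso"
    using card_of_Times_same_infinite infinite_UNIV by blast
  then obtain f :: "'i \<times> 'i \<Rightarrow> 'i" where "bij_betw f (UNIV \<times> UNIV) UNIV"
    using card_of_ordIso by blast
  then have "inj f" by (simp add: bij_betw_def)
  then show ?thesis unfolding idx_pair_def by (rule someI[of inj f])
qed

lemma idx_simps [simp]:
  "idx_fst (idx_pair (a, b)) = a" "idx_snd (idx_pair (a, b :: 'i::infinite)) = b"
  "idx_pair (a, b) = idx_pair (a', b') \<longleftrightarrow> a = a' \<and> b = b'"
  using inj_idx_pair[where 'i='i] by (auto simp: idx_fst_def idx_snd_def inj_eq)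

lemma prod_shape_hom:
  fixes I :: "('i::infinite, 'i) cat"
  shows "w \<in> hom (prod_shape I J) l m \<longleftrightarrow> (\<exists>u v i j i' j'. w = idx_pair (u, v) \<and> l = idx_pair (i, j) \<and>
     m = idx_pair (i', j') \<and> u \<in> hom I i i' \<and> v \<in> hom J j j')"
  by (auto simp: hom_def prod_shape_def)

lemma prod_shape_simps [simp]:
  fixes I :: "('i::infinite, 'i) cat"
  shows "Obj (prod_shape I J) = idx_pair ` (Obj I \<times> Obj J)"
   "Ident (prod_shape I J) (idx_pair (i, j)) = idx_pair (Ident I i, Ident J j)"
   "idx_pair (u, v) \<cdot>\<^bsub>prod_shape I J\<^esub> idx_pair (u', v') = idx_pair (u \<cdot>\<^bsub>I\<^esub> u', v \<cdot>\<^bsub>J\<^esub> v')"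
  by (auto simp: prod_shape_def)

lemma category_prod_shape:
  fixes I :: "('i::infinite, 'i) cat"
  assumes I: "category I" and J: "category J"
  shows "category (prod_shape I J)"
proof
  fix f assume "f \<in> Arr (prod_shape I J)"
  then show "Dom (prod_shape I J) f \<in> Obj (prod_shape I J)" "Cod (prod_shape I J) f \<in> Obj (prod_shape I J)"
    using category.dom_obj[OF I] category.dom_obj[OF J] category.cod_obj[OF I] category.cod_obj[OF J]
    by (auto simp: prod_shape_def)
next
  fix x assume "x \<in> Obj (prod_shape I J)"
  then show "Ident (prod_shape I J) x \<in> hom (prod_shape I J) x x"
    using category.ident_hom[OF I] category.ident_hom[OF J] by (auto simp: prod_shape_hom)
next
  fix f g x y z assume "f \<in> hom (prod_shape I J) x y" "g \<in> hom (prod_shape I J) y z"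
  then show "g \<cdot>\<^bsub>prod_shape I J\<^esub> f \<in> hom (prod_shape I J) x z"
    using category.comp_hom[OF I] category.comp_hom[OF J] by (fastforce simp: prod_shape_hom)
next
  fix f x y assume "f \<in> hom (prod_shape I J) x y"
  then show "Ident (prod_shape I J) y \<cdot>\<^bsub>prod_shape I J\<^esub> f = f" "f \<cdot>\<^bsub>prod_shape I J\<^esub> Ident (prod_shape I J) x = f"
    using category.comp_ident_left[OF I] category.comp_ident_left[OF J]
     category.comp_ident_right[OF I] category.comp_ident_right[OF J] by (auto simp: prod_shape_hom)
next
  fix f g h w x y z assume "f \<in> hom (prod_shape I J) w x" "g \<in> hom (prod_shape I J) x y" "h \<in> hom (prod_shape I J) y z"
  then show "(h \<cdot>\<^bsub>prod_shape I J\<^esub> g) \<cdot>\<^bsub>prod_shape I J\<^esub> f = h \<cdot>\<^bsub>prod_shape I J\<^esub> (g \<cdot>\<^bsub>prod_shape I J\<^esub> f)"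
    using category.comp_assoc[OF I] category.comp_assoc[OF J] by (auto simp: prod_shape_hom)
qed

lemma cofiltered_prod_shape:
  fixes I :: "('i::infinite, 'i) cat"
  assumes I: "cofiltered I" and J: "cofiltered J"
  shows "cofiltered (prod_shape I J)"
proof -
  have 1: "\<exists>z u v. u \<in> hom (prod_shape I J) z x \<and> v \<in> hom (prod_shape I J) z y"
    if "x \<in> Obj (prod_shape I J)" "y \<in> Obj (prod_shape I J)" for x y
  proof -
    obtain a b a' b' where x: "x = idx_pair (a, b)" "y = idx_pair (a', b')"
      "a \<in> Obj I" "b \<in> Obj J" "a' \<in> Obj I" "b' \<in> Obj J" using \<open>x \<in> _\<close> \<open>y \<in> _\<close> by auto
    obtain z u v where z: "u \<in> hom I z a" "v \<in> hom I z a'" using I x unfolding cofiltered_def by blast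
    obtain z' u' v' where z': "u' \<in> hom J z' b" "v' \<in> hom J z' b'" using J x unfolding cofiltered_def by blast
    have "idx_pair (u, u') \<in> hom (prod_shape I J) (idx_pair (z, z')) x"
      "idx_pair (v, v') \<in> hom (prod_shape I J) (idx_pair (z, z')) y"
      using z z' x by (auto simp: prod_shape_hom)
    then show ?thesis by blast
  qed
  have 2: "\<exists>w e. e \<in> hom (prod_shape I J) w x \<and> u \<cdot>\<^bsub>prod_shape I J\<^esub> e = v \<cdot>\<^bsub>prod_shape I J\<^esub> e"
    if uv: "u \<in> hom (prod_shape I J) x y" "v \<in> hom (prod_shape I J) x y" for x y u v
  proof -
    obtain u1 u2 a b a' b' where x0: "u = idx_pair (u1, u2)"
      "x = idx_pair (a, b)" "y = idx_pair (a', b')" "u1 \<in> hom I a a'" "u2 \<in> hom J b b'"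
      using uv(1) by (auto simp: prod_shape_hom)
    obtain v1 v2 where x1: "v = idx_pair (v1, v2)" "v1 \<in> hom I a a'" "v2 \<in> hom J b b'"
      using uv(2) x0(2,3) by (auto simp: prod_shape_hom)
    note x = x0 x1
    obtain w e where w: "e \<in> hom I w a" "u1 \<cdot>\<^bsub>I\<^esub> e = v1 \<cdot>\<^bsub>I\<^esub> e" using I x unfolding cofiltered_def by blast
    obtain w' e' where w': "e' \<in> hom J w' b" "u2 \<cdot>\<^bsub>J\<^esub> e' = v2 \<cdot>\<^bsub>J\<^esub> e'" using J x unfolding cofiltered_def by blast
    have "idx_pair (e, e') \<in> hom (prod_shape I J) (idx_pair (w, w')) x"
      using w w' x by (auto simp: prod_shape_hom)
    moreover have "u \<cdot>\<^bsub>prod_shape I J\<^esub> idx_pair (e, e') = v \<cdot>\<^bsub>prod_shape I J\<^esub> idx_pair (e, e')"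
      using w w' x by simp
    ultimately show ?thesis by blast
  qed
  have "category I" "category J" "Obj I \<noteq> {}" "Obj J \<noteq> {}" using I J by (auto simp: cofiltered_def)
  then show ?thesis using 1 2 category_prod_shape unfolding cofiltered_def by force
qed

lemma pro_tensor_object:
  fixes X Y :: "('i::infinite, 'o, 'a) diagram"
  assumes C: "monoidal_category C" and X: "X \<in> pro_objects C" and Y: "Y \<in> pro_objects C"
  shows "pro_tensor C X Y \<in> pro_objects C"
proof -
  interpret monoidal_category C by fact
  note PX = pro_object_shape[OF X] and PY = pro_object_shape[OF Y]
  let ?T = "pro_tensor C X Y"
  have cof: "cofiltered (Shape ?T)"
    using X Y cofiltered_prod_shape by (auto simp: pro_tensor_def pro_objects_def)
  have "is_functor (Shape ?T) C (ObjMap ?T) (ArrMap ?T)"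
    unfolding is_functor_def
  proof (intro conjI ballI impI)
    show "category (Shape ?T)" using cof by (simp add: cofiltered_def)
    show "category C" by (rule category_axioms)
    fix x assume "x \<in> Obj (Shape ?T)"
    then obtain i j where ij: "x = idx_pair (i, j)" "i \<in> Obj (Shape X)" "j \<in> Obj (Shape Y)"
      by (auto simp: pro_tensor_def)
    show "ObjMap ?T x \<in> Obj C" "ArrMap ?T (Ident (Shape ?T) x) = Ident C (ObjMap ?T x)"
      using ij PX(3,6) PY(3,6) tensor_obj tensor_ident by (auto simp: pro_tensor_def)
  next
    fix f assume "f \<in> Arr (Shape ?T)"
    then have "f \<in> hom (Shape ?T) (Dom (Shape ?T) f) (Cod (Shape ?T) f)" by (simp add: hom_def)
    then show "ArrMap ?T f \<in> hom C (ObjMap ?T (Dom (Shape ?T) f)) (ObjMap ?T (Cod (Shape ?T) f))"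
      using tensor_hom PX(4) PY(4) by (auto simp: pro_tensor_def prod_shape_hom)
  next
    fix f g assume "f \<in> Arr (Shape ?T)" "g \<in> Arr (Shape ?T)" "Dom (Shape ?T) g = Cod (Shape ?T) f"
    then have "f \<in> hom (Shape ?T) (Dom (Shape ?T) f) (Cod (Shape ?T) f)"
      "g \<in> hom (Shape ?T) (Cod (Shape ?T) f) (Cod (Shape ?T) g)" by (simp_all add: hom_def)
    then obtain u v u' v' i j i' j' i'' j'' where fg: "f = idx_pair (u, v)" "g = idx_pair (u', v')"
      and u: "u \<in> hom (Shape X) i i'" "u' \<in> hom (Shape X) i' i''"
      and v: "v \<in> hom (Shape Y) j j'" "v' \<in> hom (Shape Y) j' j''"
      by (auto simp: pro_tensor_def prod_shape_hom)
    have "ArrMap X (u' \<cdot>\<^bsub>Shape X\<^esub> u) \<boxtimes>\<^bsub>C\<^esub> ArrMap Y (v' \<cdot>\<^bsub>Shape Y\<^esub> v) =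
       (ArrMap X u' \<boxtimes>\<^bsub>C\<^esub> ArrMap Y v') \<cdot>\<^bsub>C\<^esub> (ArrMap X u \<boxtimes>\<^bsub>C\<^esub> ArrMap Y v)"
      unfolding PX(5)[OF u(2) u(1)] PY(5)[OF v(2) v(1)]
      by (rule tensor_comp[OF PX(4)[OF u(1)] PX(4)[OF u(2)] PY(4)[OF v(1)] PY(4)[OF v(2)]])
    then show "ArrMap ?T (g \<cdot>\<^bsub>Shape ?T\<^esub> f) = ArrMap ?T g \<cdot>\<^bsub>C\<^esub> ArrMap ?T f"
      unfolding fg by (simp add: pro_tensor_def)
  qed
  then show ?thesis using cof by (simp add: pro_objects_def)
qed

lemma tensor_carrier:
  fixes X Y :: "('i::infinite, 'o, 'a) diagram"
  assumes C: "monoidal_category C"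
   and "(i, f) \<in> colim_carrier C X c" "(j, g) \<in> colim_carrier C Y d"
  shows "(idx_pair (i, j), f \<boxtimes>\<^bsub>C\<^esub> g) \<in> colim_carrier C (pro_tensor C X Y) (c \<otimes>\<^bsub>C\<^esub> d)"
  using assms monoidal_category.tensor_hom[OF C] by (auto simp: colim_carrier_def pro_tensor_def)

lemma tensor_rel:
  fixes X Y :: "('i::infinite, 'o, 'a) diagram"
  assumes C: "monoidal_category C" and X: "X \<in> pro_objects C" and Y: "Y \<in> pro_objects C"
    and f: "(i, f) \<in> colim_carrier C X c" and g: "(j, g) \<in> colim_carrier C Y d"
    and rf: "((i, f), (i', f')) \<in> colim_rel C X c" and rg: "((j, g), (j', g')) \<in> colim_rel C Y d"
  shows "((idx_pair (i, j), f \<boxtimes>\<^bsub>C\<^esub> g), (idx_pair (i', j'), f' \<boxtimes>\<^bsub>C\<^esub> g'))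
    \<in> colim_rel C (pro_tensor C X Y) (c \<otimes>\<^bsub>C\<^esub> d)"
proof -
  interpret monoidal_category C by fact
  note PX = pro_object_shape[OF X] and PY = pro_object_shape[OF Y]
  have f': "(i', f') \<in> colim_carrier C X c" "refines C X (i, f) (i', f')"
    using rf colim_rel_iff[OF X f] by auto
  have g': "(j', g') \<in> colim_carrier C Y d" "refines C Y (j, g) (j', g')"
    using rg colim_rel_iff[OF Y g] by auto
  obtain k u v where k: "u \<in> hom (Shape X) k i" "v \<in> hom (Shape X) k i'"
    "f \<cdot>\<^bsub>C\<^esub> ArrMap X u = f' \<cdot>\<^bsub>C\<^esub> ArrMap X v" using f'(2) by (auto simp: refines_def)
  obtain l a b where l: "a \<in> hom (Shape Y) l j" "b \<in> hom (Shape Y) l j'"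
    "g \<cdot>\<^bsub>C\<^esub> ArrMap Y a = g' \<cdot>\<^bsub>C\<^esub> ArrMap Y b" using g'(2) by (auto simp: refines_def)
  have h: "f \<in> hom C (ObjMap X i) c" "f' \<in> hom C (ObjMap X i') c"
     "g \<in> hom C (ObjMap Y j) d" "g' \<in> hom C (ObjMap Y j') d"
    using f f' g g' by (auto simp: colim_carrier_def)
  have "(f \<boxtimes>\<^bsub>C\<^esub> g) \<cdot>\<^bsub>C\<^esub> (ArrMap X u \<boxtimes>\<^bsub>C\<^esub> ArrMap Y a) = (f' \<boxtimes>\<^bsub>C\<^esub> g') \<cdot>\<^bsub>C\<^esub> (ArrMap X v \<boxtimes>\<^bsub>C\<^esub> ArrMap Y b)"
    using tensor_comp[OF PX(4)[OF k(1)] h(1) PY(4)[OF l(1)] h(3)]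
      tensor_comp[OF PX(4)[OF k(2)] h(2) PY(4)[OF l(2)] h(4)] k(3) l(3) by simp
  then have "refines C (pro_tensor C X Y) (idx_pair (i, j), f \<boxtimes>\<^bsub>C\<^esub> g) (idx_pair (i', j'), f' \<boxtimes>\<^bsub>C\<^esub> g')"
    unfolding refines_def
    by (intro exI[of _ "idx_pair (k, l)"] exI[of _ "idx_pair (u, a)"] exI[of _ "idx_pair (v, b)"])
      (use k l in \<open>auto simp: pro_tensor_def prod_shape_hom\<close>)
  then show ?thesis
    using colim_rel_iff[OF pro_tensor_object[OF C X Y] tensor_carrier[OF C f g]]
      tensor_carrier[OF C f'(1) g'(1)] by blast
qed

lemma const_object:
  assumes C: "category C" and c: "c \<in> Obj C"
  shows "const_diagram C c \<in> pro_objects C"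
proof -
  have u: "category unit_shape" by unfold_locales (auto simp: unit_shape_def hom_def)
  then have "cofiltered unit_shape" by (auto simp: cofiltered_def hom_def unit_shape_def)
  moreover have "is_functor unit_shape C (\<lambda>_. c) (\<lambda>_. Ident C c)"
    using u C category.ident_hom[OF C c] category.comp_ident_left[OF C category.ident_hom[OF C c]] c
    by (auto simp: is_functor_def)
  ultimately show ?thesis by (simp add: pro_objects_def const_diagram_def)
qed

definition point ::
  "('o, 'a, 'm) cat_scheme \<Rightarrow> ('i, 'o, 'a) diagram \<Rightarrow> 'o \<Rightarrow> 'i \<times> 'a
    \<Rightarrow> ('i, 'o, 'a) pro_arrow" where
  "point C X c p = pro_arr C X (const_diagram C c) (\<lambda>_. {p})"

lemma point_simp: "point C X c p = (X, const_diagram C c, \<lambda>j\<in>{idx_star}. cls C X c p)"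
  by (simp add: point_def pro_arr_def const_diagram_def unit_shape_def)

lemma pro_homset: "h \<in> hom (pro C) X Y \<longleftrightarrow>
   (\<exists>F. h = (X, Y, F) \<and> X \<in> pro_objects C \<and> Y \<in> pro_objects C \<and> F \<in> pro_hom C X Y)"
  by (auto simp: hom_def pro_def)

lemma point_hom:
  assumes X: "X \<in> pro_objects C" and c: "c \<in> Obj C" and p: "p \<in> colim_carrier C X c"
  shows "point C X c p \<in> hom (pro C) X (const_diagram C c)"
proof -
  note P = pro_object_shape[OF X]
  note K = const_object[OF P(2) c]
  have "(\<lambda>j\<in>{idx_star}. cls C X c p) \<in> pro_hom C X (const_diagram C c)"
  proof (rule pro_homI[OF X K, where r = "\<lambda>_. p"])
    show "(\<lambda>j\<in>{idx_star}. cls C X c p) \<in> extensional (Obj (Shape (const_diagram C c)))"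
      by (simp add: const_diagram_def unit_shape_def)
  next
    fix j assume "j \<in> Obj (Shape (const_diagram C c))"
    then show "p \<in> colim_carrier C X (ObjMap (const_diagram C c) j) \<and>
      (\<lambda>j\<in>{idx_star}. cls C X c p) j = cls C X (ObjMap (const_diagram C c) j) p"
      using p by (auto simp: const_diagram_def unit_shape_def)
  next
    fix j j' v
    have "snd p \<in> hom C (ObjMap X (fst p)) c" using p by (auto simp: colim_carrier_def)
    then show "(p, fst p, ArrMap (const_diagram C c) v \<cdot>\<^bsub>C\<^esub> snd p) \<in> colim_rel C X (ObjMap (const_diagram C c) j')"
      using category.comp_ident_left[OF P(2)] colim_rel_refl by (simp add: const_diagram_def)
  qed
  then show ?thesis using X K by (simp add: pro_homset point_simp)
qed

lemma hom_pointE: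
  assumes "h \<in> hom (pro C) X (const_diagram C c)"
  obtains i f where "(i, f) \<in> colim_carrier C X c" "h = point C X c (i, f)"
proof -
  obtain F where F: "h = (X, const_diagram C c, F)" "F \<in> pro_hom C X (const_diagram C c)"
    using assms by (auto simp: pro_homset)
  have s: "idx_star \<in> Obj (Shape (const_diagram C c))" by (simp add: const_diagram_def unit_shape_def)
  obtain i f where r: "(i, f) \<in> colim_carrier C X c" "F idx_star = cls C X c (i, f)"
    using pro_hom_component[OF F(2) s] by (auto simp: const_diagram_def)
  have "F \<in> extensional {idx_star}" using F(2) by (auto simp: pro_hom_def const_diagram_def unit_shape_def PiE_def)
  then have "F = (\<lambda>j\<in>{idx_star}. cls C X c (i, f))" using r(2) by (auto simp: extensional_def fun_eq_iff)
  then show ?thesis using that r F by (simp add: point_simp)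
qed

lemma point_eq:
  fixes X :: "('i, 'o, 'a) diagram"
  shows "point C X c p = point C X c q \<longleftrightarrow> (p, q) \<in> colim_rel C X c"
proof
  assume "point C X c p = point C X c q"
  then have "(\<lambda>j\<in>{idx_star :: 'i}. cls C X c p) = (\<lambda>j\<in>{idx_star :: 'i}. cls C X c q)"
    unfolding point_simp prod.inject by (elim conjE)
  then have "(\<lambda>j\<in>{idx_star :: 'i}. cls C X c p) idx_star = (\<lambda>j\<in>{idx_star :: 'i}. cls C X c q) idx_star"
    by (rule fun_cong)
  then show "(p, q) \<in> colim_rel C X c" using cls_eq[of C X c p q] by simp
next
  assume "(p, q) \<in> colim_rel C X c"
  then have "cls C X c p = cls C X c q" using cls_eq[of C X c p q] by simp
  then show "point C X c p = point C X c q" by (simp add: point_simp)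
qed

lemma point_comp:
  assumes X: "X \<in> pro_objects C" and Y: "Y \<in> pro_objects C" and F: "F \<in> pro_hom C X Y"
    and cg: "(j, g) \<in> colim_carrier C Y d"
    and cf: "(i, f) \<in> colim_carrier C X (ObjMap Y j)" and Fj: "F j = cls C X (ObjMap Y j) (i, f)"
  shows "point C Y d (j, g) \<cdot>\<^bsub>pro C\<^esub> (X, Y, F) = point C X d (i, g \<cdot>\<^bsub>C\<^esub> f)"
  using pro_comp_component[OF X Y F cg refl cf Fj]
  by (simp add: point_simp pro_def pro_arr_def const_diagram_def unit_shape_def fun_eq_iff)

lemma const_arr_point: "a \<in> hom C c d \<Longrightarrow> pro_const_arr C a = point C (const_diagram C c) d (idx_star, a)"
  by (simp add: pro_const_arr_def point_def hom_def)

lemma const_arr_comp: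
  assumes X: "X \<in> pro_objects C" and a: "a \<in> hom C c d" and f: "(i, f) \<in> colim_carrier C X c"
  shows "pro_const_arr C a \<cdot>\<^bsub>pro C\<^esub> point C X c (i, f) = point C X d (i, a \<cdot>\<^bsub>C\<^esub> f)"
proof -
  have c: "c \<in> Obj C" using hom_obj[OF pro_object_shape(2)[OF X] a] by simp
  have h: "(\<lambda>j\<in>{idx_star}. cls C X c (i, f)) \<in> pro_hom C X (const_diagram C c)"
    using point_hom[OF X c f] by (simp add: pro_homset point_simp)
  show ?thesis
    unfolding const_arr_point[OF a] point_simp[of C X c]
    by (rule point_comp[OF X const_object[OF pro_object_shape(2)[OF X] c] h])
      (use a f in \<open>auto simp: colim_carrier_def const_diagram_def unit_shape_def\<close>)
qed

lemma det_simps [simp]: "Obj (det C) = Obj C" "Dom (det C) = Dom C" "Cod (det C) = Cod C"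
  "Ident (det C) = Ident C" "Comp (det C) = Comp C" "const_diagram (det C) = const_diagram C"
  by (auto simp: det_def const_diagram_def fun_eq_iff)

lemma det_hom: "f \<in> hom (det C) x y \<longleftrightarrow> f \<in> hom C x y \<and> Copy C y \<cdot>\<^bsub>C\<^esub> f = (f \<boxtimes>\<^bsub>C\<^esub> f) \<cdot>\<^bsub>C\<^esub> Copy C x"
  by (auto simp: det_def hom_def deterministic_def)

lemma category_det:
  assumes "markov_category C"
  shows "category (det C)"
proof -
  interpret markov_category C by fact
  show ?thesis
  proof
    fix f assume "f \<in> Arr (det C)"
    then show "Dom (det C) f \<in> Obj (det C)" "Cod (det C) f \<in> Obj (det C)"
      using dom_obj cod_obj by (auto simp: det_def)
  next
    fix x assume "x \<in> Obj (det C)"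
    then show "Ident (det C) x \<in> hom (det C) x x"
      using ident_hom[of x] tensor_ident[of x x] copy_hom[of x] comp_ident_left comp_ident_right
      by (simp add: det_hom)
  next
    fix f g x y z assume f: "f \<in> hom (det C) x y" and g: "g \<in> hom (det C) y z"
    have f': "f \<in> hom C x y" "Copy C y \<cdot>\<^bsub>C\<^esub> f = (f \<boxtimes>\<^bsub>C\<^esub> f) \<cdot>\<^bsub>C\<^esub> Copy C x" using f by (auto simp: det_hom)
    have g': "g \<in> hom C y z" "Copy C z \<cdot>\<^bsub>C\<^esub> g = (g \<boxtimes>\<^bsub>C\<^esub> g) \<cdot>\<^bsub>C\<^esub> Copy C y" using g by (auto simp: det_hom)
    note o = hom_obj[OF category_axioms f'(1)] hom_obj[OF category_axioms g'(1)]
    have "Copy C z \<cdot>\<^bsub>C\<^esub> (g \<cdot>\<^bsub>C\<^esub> f) = ((g \<boxtimes>\<^bsub>C\<^esub> g) \<cdot>\<^bsub>C\<^esub> Copy C y) \<cdot>\<^bsub>C\<^esub> f"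
      using comp_assoc[OF f'(1) g'(1) copy_hom] o g'(2) by simp
    also have "\<dots> = (g \<boxtimes>\<^bsub>C\<^esub> g) \<cdot>\<^bsub>C\<^esub> ((f \<boxtimes>\<^bsub>C\<^esub> f) \<cdot>\<^bsub>C\<^esub> Copy C x)"
      using comp_assoc[OF f'(1) copy_hom tensor_hom[OF g'(1) g'(1)]] o f'(2) by simp
    also have "\<dots> = ((g \<cdot>\<^bsub>C\<^esub> f) \<boxtimes>\<^bsub>C\<^esub> (g \<cdot>\<^bsub>C\<^esub> f)) \<cdot>\<^bsub>C\<^esub> Copy C x"
      using comp_assoc[OF copy_hom tensor_hom[OF f'(1) f'(1)] tensor_hom[OF g'(1) g'(1)]] o
        tensor_comp[OF f'(1) g'(1) f'(1) g'(1)] by simp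
    finally show "g \<cdot>\<^bsub>det C\<^esub> f \<in> hom (det C) x z"
      using comp_hom[OF f'(1) g'(1)] by (simp add: det_hom)
  qed (auto simp: det_hom comp_ident_left comp_ident_right intro: comp_assoc)
qed

lemma pro_objects_det:
  assumes "category C" "X \<in> pro_objects (det C)"
  shows "X \<in> pro_objects C"
  using assms by (auto simp: pro_objects_def is_functor_def det_hom)

lemma colim_carrier_det: "p \<in> colim_carrier (det C) X c \<Longrightarrow> p \<in> colim_carrier C X c"
  by (auto simp: colim_carrier_def det_hom)

lemma colim_rel_det: 
  assumes r: "(p, q) \<in> colim_rel (det C) X c"
  shows "(p, q) \<in> colim_rel C X c"
proof -
  have "colim_step (det C) X c \<subseteq> colim_step C X c"
    unfolding colim_step_def using colim_carrier_det[of _ C X c] by (simp only: det_simps) blast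
  then have "colim_rel (det C) X c \<subseteq> colim_rel C X c"
    unfolding colim_rel_def by (intro rtrancl_mono) blast
  then show ?thesis using r by blast
qed

lemma tensor_leg_point:
  fixes X Y :: "('i::infinite, 'o, 'a) diagram"
  assumes C: "markov_category C" and X: "X \<in> pro_objects (det C)" and Y: "Y \<in> pro_objects (det C)"
    and f: "(i, f) \<in> colim_carrier (det C) X c" and g: "(j, g) \<in> colim_carrier (det C) Y d"
  shows "tensor_leg C c d (point (det C) X c (i, f)) (point (det C) Y d (j, g)) =
    point C (pro_tensor C X Y) (c \<otimes>\<^bsub>C\<^esub> d) (idx_pair (i, j), f \<boxtimes>\<^bsub>C\<^esub> g)"
proof -
  interpret markov_category C by fact
  note X' = pro_objects_det[OF category_axioms X] and Y' = pro_objects_det[OF category_axioms Y]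
  note f' = colim_carrier_det[OF f] and g' = colim_carrier_det[OF g]
  let ?S = "{(idx_pair (i', j'), f' \<boxtimes>\<^bsub>C\<^esub> g') | i' f' j' g'.
     (i', f') \<in> cls (det C) X c (i, f) \<and> (j', g') \<in> cls (det C) Y d (j, g)}"
  have "colim_class C (pro_tensor C X Y) (c \<otimes>\<^bsub>C\<^esub> d) ?S =
     cls C (pro_tensor C X Y) (c \<otimes>\<^bsub>C\<^esub> d) (idx_pair (i, j), f \<boxtimes>\<^bsub>C\<^esub> g)"
  proof (rule class_eqI)
    show "(idx_pair (i, j), f \<boxtimes>\<^bsub>C\<^esub> g) \<in> ?S"
      using colim_rel_refl[of "(i, f)" "det C" X c] colim_rel_refl[of "(j, g)" "det C" Y d] by auto
    fix q assume "q \<in> ?S"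
    then obtain i' k j' l where q: "q = (idx_pair (i', j'), k \<boxtimes>\<^bsub>C\<^esub> l)"
      and r: "((i, f), (i', k)) \<in> colim_rel (det C) X c" "((j, g), (j', l)) \<in> colim_rel (det C) Y d" by auto
    show "(q, (idx_pair (i, j), f \<boxtimes>\<^bsub>C\<^esub> g)) \<in> colim_rel C (pro_tensor C X Y) (c \<otimes>\<^bsub>C\<^esub> d)"
      unfolding q
      by (rule symD[OF colim_rel_sym tensor_rel[OF monoidal_category_axioms X' Y' f' g' colim_rel_det[OF r(1)] colim_rel_det[OF r(2)]]])
  qed
  then show ?thesis
    by (simp add: tensor_leg_def point_simp pro_arr_def const_diagram_def unit_shape_def fun_eq_iff)
qed

lemma idx_star_const: "idx_star \<in> Obj (Shape (const_diagram C c))"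
  by (simp add: const_diagram_def unit_shape_def)

text \<open>\<open>X \<otimes> Y\<close> is the limit in \<open>Pro(C)\<close> of \<open>c \<otimes> d\<close> over all \<open>X \<rightarrow> c\<close> and
  \<open>Y \<rightarrow> d\<close> in \<open>Pro(det C)\<close>: a compatible family \<open>s\<close> factors uniquely through it.\<close>

lemma prodet_tensor_limit:
  fixes X Y Z :: "('i::infinite, 'o, 'a) diagram"
  assumes C: "markov_category C"
    and X: "X \<in> Obj (pro (det C))" and Y: "Y \<in> Obj (pro (det C))" and Z: "Z \<in> Obj (pro C)"
    and cone: "\<And>c d p q. \<lbrakk>p \<in> hom (pro (det C)) X (const_diagram C c);
        q \<in> hom (pro (det C)) Y (const_diagram C d)\<rbrakk>
      \<Longrightarrow> s p q \<in> hom (pro C) Z (const_diagram C (c \<otimes>\<^bsub>C\<^esub> d))"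
    and natural: "\<And>a b c c' d d' p q. \<lbrakk>a \<in> hom (det C) c c'; b \<in> hom (det C) d d';
        p \<in> hom (pro (det C)) X (const_diagram C c); q \<in> hom (pro (det C)) Y (const_diagram C d)\<rbrakk>
      \<Longrightarrow> s (pro_const_arr (det C) a \<cdot>\<^bsub>pro (det C)\<^esub> p) (pro_const_arr (det C) b \<cdot>\<^bsub>pro (det C)\<^esub> q) =
          pro_const_arr C (a \<boxtimes>\<^bsub>C\<^esub> b) \<cdot>\<^bsub>pro C\<^esub> s p q"
  shows "\<exists>!h. h \<in> hom (pro C) Z (pro_tensor C X Y) \<and>
     (\<forall>c d. \<forall>p\<in>hom (pro (det C)) X (const_diagram C c). \<forall>q\<in>hom (pro (det C)) Y (const_diagram C d).
        tensor_leg C c d p q \<cdot>\<^bsub>pro C\<^esub> h = s p q)"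
proof -
  interpret markov_category C by fact
  have X: "X \<in> pro_objects (det C)" and Y: "Y \<in> pro_objects (det C)" and Z: "Z \<in> pro_objects C"
    using X Y Z by (auto simp: pro_def)
  note X' = pro_objects_det[OF category_axioms X] and Y' = pro_objects_det[OF category_axioms Y]
  note PX = pro_object_shape[OF X] and PY = pro_object_shape[OF Y]
  let ?T = "pro_tensor C X Y"
  note T = pro_tensor_object[OF monoidal_category_axioms X' Y']
  have PT: "Obj (Shape ?T) = idx_pair ` (Obj (Shape X) \<times> Obj (Shape Y))"
    "\<And>i j. ObjMap ?T (idx_pair (i, j)) = ObjMap X i \<otimes>\<^bsub>C\<^esub> ObjMap Y j"
    by (auto simp: pro_tensor_def)
  define px where "px i = point (det C) X (ObjMap X i) (i, Ident C (ObjMap X i))" for i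
  define py where "py j = point (det C) Y (ObjMap Y j) (j, Ident C (ObjMap Y j))" for j
  have ix: "(i, Ident C (ObjMap X i)) \<in> colim_carrier (det C) X (ObjMap X i)" if "i \<in> Obj (Shape X)" for i
    using category.ident_hom[OF PX(2), of "ObjMap X i"] PX(3)[OF that] that by (simp add: colim_carrier_def)
  have iy: "(j, Ident C (ObjMap Y j)) \<in> colim_carrier (det C) Y (ObjMap Y j)" if "j \<in> Obj (Shape Y)" for j
    using category.ident_hom[OF PY(2), of "ObjMap Y j"] PY(3)[OF that] that by (simp add: colim_carrier_def)
  have px: "px i \<in> hom (pro (det C)) X (const_diagram C (ObjMap X i))" if "i \<in> Obj (Shape X)" for i
    using point_hom[OF X PX(3) ix] that unfolding px_def by simp
  have py: "py j \<in> hom (pro (det C)) Y (const_diagram C (ObjMap Y j))" if "j \<in> Obj (Shape Y)" for j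
    using point_hom[OF Y PY(3) iy] that unfolding py_def by simp
  have px_comp: "pro_const_arr (det C) f \<cdot>\<^bsub>pro (det C)\<^esub> px i = point (det C) X c (i, f)"
    if "(i, f) \<in> colim_carrier (det C) X c" for i f c
  proof -
    have i: "i \<in> Obj (Shape X)" and f: "f \<in> hom (det C) (ObjMap X i) c" using that by (auto simp: colim_carrier_def)
    show ?thesis using const_arr_comp[OF X f ix[OF i]] category.comp_ident_right[OF PX(2) f] by (simp add: px_def)
  qed
  have py_comp: "pro_const_arr (det C) f \<cdot>\<^bsub>pro (det C)\<^esub> py i = point (det C) Y c (i, f)"
    if "(i, f) \<in> colim_carrier (det C) Y c" for i f c
  proof -
    have i: "i \<in> Obj (Shape Y)" and f: "f \<in> hom (det C) (ObjMap Y i) c" using that by (auto simp: colim_carrier_def)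
    show ?thesis using const_arr_comp[OF Y f iy[OF i]] category.comp_ident_right[OF PY(2) f] by (simp add: py_def)
  qed
  have "\<exists>r. r \<in> colim_carrier C Z (ObjMap X i \<otimes>\<^bsub>C\<^esub> ObjMap Y j) \<and>
     s (px i) (py j) = point C Z (ObjMap X i \<otimes>\<^bsub>C\<^esub> ObjMap Y j) r"
    if "i \<in> Obj (Shape X)" "j \<in> Obj (Shape Y)" for i j
    using cone[OF px[OF that(1)] py[OF that(2)]] by (blast elim: hom_pointE)
  then obtain r where r: "\<And>i j. \<lbrakk>i \<in> Obj (Shape X); j \<in> Obj (Shape Y)\<rbrakk> \<Longrightarrow>
     r i j \<in> colim_carrier C Z (ObjMap X i \<otimes>\<^bsub>C\<^esub> ObjMap Y j)"
    "\<And>i j. \<lbrakk>i \<in> Obj (Shape X); j \<in> Obj (Shape Y)\<rbrakk> \<Longrightarrow>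
       s (px i) (py j) = point C Z (ObjMap X i \<otimes>\<^bsub>C\<^esub> ObjMap Y j) (r i j)"
    by metis
  have s_gen: "s (point (det C) X c (i, f)) (point (det C) Y d (j, g)) =
      point C Z (c \<otimes>\<^bsub>C\<^esub> d) (fst (r i j), (f \<boxtimes>\<^bsub>C\<^esub> g) \<cdot>\<^bsub>C\<^esub> snd (r i j))"
    if f: "(i, f) \<in> colim_carrier (det C) X c" and g: "(j, g) \<in> colim_carrier (det C) Y d" for i f c j g d
  proof -
    have i: "i \<in> Obj (Shape X)" "f \<in> hom (det C) (ObjMap X i) c" using f by (auto simp: colim_carrier_def)
    have j: "j \<in> Obj (Shape Y)" "g \<in> hom (det C) (ObjMap Y j) d" using g by (auto simp: colim_carrier_def)
    have fg: "f \<boxtimes>\<^bsub>C\<^esub> g \<in> hom C (ObjMap X i \<otimes>\<^bsub>C\<^esub> ObjMap Y j) (c \<otimes>\<^bsub>C\<^esub> d)"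
      using tensor_hom i(2) j(2) by (auto simp: det_hom)
    have "s (point (det C) X c (i, f)) (point (det C) Y d (j, g)) =
       pro_const_arr C (f \<boxtimes>\<^bsub>C\<^esub> g) \<cdot>\<^bsub>pro C\<^esub> s (px i) (py j)"
      using natural[OF i(2) j(2) px[OF i(1)] py[OF j(1)]] px_comp[OF f] py_comp[OF g] by simp
    also have "\<dots> = point C Z (c \<otimes>\<^bsub>C\<^esub> d) (fst (r i j), (f \<boxtimes>\<^bsub>C\<^esub> g) \<cdot>\<^bsub>C\<^esub> snd (r i j))"
      using const_arr_comp[OF Z fg, of "fst (r i j)" "snd (r i j)"] r[OF i(1) j(1)] by simp
    finally show ?thesis .
  qed
  define H where "H = (\<lambda>l\<in>Obj (Shape ?T). cls C Z (ObjMap ?T l) (r (idx_fst l) (idx_snd l)))"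
  have H: "H \<in> pro_hom C Z ?T"
  proof (rule pro_homI[OF Z T, where r = "\<lambda>l. r (idx_fst l) (idx_snd l)"])
    show "H \<in> extensional (Obj (Shape ?T))" by (simp add: H_def)
  next
    fix l assume "l \<in> Obj (Shape ?T)"
    then show "r (idx_fst l) (idx_snd l) \<in> colim_carrier C Z (ObjMap ?T l) \<and>
       H l = cls C Z (ObjMap ?T l) (r (idx_fst l) (idx_snd l))"
      using r(1) by (auto simp: H_def PT)
  next
    fix l l' w assume "w \<in> hom (Shape ?T) l l'"
    then obtain u v i j i' j' where w: "w = idx_pair (u, v)" "l = idx_pair (i, j)" "l' = idx_pair (i', j')"
      and u: "u \<in> hom (Shape X) i i'" and v: "v \<in> hom (Shape Y) j j'"
      by (auto simp: pro_tensor_def prod_shape_hom)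
    have o: "i \<in> Obj (Shape X)" "i' \<in> Obj (Shape X)" "j \<in> Obj (Shape Y)" "j' \<in> Obj (Shape Y)"
      using hom_obj[OF PX(1) u] hom_obj[OF PY(1) v] by auto
    have cu: "(i, ArrMap X u) \<in> colim_carrier (det C) X (ObjMap X i')"
      using PX(4)[OF u] o by (simp add: colim_carrier_def)
    have cv: "(j, ArrMap Y v) \<in> colim_carrier (det C) Y (ObjMap Y j')"
      using PY(4)[OF v] o by (simp add: colim_carrier_def)
    have ru: "px i' = point (det C) X (ObjMap X i') (i, ArrMap X u)"
      unfolding px_def point_eq colim_rel_iff[OF X ix[OF o(2)]] refines_def
      using cu u category.ident_hom[OF PX(1) o(1)] PX(6)[OF o(1)]
        category.comp_ident_left[OF PX(2) PX(4)[OF u]] category.comp_ident_right[OF PX(2) PX(4)[OF u]]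
      by (intro conjI exI[of _ i] exI[of _ u] exI[of _ "Ident (Shape X) i"]) auto
    have rv: "py j' = point (det C) Y (ObjMap Y j') (j, ArrMap Y v)"
      unfolding py_def point_eq colim_rel_iff[OF Y iy[OF o(4)]] refines_def
      using cv v category.ident_hom[OF PY(1) o(3)] PY(6)[OF o(3)]
        category.comp_ident_left[OF PY(2) PY(4)[OF v]] category.comp_ident_right[OF PY(2) PY(4)[OF v]]
      by (intro conjI exI[of _ j] exI[of _ v] exI[of _ "Ident (Shape Y) j"]) auto
    have "(r i' j', (fst (r i j), (ArrMap X u \<boxtimes>\<^bsub>C\<^esub> ArrMap Y v) \<cdot>\<^bsub>C\<^esub> snd (r i j)))
       \<in> colim_rel C Z (ObjMap X i' \<otimes>\<^bsub>C\<^esub> ObjMap Y j')"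
      using s_gen[OF cu cv] r(2)[OF o(2) o(4)] ru rv point_eq by metis
    then show "(r (idx_fst l') (idx_snd l'), fst (r (idx_fst l) (idx_snd l)),
       ArrMap ?T w \<cdot>\<^bsub>C\<^esub> snd (r (idx_fst l) (idx_snd l))) \<in> colim_rel C Z (ObjMap ?T l')"
      by (simp add: w pro_tensor_def)
  qed
  have leg: "tensor_leg C c d (point (det C) X c (i, f)) (point (det C) Y d (j, g)) \<cdot>\<^bsub>pro C\<^esub> (Z, ?T, G) =
      point C Z (c \<otimes>\<^bsub>C\<^esub> d) (k, (f \<boxtimes>\<^bsub>C\<^esub> g) \<cdot>\<^bsub>C\<^esub> e)"
    if f: "(i, f) \<in> colim_carrier (det C) X c" and g: "(j, g) \<in> colim_carrier (det C) Y d"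
     and G: "G \<in> pro_hom C Z ?T" and e: "(k, e) \<in> colim_carrier C Z (ObjMap X i \<otimes>\<^bsub>C\<^esub> ObjMap Y j)"
     and Ge: "G (idx_pair (i, j)) = cls C Z (ObjMap X i \<otimes>\<^bsub>C\<^esub> ObjMap Y j) (k, e)" for i f j g c d G k e
    unfolding tensor_leg_point[OF C X Y f g]
    by (rule point_comp[OF Z T G tensor_carrier[OF monoidal_category_axioms colim_carrier_det[OF f] colim_carrier_det[OF g]]])
      (use e Ge PT in simp_all)
  show ?thesis
  proof (rule ex1I[of _ "(Z, ?T, H)"], intro conjI allI ballI)
    show "(Z, ?T, H) \<in> hom (pro C) Z ?T" using Z T H by (simp add: pro_homset)
    fix c d p q assume p: "p \<in> hom (pro (det C)) X (const_diagram C c)"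
      and q: "q \<in> hom (pro (det C)) Y (const_diagram C d)"
    obtain i f where f: "(i, f) \<in> colim_carrier (det C) X c" "p = point (det C) X c (i, f)"
      using hom_pointE[of p "det C" X c] p by auto
    obtain j g where g: "(j, g) \<in> colim_carrier (det C) Y d" "q = point (det C) Y d (j, g)"
      using hom_pointE[of q "det C" Y d] q by auto
    have o: "i \<in> Obj (Shape X)" "j \<in> Obj (Shape Y)" using f g by (auto simp: colim_carrier_def)
    have "H (idx_pair (i, j)) = cls C Z (ObjMap X i \<otimes>\<^bsub>C\<^esub> ObjMap Y j) (fst (r i j), snd (r i j))"
      using o by (simp add: H_def PT)
    then show "tensor_leg C c d p q \<cdot>\<^bsub>pro C\<^esub> (Z, ?T, H) = s p q"
      using leg[OF f(1) g(1) H, of "fst (r i j)" "snd (r i j)"] s_gen[OF f(1) g(1)] r(1)[OF o] f(2) g(2) by simp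
  next
    fix h assume h: "h \<in> hom (pro C) Z ?T \<and>
     (\<forall>c d. \<forall>p\<in>hom (pro (det C)) X (const_diagram C c). \<forall>q\<in>hom (pro (det C)) Y (const_diagram C d).
        tensor_leg C c d p q \<cdot>\<^bsub>pro C\<^esub> h = s p q)"
    then obtain G where G: "h = (Z, ?T, G)" "G \<in> pro_hom C Z ?T" by (auto simp: pro_homset)
    have "G l = H l" for l
    proof (cases "l \<in> Obj (Shape ?T)")
      case False
      then show ?thesis using G(2) by (auto simp: H_def pro_hom_def PiE_def extensional_def)
    next
      case True
      then obtain i j where l: "l = idx_pair (i, j)" and o: "i \<in> Obj (Shape X)" "j \<in> Obj (Shape Y)"
        by (auto simp: PT)
      obtain k e where e: "(k, e) \<in> colim_carrier C Z (ObjMap X i \<otimes>\<^bsub>C\<^esub> ObjMap Y j)"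
        "G (idx_pair (i, j)) = cls C Z (ObjMap X i \<otimes>\<^bsub>C\<^esub> ObjMap Y j) (k, e)"
        using pro_hom_component[OF G(2) True] by (auto simp: l PT)
      have eh: "e \<in> hom C (ObjMap Z k) (ObjMap X i \<otimes>\<^bsub>C\<^esub> ObjMap Y j)" using e by (simp add: colim_carrier_def)
      have obs: "ObjMap X i \<in> Obj C" "ObjMap Y j \<in> Obj C"
        using PX(3)[OF o(1)] PY(3)[OF o(2)] by auto
      have "s (px i) (py j) = tensor_leg C (ObjMap X i) (ObjMap Y j) (px i) (py j) \<cdot>\<^bsub>pro C\<^esub> h"
        using h px[OF o(1)] py[OF o(2)] by simp
      also have "\<dots> = point C Z (ObjMap X i \<otimes>\<^bsub>C\<^esub> ObjMap Y j) (k, e)"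
        using leg[OF ix[OF o(1)] iy[OF o(2)] G(2) e] comp_ident_left[OF eh] tensor_ident[OF obs]
        by (simp add: G(1) px_def py_def)
      finally have "point C Z (ObjMap X i \<otimes>\<^bsub>C\<^esub> ObjMap Y j) (r i j) =
         point C Z (ObjMap X i \<otimes>\<^bsub>C\<^esub> ObjMap Y j) (k, e)" using r(2)[OF o] by simp
      then have "cls C Z (ObjMap X i \<otimes>\<^bsub>C\<^esub> ObjMap Y j) (r i j) = cls C Z (ObjMap X i \<otimes>\<^bsub>C\<^esub> ObjMap Y j) (k, e)"
        unfolding point_eq cls_eq .
      then show ?thesis using e(2) True by (simp add: l H_def PT o)
    qed
    then show "h = (Z, ?T, H)" using G(1) by (simp add: fun_eq_iff)
  qed
qed

lemma pro_copy_class: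
  fixes X :: "('i::infinite, 'o, 'a) diagram"
  assumes C: "markov_category C" and X: "X \<in> pro_objects (det C)"
    and u: "u \<in> hom (Shape X) k i" and v: "v \<in> hom (Shape X) k i'"
  shows "colim_class C X (ObjMap X i \<otimes>\<^bsub>C\<^esub> ObjMap X i')
     {(k, (ArrMap X u \<boxtimes>\<^bsub>C\<^esub> ArrMap X v) \<cdot>\<^bsub>C\<^esub> Copy C (ObjMap X k)) | k u v.
            u \<in> hom (Shape X) k i \<and> v \<in> hom (Shape X) k i'} =
     cls C X (ObjMap X i \<otimes>\<^bsub>C\<^esub> ObjMap X i') (k, (ArrMap X u \<boxtimes>\<^bsub>C\<^esub> ArrMap X v) \<cdot>\<^bsub>C\<^esub> Copy C (ObjMap X k))"
    (is "colim_class C X ?c ?S = cls C X ?c (?p k u v)")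
    "(k, (ArrMap X u \<boxtimes>\<^bsub>C\<^esub> ArrMap X v) \<cdot>\<^bsub>C\<^esub> Copy C (ObjMap X k))
      \<in> colim_carrier C X (ObjMap X i \<otimes>\<^bsub>C\<^esub> ObjMap X i')"
proof -
  interpret markov_category C by fact
  note X' = pro_objects_det[OF category_axioms X]
  note P = pro_object_shape[OF X'] and PD = pro_object_shape[OF X]
  have carrier: "?p k u v \<in> colim_carrier C X ?c"
    if u: "u \<in> hom (Shape X) k i" and v: "v \<in> hom (Shape X) k i'" for k u v
    using tensor_hom[OF P(4)[OF u] P(4)[OF v]] copy_hom[OF P(3), of k] comp_hom hom_obj[OF P(1) u]
    by (fastforce simp: colim_carrier_def)
  show "?p k u v \<in> colim_carrier C X ?c" using carrier u v by simp
  have restr: "((ArrMap X u \<boxtimes>\<^bsub>C\<^esub> ArrMap X v) \<cdot>\<^bsub>C\<^esub> Copy C (ObjMap X k)) \<cdot>\<^bsub>C\<^esub> ArrMap X a =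
      (ArrMap X (u \<cdot>\<^bsub>Shape X\<^esub> a) \<boxtimes>\<^bsub>C\<^esub> ArrMap X (v \<cdot>\<^bsub>Shape X\<^esub> a)) \<cdot>\<^bsub>C\<^esub> Copy C (ObjMap X w)"
    if u: "u \<in> hom (Shape X) k i" and v: "v \<in> hom (Shape X) k i'" and a: "a \<in> hom (Shape X) w k" for w k u v a
  proof -
    note uc = P(4)[OF u] and vc = P(4)[OF v] and ac = P(4)[OF a]
    have ob: "ObjMap X k \<in> Obj C" "ObjMap X w \<in> Obj C" using hom_obj[OF category_axioms ac] by auto
    have "((ArrMap X u \<boxtimes>\<^bsub>C\<^esub> ArrMap X v) \<cdot>\<^bsub>C\<^esub> Copy C (ObjMap X k)) \<cdot>\<^bsub>C\<^esub> ArrMap X a =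
       (ArrMap X u \<boxtimes>\<^bsub>C\<^esub> ArrMap X v) \<cdot>\<^bsub>C\<^esub> ((ArrMap X a \<boxtimes>\<^bsub>C\<^esub> ArrMap X a) \<cdot>\<^bsub>C\<^esub> Copy C (ObjMap X w))"
      using comp_assoc[OF ac copy_hom[OF ob(1)] tensor_hom[OF uc vc]] PD(4)[OF a] by (simp add: det_hom)
    also have "\<dots> = ((ArrMap X u \<boxtimes>\<^bsub>C\<^esub> ArrMap X v) \<cdot>\<^bsub>C\<^esub> (ArrMap X a \<boxtimes>\<^bsub>C\<^esub> ArrMap X a)) \<cdot>\<^bsub>C\<^esub> Copy C (ObjMap X w)"
      using comp_assoc[OF copy_hom[OF ob(2)] tensor_hom[OF ac ac] tensor_hom[OF uc vc]] by simp
    finally show ?thesis using tensor_comp[OF ac uc ac vc] P(5)[OF u a] P(5)[OF v a] by simp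
  qed
  show "colim_class C X ?c ?S = cls C X ?c (?p k u v)"
  proof (rule class_eqI)
    show "?p k u v \<in> ?S" using u v by blast
    fix q assume "q \<in> ?S"
    then obtain k' u' v' where q: "q = ?p k' u' v'"
      and u': "u' \<in> hom (Shape X) k' i" and v': "v' \<in> hom (Shape X) k' i'" by blast
    obtain z a b where z: "a \<in> hom (Shape X) z k" "b \<in> hom (Shape X) z k'"
      using pro_object_cofiltered(2)[OF X'] hom_obj[OF P(1) u] hom_obj[OF P(1) u'] by blast
    note cI = category.comp_hom[OF P(1)] and aI = category.comp_assoc[OF P(1)]
    obtain y e where e: "e \<in> hom (Shape X) y z"
      "(u \<cdot>\<^bsub>Shape X\<^esub> a) \<cdot>\<^bsub>Shape X\<^esub> e = (u' \<cdot>\<^bsub>Shape X\<^esub> b) \<cdot>\<^bsub>Shape X\<^esub> e"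
      using pro_object_cofiltered(3)[OF X' cI[OF z(1) u] cI[OF z(2) u']] by blast
    have ve: "(v \<cdot>\<^bsub>Shape X\<^esub> a) \<cdot>\<^bsub>Shape X\<^esub> e \<in> hom (Shape X) y i'"
      "(v' \<cdot>\<^bsub>Shape X\<^esub> b) \<cdot>\<^bsub>Shape X\<^esub> e \<in> hom (Shape X) y i'"
      using cI[OF e(1) cI[OF z(1) v]] cI[OF e(1) cI[OF z(2) v']] .
    obtain w e' where e': "e' \<in> hom (Shape X) w y"
      "((v \<cdot>\<^bsub>Shape X\<^esub> a) \<cdot>\<^bsub>Shape X\<^esub> e) \<cdot>\<^bsub>Shape X\<^esub> e' = ((v' \<cdot>\<^bsub>Shape X\<^esub> b) \<cdot>\<^bsub>Shape X\<^esub> e) \<cdot>\<^bsub>Shape X\<^esub> e'"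
      using pro_object_cofiltered(3)[OF X' ve] by blast
    define a' where "a' = (a \<cdot>\<^bsub>Shape X\<^esub> e) \<cdot>\<^bsub>Shape X\<^esub> e'"
    define b' where "b' = (b \<cdot>\<^bsub>Shape X\<^esub> e) \<cdot>\<^bsub>Shape X\<^esub> e'"
    have ae: "a \<cdot>\<^bsub>Shape X\<^esub> e \<in> hom (Shape X) y k" "b \<cdot>\<^bsub>Shape X\<^esub> e \<in> hom (Shape X) y k'"
      using cI[OF e(1) z(1)] cI[OF e(1) z(2)] .
    have ab: "a' \<in> hom (Shape X) w k" "b' \<in> hom (Shape X) w k'"
      unfolding a'_def b'_def using cI[OF e'(1) ae(1)] cI[OF e'(1) ae(2)] .
    have 1: "u \<cdot>\<^bsub>Shape X\<^esub> a' = u' \<cdot>\<^bsub>Shape X\<^esub> b'"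
      using e(2) aI[OF e'(1) ae(1) u] aI[OF e'(1) ae(2) u'] aI[OF e(1) z(1) u] aI[OF e(1) z(2) u']
      by (simp add: a'_def b'_def)
    have 2: "v \<cdot>\<^bsub>Shape X\<^esub> a' = v' \<cdot>\<^bsub>Shape X\<^esub> b'"
      using e'(2) aI[OF e'(1) ae(1) v] aI[OF e'(1) ae(2) v'] aI[OF e(1) z(1) v] aI[OF e(1) z(2) v']
      by (simp add: a'_def b'_def)
    have "refines C X q (?p k u v)"
      unfolding refines_def q using ab restr[OF u v ab(1)] restr[OF u' v' ab(2)] 1 2
      by (intro exI[of _ w] exI[of _ b'] exI[of _ a']) simp
    then show "(q, ?p k u v) \<in> colim_rel C X ?c"
      using colim_rel_iff[OF X' carrier[OF u' v']] carrier[OF u v] q by blast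
  qed
qed

text \<open>The component of the copy map of \<open>X\<close> at \<open>p : X \<rightarrow> c\<close> is \<open>p\<close> followed by the copy
  map of \<open>c\<close>.\<close>

lemma prodet_copy_component:
  fixes X :: "('i::infinite, 'o, 'a) diagram"
  assumes C: "markov_category C" and p: "p \<in> hom (pro (det C)) X (const_diagram C c)"
  shows "tensor_leg C c c p p \<cdot>\<^bsub>pro C\<^esub> pro_copy C X =
    pro_const_arr C (Copy C c) \<cdot>\<^bsub>pro C\<^esub> pro_det_incl C p"
proof -
  interpret markov_category C by fact
  have X: "X \<in> pro_objects (det C)" using p by (auto simp: pro_homset)
  note X' = pro_objects_det[OF category_axioms X]
  note P = pro_object_shape[OF X'] and PD = pro_object_shape[OF X]
  let ?T = "pro_tensor C X X"
  note T = pro_tensor_object[OF monoidal_category_axioms X' X']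
  obtain i f where f: "(i, f) \<in> colim_carrier (det C) X c" "p = point (det C) X c (i, f)"
    using hom_pointE[of p "det C" X c] p by auto
  note fC = colim_carrier_det[OF f(1)]
  have i: "i \<in> Obj (Shape X)" and fh: "f \<in> hom C (ObjMap X i) c"
     and fd: "Copy C c \<cdot>\<^bsub>C\<^esub> f = (f \<boxtimes>\<^bsub>C\<^esub> f) \<cdot>\<^bsub>C\<^esub> Copy C (ObjMap X i)"
    using f(1) by (auto simp: colim_carrier_def det_hom)
  have c: "c \<in> Obj C" using hom_obj[OF category_axioms fh] by simp
  have "\<exists>k u v. u \<in> hom (Shape X) k i \<and> v \<in> hom (Shape X) k i'" if "i \<in> Obj (Shape X)" "i' \<in> Obj (Shape X)" for i i'
    using pro_object_cofiltered(2)[OF X' that] .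
  then obtain k u v where k: "\<And>i i'. \<lbrakk>i \<in> Obj (Shape X); i' \<in> Obj (Shape X)\<rbrakk> \<Longrightarrow> u i i' \<in> hom (Shape X) (k i i') i"
      "\<And>i i'. \<lbrakk>i \<in> Obj (Shape X); i' \<in> Obj (Shape X)\<rbrakk> \<Longrightarrow> v i i' \<in> hom (Shape X) (k i i') i'"
    by metis
  define S where "S l = {(k, (ArrMap X u \<boxtimes>\<^bsub>C\<^esub> ArrMap X v) \<cdot>\<^bsub>C\<^esub> Copy C (ObjMap X k)) | k u v.
            u \<in> hom (Shape X) k (idx_fst l) \<and> v \<in> hom (Shape X) k (idx_snd l)}" for l
  define F where "F = (\<lambda>l\<in>Obj (Shape ?T). colim_class C X (ObjMap ?T l) (S l))"
  have copy: "pro_copy C X = (X, ?T, F)"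
    by (simp add: pro_copy_def pro_arr_def F_def S_def)
  have Fl: "F (idx_pair (i, i')) = cls C X (ObjMap X i \<otimes>\<^bsub>C\<^esub> ObjMap X i')
      (k, (ArrMap X u \<boxtimes>\<^bsub>C\<^esub> ArrMap X v) \<cdot>\<^bsub>C\<^esub> Copy C (ObjMap X k))"
    if "u \<in> hom (Shape X) k i" "v \<in> hom (Shape X) k i'" for i i' k u v
    using pro_copy_class(1)[OF C X that] hom_obj[OF P(1) that(1)] hom_obj[OF P(1) that(2)]
    by (simp add: F_def S_def pro_tensor_def)
  have F: "F \<in> pro_hom C X ?T"
  proof (rule pro_homI[OF X' T, where r = "\<lambda>l. (k (idx_fst l) (idx_snd l),
      (ArrMap X (u (idx_fst l) (idx_snd l)) \<boxtimes>\<^bsub>C\<^esub> ArrMap X (v (idx_fst l) (idx_snd l))) \<cdot>\<^bsub>C\<^esub>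
       Copy C (ObjMap X (k (idx_fst l) (idx_snd l))))"])
    show "F \<in> extensional (Obj (Shape ?T))" by (simp add: F_def)
  next
    fix l assume "l \<in> Obj (Shape ?T)"
    then obtain a b where l: "l = idx_pair (a, b)" and ab: "a \<in> Obj (Shape X)" "b \<in> Obj (Shape X)"
      by (auto simp: pro_tensor_def)
    show "(k (idx_fst l) (idx_snd l),
      (ArrMap X (u (idx_fst l) (idx_snd l)) \<boxtimes>\<^bsub>C\<^esub> ArrMap X (v (idx_fst l) (idx_snd l))) \<cdot>\<^bsub>C\<^esub>
       Copy C (ObjMap X (k (idx_fst l) (idx_snd l)))) \<in> colim_carrier C X (ObjMap ?T l) \<and>
      F l = cls C X (ObjMap ?T l) (k (idx_fst l) (idx_snd l),
      (ArrMap X (u (idx_fst l) (idx_snd l)) \<boxtimes>\<^bsub>C\<^esub> ArrMap X (v (idx_fst l) (idx_snd l))) \<cdot>\<^bsub>C\<^esub>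
       Copy C (ObjMap X (k (idx_fst l) (idx_snd l))))"
      using pro_copy_class(2)[OF C X k[OF ab]] Fl[OF k[OF ab]] by (simp add: l pro_tensor_def)
  next
    fix l l' w assume "w \<in> hom (Shape ?T) l l'"
    then obtain s t a b a' b' where w: "w = idx_pair (s, t)" "l = idx_pair (a, b)" "l' = idx_pair (a', b')"
      and s: "s \<in> hom (Shape X) a a'" and t: "t \<in> hom (Shape X) b b'"
      by (auto simp: pro_tensor_def prod_shape_hom)
    have ab: "a \<in> Obj (Shape X)" "b \<in> Obj (Shape X)" "a' \<in> Obj (Shape X)" "b' \<in> Obj (Shape X)"
      using hom_obj[OF P(1) s] hom_obj[OF P(1) t] by auto
    let ?k = "k a b" and ?u = "u a b" and ?v = "v a b"
    let ?k' = "k a' b'" and ?u' = "u a' b'" and ?v' = "v a' b'"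
    note uu = k(1)[OF ab(1,2)] and vv = k(2)[OF ab(1,2)]
    have kO: "ObjMap X ?k \<in> Obj C" using hom_obj[OF P(1) uu] P(3) by simp
    have su: "s \<cdot>\<^bsub>Shape X\<^esub> ?u \<in> hom (Shape X) ?k a'" "t \<cdot>\<^bsub>Shape X\<^esub> ?v \<in> hom (Shape X) ?k b'"
      using category.comp_hom[OF P(1) uu s] category.comp_hom[OF P(1) vv t] .
    have "(ArrMap X s \<boxtimes>\<^bsub>C\<^esub> ArrMap X t) \<cdot>\<^bsub>C\<^esub> ((ArrMap X ?u \<boxtimes>\<^bsub>C\<^esub> ArrMap X ?v) \<cdot>\<^bsub>C\<^esub> Copy C (ObjMap X ?k)) =
      (ArrMap X (s \<cdot>\<^bsub>Shape X\<^esub> ?u) \<boxtimes>\<^bsub>C\<^esub> ArrMap X (t \<cdot>\<^bsub>Shape X\<^esub> ?v)) \<cdot>\<^bsub>C\<^esub> Copy C (ObjMap X ?k)"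
      using comp_assoc[OF copy_hom[OF kO] tensor_hom[OF P(4)[OF uu] P(4)[OF vv]] tensor_hom[OF P(4)[OF s] P(4)[OF t]]]
        tensor_comp[OF P(4)[OF uu] P(4)[OF s] P(4)[OF vv] P(4)[OF t]] P(5)[OF s uu] P(5)[OF t vv] by simp
    moreover have "((?k', (ArrMap X ?u' \<boxtimes>\<^bsub>C\<^esub> ArrMap X ?v') \<cdot>\<^bsub>C\<^esub> Copy C (ObjMap X ?k')),
       (?k, (ArrMap X (s \<cdot>\<^bsub>Shape X\<^esub> ?u) \<boxtimes>\<^bsub>C\<^esub> ArrMap X (t \<cdot>\<^bsub>Shape X\<^esub> ?v)) \<cdot>\<^bsub>C\<^esub> Copy C (ObjMap X ?k)))
       \<in> colim_rel C X (ObjMap X a' \<otimes>\<^bsub>C\<^esub> ObjMap X b')"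
      unfolding cls_eq[symmetric] using Fl[OF k(1)[OF ab(3,4)] k(2)[OF ab(3,4)]] Fl[OF su] by (rule trans[OF sym])
    ultimately show "((k (idx_fst l') (idx_snd l'),
      (ArrMap X (u (idx_fst l') (idx_snd l')) \<boxtimes>\<^bsub>C\<^esub> ArrMap X (v (idx_fst l') (idx_snd l'))) \<cdot>\<^bsub>C\<^esub>
       Copy C (ObjMap X (k (idx_fst l') (idx_snd l')))),
      fst (k (idx_fst l) (idx_snd l),
      (ArrMap X (u (idx_fst l) (idx_snd l)) \<boxtimes>\<^bsub>C\<^esub> ArrMap X (v (idx_fst l) (idx_snd l))) \<cdot>\<^bsub>C\<^esub>
       Copy C (ObjMap X (k (idx_fst l) (idx_snd l)))),
      ArrMap ?T w \<cdot>\<^bsub>C\<^esub> snd (k (idx_fst l) (idx_snd l),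
      (ArrMap X (u (idx_fst l) (idx_snd l)) \<boxtimes>\<^bsub>C\<^esub> ArrMap X (v (idx_fst l) (idx_snd l))) \<cdot>\<^bsub>C\<^esub>
       Copy C (ObjMap X (k (idx_fst l) (idx_snd l)))))
       \<in> colim_rel C X (ObjMap ?T l')"
      by (simp add: w pro_tensor_def)
  qed
  let ?id = "Ident (Shape X) i"
  have id: "?id \<in> hom (Shape X) i i" using category.ident_hom[OF P(1) i] .
  have cp: "Copy C (ObjMap X i) \<in> hom C (ObjMap X i) (ObjMap X i \<otimes>\<^bsub>C\<^esub> ObjMap X i)"
    using copy_hom[OF P(3)[OF i]] .
  have unit: "(ArrMap X ?id \<boxtimes>\<^bsub>C\<^esub> ArrMap X ?id) \<cdot>\<^bsub>C\<^esub> Copy C (ObjMap X i) = Copy C (ObjMap X i)"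
    using P(6)[OF i] tensor_ident[OF P(3)[OF i] P(3)[OF i]] comp_ident_left[OF cp] by simp
  have "tensor_leg C c c p p \<cdot>\<^bsub>pro C\<^esub> pro_copy C X =
     point C X (c \<otimes>\<^bsub>C\<^esub> c) (i, (f \<boxtimes>\<^bsub>C\<^esub> f) \<cdot>\<^bsub>C\<^esub> Copy C (ObjMap X i))"
    unfolding f(2) tensor_leg_point[OF C X X f(1) f(1)] copy
    by (rule point_comp[OF X' T F tensor_carrier[OF monoidal_category_axioms fC fC]])
      (use Fl[OF id id] unit cp i in \<open>simp_all add: pro_tensor_def colim_carrier_def\<close>)
  also have "\<dots> = pro_const_arr C (Copy C c) \<cdot>\<^bsub>pro C\<^esub> point C X c (i, f)"
    using const_arr_comp[OF X' copy_hom[OF c] fC] fd by simp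
  also have "point C X c (i, f) = pro_det_incl C p"
  proof -
    have "colim_class C X c (cls (det C) X c (i, f)) = cls C X c (i, f)"
      by (rule class_eqI) (auto intro: symD[OF colim_rel_sym colim_rel_det] simp: colim_rel_refl)
    then show ?thesis
      unfolding f(2) by (simp add: pro_det_incl_def point_simp pro_arr_def const_diagram_def unit_shape_def fun_eq_iff)
  qed
  finally show ?thesis .
qed

end

theory Submission
  imports Defs
begin

text \<open>
  Everything is reduced to \<open>C\<close> by means of representatives.  A component of an arrow of \<open>Pro(C)\<close> is a
  class in a filtered colimit of hom-sets.  Composition, tensor and all structure arrows are given
  by formulas on representatives, and two arrows with the same source and target are equal once
  each component has a common representative (\<open>represents\<close>, \<open>represents_comp\<close>, \<open>pro_arrow_eqI\<close>).

  \<^bold>\<open>The Markov structure.\<close>  Associators, unitors and symmetries are levelwise, so that the axioms of a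
  symmetric monoidal category hold because they hold in \<open>C\<close> at every index.  The copy map is
  different: at \<open>(i, i')\<close> it has to be computed at some index \<open>k\<close> over both \<open>i\<close> and \<open>i'\<close>, and its
  independence of \<open>k\<close> is where determinism of the transition arrows enters.  For each comonoid axiom
  one chooses an index over all the indices involved, pulls the transition arrows out
  by naturality, and is left with the axiom of \<open>C\<close> at that index.  Compatibility of \<open>del\<close> with the tensor
  and of \<open>copy\<close> and \<open>del\<close> with the unit follow from terminality of the unit, which holds because any two
  representatives of arrows into it become equal at a common index.

  \<^bold>\<open>The deterministic arrows.\<close>  If an arrow has deterministic representatives, it commutes with copying
  (\<open>pro_det_incl_deterministic\<close>).  Conversely let \<open>h : X \<rightarrow> Y\<close> be deterministic and let \<open>f : X\<^sub>i \<rightarrow> Y\<^sub>j\<close>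
  represent its component at \<open>j\<close>.  At the index \<open>(j, j)\<close> determinism of \<open>h\<close> says that \<open>copy \<cdot> f\<close> and
  \<open>(f \<boxtimes> f) \<cdot> copy\<close> agree in the colimit, so they agree after restriction along some \<open>X\<^sub>u : X\<^sub>k \<rightarrow> X\<^sub>i\<close>.
  As \<open>X\<^sub>u\<close> is deterministic, this says that the representative \<open>f \<cdot> X\<^sub>u\<close> is deterministic
  (\<open>deterministic_representative\<close>).  Equality of deterministic representatives is the same in the
  colimits over \<open>det C\<close> and over \<open>C\<close> (\<open>colim_rel_det_iff\<close>), which gives faithfulness and, together with the
  existence of deterministic representatives, a preimage of \<open>h\<close> in \<open>Pro(det C)\<close>.
\<close>

section \<open>Calculating with arrows\<close>

text \<open>Typing in terms of \<open>Dom\<close> and \<open>Cod\<close> rather than \<open>hom\<close> leaves no object to be guessed when a law is used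
  as a conditional rewrite rule, so the simplifier can type composites on its own.\<close>

lemma (in category) arr_comp [simp]:
  assumes "f \<in> Arr C" "g \<in> Arr C" "Dom C g = Cod C f"
  shows "g \<cdot> f \<in> Arr C" "Dom C (g \<cdot> f) = Dom C f" "Cod C (g \<cdot> f) = Cod C g"
  using comp_hom[of f "Dom C f" "Cod C f" g "Cod C g"] assms by (simp_all add: hom_def)

lemma (in category) arr_ident [simp]:
  assumes "x \<in> Obj C"
  shows "Ident C x \<in> Arr C" "Dom C (Ident C x) = x" "Cod C (Ident C x) = x"
  using ident_hom[OF assms] by (simp_all add: hom_def)

lemma (in category) obj_arr [simp]:
  "f \<in> Arr C \<Longrightarrow> Dom C f \<in> Obj C" "f \<in> Arr C \<Longrightarrow> Cod C f \<in> Obj C"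
  using dom_obj cod_obj by auto

lemma (in category) assoc_arr [simp]:
  assumes "f \<in> Arr C" "g \<in> Arr C" "h \<in> Arr C" "Dom C g = Cod C f" "Dom C h = Cod C g"
  shows "(h \<cdot> g) \<cdot> f = h \<cdot> g \<cdot> f"
  using assms comp_assoc[of f "Dom C f" "Cod C f" g "Cod C g" h "Cod C h"] by (simp add: hom_def)

lemma (in category) ident_comp [simp]:
  "f \<in> Arr C \<Longrightarrow> Cod C f = x \<Longrightarrow> Ident C x \<cdot> f = f"
  "f \<in> Arr C \<Longrightarrow> Dom C f = x \<Longrightarrow> f \<cdot> Ident C x = f"
  using comp_ident_left[of f "Dom C f" x] comp_ident_right[of f x "Cod C f"] by (auto simp: hom_def)

text \<open>The associativity rule \<open>assoc_arr\<close> hides composable pairs in the middle of a right-nested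
  composite; an equation between binary composites is therefore also used with an arbitrary
  arrow in front.\<close>

lemma (in category) comp_cong_prefix:
  assumes "g \<cdot> f = g' \<cdot> f'" "f \<in> Arr C" "g \<in> Arr C" "Dom C g = Cod C f"
    "f' \<in> Arr C" "g' \<in> Arr C" "Dom C g' = Cod C f'" "h \<in> Arr C" "Cod C h = Dom C f"
  shows "g \<cdot> f \<cdot> h = g' \<cdot> f' \<cdot> h"
proof -
  have "Dom C f' = Dom C f"
    using assms by (metis arr_comp(2))
  then show ?thesis
    using assms assoc_arr by metis
qed

lemma (in category) inverse_arr_eq:
  assumes "inverse_arrows C f g"
  shows "inverse_arr C f = g"
  unfolding inverse_arr_def
proof (rule the_equality[of _ g], rule assms)
  fix g' assume g': "inverse_arrows C f g'"
  note g = assms[unfolded inverse_arrows_def hom_def] and g' = g'[unfolded inverse_arrows_def hom_def]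
  have "(g' \<cdot> f) \<cdot> g = g' \<cdot> f \<cdot> g" using g g' by (intro assoc_arr) auto
  then show "g' = g" using g g' by auto
qed

lemma (in category) inverse_arr [simp]:
  assumes "iso_arr C f"
  shows "inverse_arr C f \<in> Arr C" "Dom C (inverse_arr C f) = Cod C f" "Cod C (inverse_arr C f) = Dom C f"
    "inverse_arr C f \<cdot> f = Ident C (Dom C f)" "f \<cdot> inverse_arr C f = Ident C (Cod C f)" "f \<in> Arr C"
proof -
  obtain g where "inverse_arrows C f g" using assms by (auto simp: iso_arr_def)
  then have "inverse_arrows C f (inverse_arr C f)" using inverse_arr_eq by simp
  then show "inverse_arr C f \<in> Arr C" "Dom C (inverse_arr C f) = Cod C f" "Cod C (inverse_arr C f) = Dom C f"
    "inverse_arr C f \<cdot> f = Ident C (Dom C f)" "f \<cdot> inverse_arr C f = Ident C (Cod C f)" "f \<in> Arr C"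
    by (auto simp: inverse_arrows_def hom_def)
qed

lemma (in category) inverse_natural:
  assumes "iso_arr C a" "iso_arr C b" "u \<in> Arr C" "v \<in> Arr C"
    "Dom C u = Dom C a" "Cod C u = Dom C b" "Dom C v = Cod C a" "Cod C v = Cod C b"
    and sq: "v \<cdot> a = b \<cdot> u"
  shows "u \<cdot> inverse_arr C a = inverse_arr C b \<cdot> v"
proof -
  have "inverse_arr C b \<cdot> v = inverse_arr C b \<cdot> v \<cdot> a \<cdot> inverse_arr C a"
    using assms by simp
  also have "\<dots> = inverse_arr C b \<cdot> (v \<cdot> a) \<cdot> inverse_arr C a"
    using assms(1-8) by simp
  also have "\<dots> = (inverse_arr C b \<cdot> b) \<cdot> u \<cdot> inverse_arr C a"
    unfolding sq using assms(1-8) by (simp del: inverse_arr(4))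
  also have "\<dots> = u \<cdot> inverse_arr C a"
    using assms(1-8) by simp
  finally show ?thesis by simp
qed

context monoidal_category
begin

lemma arr_tensor [simp]:
  assumes "f \<in> Arr C" "g \<in> Arr C"
  shows "f \<boxtimes> g \<in> Arr C" "Dom C (f \<boxtimes> g) = Dom C f \<otimes> Dom C g" "Cod C (f \<boxtimes> g) = Cod C f \<otimes> Cod C g"
  using tensor_hom[of f "Dom C f" "Cod C f" g "Dom C g" "Cod C g"] assms by (simp_all add: hom_def)

lemma comp_tensor [simp]:
  assumes "f \<in> Arr C" "g \<in> Arr C" "f' \<in> Arr C" "g' \<in> Arr C" "Dom C g = Cod C f" "Dom C g' = Cod C f'"
  shows "(g \<boxtimes> g') \<cdot> (f \<boxtimes> f') = (g \<cdot> f) \<boxtimes> (g' \<cdot> f')"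
  using tensor_comp[of f "Dom C f" "Cod C f" g "Cod C g" f' "Dom C f'" "Cod C f'" g' "Cod C g'"] assms
  by (simp add: hom_def)

text \<open>Rewriting fuses tensor products of composable arrows.  It is switched off below where a
  naturality square has to be applied to one of the factors first.\<close>

lemma comp_tensor_prefix [simp]:
  assumes "f \<in> Arr C" "g \<in> Arr C" "f' \<in> Arr C" "g' \<in> Arr C" "Dom C g = Cod C f" "Dom C g' = Cod C f'"
    "h \<in> Arr C" "Cod C h = Dom C f \<otimes> Dom C f'"
  shows "(g \<boxtimes> g') \<cdot> (f \<boxtimes> f') \<cdot> h = ((g \<cdot> f) \<boxtimes> (g' \<cdot> f')) \<cdot> h"
  using assoc_arr[of h "f \<boxtimes> f'" "g \<boxtimes> g'"] assms by (simp del: assoc_arr)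

lemma arr_unitors [simp]:
  assumes "a \<in> Obj C"
  shows "LUnit C a \<in> Arr C" "Dom C (LUnit C a) = Unit C \<otimes> a" "Cod C (LUnit C a) = a" "iso_arr C (LUnit C a)"
   "RUnit C a \<in> Arr C" "Dom C (RUnit C a) = a \<otimes> Unit C" "Cod C (RUnit C a) = a" "iso_arr C (RUnit C a)"
  using lunit_hom[OF assms] runit_hom[OF assms] lunit_iso[OF assms] runit_iso[OF assms]
  by (simp_all add: hom_def)

lemma arr_associator [simp]:
  assumes "a \<in> Obj C" "b \<in> Obj C" "c \<in> Obj C"
  shows "Assoc C a b c \<in> Arr C" "Dom C (Assoc C a b c) = (a \<otimes> b) \<otimes> c"
   "Cod C (Assoc C a b c) = a \<otimes> (b \<otimes> c)" "iso_arr C (Assoc C a b c)"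
  using assoc_hom[OF assms] assoc_iso[OF assms] by (simp_all add: hom_def)

lemmas obj_tensor [simp] = tensor_obj unit_obj tensor_ident

lemma associator_natural:
  assumes "f \<in> Arr C" "g \<in> Arr C" "h \<in> Arr C"
  shows "Assoc C (Cod C f) (Cod C g) (Cod C h) \<cdot> ((f \<boxtimes> g) \<boxtimes> h) =
    (f \<boxtimes> (g \<boxtimes> h)) \<cdot> Assoc C (Dom C f) (Dom C g) (Dom C h)"
  using assms assoc_natural by (simp add: hom_def)

lemma associator_inverse_natural:
  assumes "f \<in> Arr C" "g \<in> Arr C" "h \<in> Arr C"
  shows "inverse_arr C (Assoc C (Cod C f) (Cod C g) (Cod C h)) \<cdot> (f \<boxtimes> (g \<boxtimes> h)) =
    ((f \<boxtimes> g) \<boxtimes> h) \<cdot> inverse_arr C (Assoc C (Dom C f) (Dom C g) (Dom C h))"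
  by (rule inverse_natural[symmetric]) (use assms in \<open>simp_all add: associator_natural\<close>)

end

context symmetric_monoidal_category
begin

lemma arr_swap [simp]:
  assumes "a \<in> Obj C" "b \<in> Obj C"
  shows "Swap C a b \<in> Arr C" "Dom C (Swap C a b) = a \<otimes> b" "Cod C (Swap C a b) = b \<otimes> a"
  using swap_hom[OF assms] by (simp_all add: hom_def)

lemma swap_natural_arr:
  assumes "f \<in> Arr C" "g \<in> Arr C"
  shows "Swap C (Cod C f) (Cod C g) \<cdot> (f \<boxtimes> g) = (g \<boxtimes> f) \<cdot> Swap C (Dom C f) (Dom C g)"
  using assms swap_natural by (simp add: hom_def)

lemma arr_interchange [simp]:
  assumes "a \<in> Obj C" "a' \<in> Obj C" "b \<in> Obj C" "b' \<in> Obj C"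
  shows "interchange C a a' b b' \<in> Arr C" "Dom C (interchange C a a' b b') = (a \<otimes> a') \<otimes> (b \<otimes> b')"
    "Cod C (interchange C a a' b b') = (a \<otimes> b) \<otimes> (a' \<otimes> b')"
  using assms by (simp_all add: interchange_def)

text \<open>\<open>interchange\<close> is a composite of associators, their inverses and a symmetry, all of which are natural.\<close>

lemma interchange_natural:
  assumes "f \<in> Arr C" "f' \<in> Arr C" "g \<in> Arr C" "g' \<in> Arr C"
  shows "interchange C (Cod C f) (Cod C f') (Cod C g) (Cod C g') \<cdot> ((f \<boxtimes> f') \<boxtimes> (g \<boxtimes> g')) =
    ((f \<boxtimes> g) \<boxtimes> (f' \<boxtimes> g')) \<cdot> interchange C (Dom C f) (Dom C f') (Dom C g) (Dom C g')"
proof -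
  \<comment> \<open>the part of \<open>interchange\<close> acting on all factors but the first\<close>
  define s where "s a b b' = Assoc C b a b' \<cdot> (Swap C a b \<boxtimes> Ident C b') \<cdot> inverse_arr C (Assoc C a b b')" for a b b'
  have s: "s a b b' \<in> Arr C" "Dom C (s a b b') = a \<otimes> (b \<otimes> b')" "Cod C (s a b b') = b \<otimes> (a \<otimes> b')"
    if "a \<in> Obj C" "b \<in> Obj C" "b' \<in> Obj C" for a b b'
    using that by (simp_all add: s_def)
  have s_natural: "s (Cod C f') (Cod C g) (Cod C g') \<cdot> (f' \<boxtimes> (g \<boxtimes> g')) =
      (g \<boxtimes> (f' \<boxtimes> g')) \<cdot> s (Dom C f') (Dom C g) (Dom C g')"
  proof -
    have "s (Cod C f') (Cod C g) (Cod C g') \<cdot> (f' \<boxtimes> (g \<boxtimes> g')) =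
       Assoc C (Cod C g) (Cod C f') (Cod C g') \<cdot> ((g \<boxtimes> f') \<boxtimes> g') \<cdot>
         (Swap C (Dom C f') (Dom C g) \<boxtimes> Ident C (Dom C g')) \<cdot> inverse_arr C (Assoc C (Dom C f') (Dom C g) (Dom C g'))"
      using assms by (simp add: s_def associator_inverse_natural swap_natural_arr)
    also have "\<dots> = (g \<boxtimes> (f' \<boxtimes> g')) \<cdot> s (Dom C f') (Dom C g) (Dom C g')"
      using assms comp_cong_prefix[OF associator_natural[of g f' g']]
      by (simp add: s_def del: comp_tensor_prefix)
    finally show ?thesis .
  qed
  have "interchange C (Cod C f) (Cod C f') (Cod C g) (Cod C g') \<cdot> ((f \<boxtimes> f') \<boxtimes> (g \<boxtimes> g')) =
     inverse_arr C (Assoc C (Cod C f) (Cod C g) (Cod C f' \<otimes> Cod C g')) \<cdot>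
     (f \<boxtimes> (g \<boxtimes> (f' \<boxtimes> g'))) \<cdot> (Ident C (Dom C f) \<boxtimes> s (Dom C f') (Dom C g) (Dom C g')) \<cdot>
     Assoc C (Dom C f) (Dom C f') (Dom C g \<otimes> Dom C g')"
    using assms associator_natural[of f f' "g \<boxtimes> g'"] s
    by (simp add: interchange_def s_def[symmetric] s_natural)
  also have "\<dots> = ((f \<boxtimes> g) \<boxtimes> (f' \<boxtimes> g')) \<cdot> interchange C (Dom C f) (Dom C f') (Dom C g) (Dom C g')"
    using assms s comp_cong_prefix[OF associator_inverse_natural[of f g "f' \<boxtimes> g'"]]
    by (simp add: interchange_def s_def[symmetric] del: comp_tensor_prefix)
  finally show ?thesis .
qed

end

context markov_category
begin

lemma arr_copy_del [simp]:
  assumes "a \<in> Obj C"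
  shows "Copy C a \<in> Arr C" "Dom C (Copy C a) = a" "Cod C (Copy C a) = a \<otimes> a"
    "Del C a \<in> Arr C" "Dom C (Del C a) = a" "Cod C (Del C a) = Unit C"
  using copy_hom[OF assms] del_hom[OF assms] by (simp_all add: hom_def)

lemma into_unit_eq:
  assumes "f \<in> Arr C" "g \<in> Arr C" "Dom C f = Dom C g" "Cod C f = Unit C" "Cod C g = Unit C"
  shows "f = g"
  using unit_terminal assms unfolding terminal_obj_def by (auto simp: hom_def) (metis dom_obj)

text \<open>The copy map of a tensor product is the tensor of the copy maps up to \<open>interchange\<close>, which is natural.
  This makes the diagram \<open>X \<otimes> Y\<close> factor through \<open>det C\<close> whenever \<open>X\<close> and \<open>Y\<close> do.\<close>

lemma deterministic_tensor:
  assumes "f \<in> Arr C" "g \<in> Arr C" "deterministic C f" "deterministic C g"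
  shows "deterministic C (f \<boxtimes> g)"
proof -
  have "interchange C (Cod C f) (Cod C f) (Cod C g) (Cod C g) \<cdot> (Copy C (Cod C f) \<boxtimes> Copy C (Cod C g)) \<cdot> (f \<boxtimes> g) =
     interchange C (Cod C f) (Cod C f) (Cod C g) (Cod C g) \<cdot> ((f \<boxtimes> f) \<boxtimes> (g \<boxtimes> g)) \<cdot>
       (Copy C (Dom C f) \<boxtimes> Copy C (Dom C g))"
    using assms by (simp add: deterministic_def)
  also have "\<dots> = ((f \<boxtimes> g) \<boxtimes> (f \<boxtimes> g)) \<cdot> interchange C (Dom C f) (Dom C f) (Dom C g) (Dom C g) \<cdot>
       (Copy C (Dom C f) \<boxtimes> Copy C (Dom C g))"
    by (rule comp_cong_prefix[OF interchange_natural]) (use assms in simp_all)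
  finally show ?thesis
    using assms by (simp add: deterministic_def copy_tensor)
qed

end

section \<open>Arrows of pro-objects through representatives\<close>

text \<open>\<open>represents C X Y h j i f\<close>: the component of \<open>h : X \<rightarrow> Y\<close> at the index \<open>j\<close> of \<open>Y\<close> is the
  class of \<open>f : X\<^sub>i \<rightarrow> Y\<^sub>j\<close>.  The typing of \<open>h\<close> is part of the notion, so that the rules below
  check the typing of a composite arrow and compute its components at once.\<close>

definition represents ::
  "('o, 'a, 'm) cat_scheme \<Rightarrow> ('i, 'o, 'a) diagram \<Rightarrow> ('i, 'o, 'a) diagram \<Rightarrow> ('i, 'o, 'a) pro_arrow
    \<Rightarrow> 'i \<Rightarrow> 'i \<Rightarrow> 'a \<Rightarrow> bool" where
  "represents C X Y h j i f \<longleftrightarrow>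
     h \<in> hom (pro C) X Y \<and> j \<in> Obj (Shape Y) \<and> (i, f) \<in> snd (snd h) j"

lemma representsD:
  assumes "represents C X Y h j i f"
  shows "h \<in> hom (pro C) X Y" "X \<in> pro_objects C" "Y \<in> pro_objects C" "h = (X, Y, snd (snd h))"
    "snd (snd h) \<in> pro_hom C X Y" "j \<in> Obj (Shape Y)" "i \<in> Obj (Shape X)"
    "f \<in> hom C (ObjMap X i) (ObjMap Y j)" "(i, f) \<in> colim_carrier C X (ObjMap Y j)"
    "snd (snd h) j = cls C X (ObjMap Y j) (i, f)"
proof -
  show h: "h \<in> hom (pro C) X Y" and j: "j \<in> Obj (Shape Y)"
    using assms by (auto simp: represents_def)
  then show X: "X \<in> pro_objects C" and "Y \<in> pro_objects C" "h = (X, Y, snd (snd h))"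
    and F: "snd (snd h) \<in> pro_hom C X Y"
    by (auto simp: pro_homset)
  obtain k g where g: "(k, g) \<in> colim_carrier C X (ObjMap Y j)"
    "snd (snd h) j = cls C X (ObjMap Y j) (k, g)"
    using pro_hom_component[OF F j] by blast
  have r: "((k, g), (i, f)) \<in> colim_rel C X (ObjMap Y j)"
    using assms g(2) by (auto simp: represents_def)
  then show c: "(i, f) \<in> colim_carrier C X (ObjMap Y j)"
    using colim_rel_iff[OF X g(1)] by blast
  then show "i \<in> Obj (Shape X)" "f \<in> hom C (ObjMap X i) (ObjMap Y j)"
    by (auto simp: colim_carrier_def)
  show "snd (snd h) j = cls C X (ObjMap Y j) (i, f)"
    using g(2) r cls_eq by metis
qed

lemma represents_exists:
  assumes "h \<in> hom (pro C) X Y" "j \<in> Obj (Shape Y)"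
  obtains i f where "represents C X Y h j i f"
proof -
  have "snd (snd h) \<in> pro_hom C X Y" using assms(1) by (auto simp: pro_homset)
  then obtain i f where "snd (snd h) j = cls C X (ObjMap Y j) (i, f)"
    using pro_hom_component[OF _ assms(2)] by blast
  then have "represents C X Y h j i f"
    using assms colim_rel_refl by (simp add: represents_def)
  then show ?thesis using that by blast
qed

lemma represents_iff_rel:
  assumes "represents C X Y h j i f"
  shows "represents C X Y h j i' f' \<longleftrightarrow> ((i, f), (i', f')) \<in> colim_rel C X (ObjMap Y j)"
  using representsD[OF assms] by (simp add: represents_def)

text \<open>Extensionality, with a component compared through any one pair of representatives.  The arrows are typed by
  \<open>represents\<close>, since a cofiltered index category has an object.\<close>

lemma pro_arrow_eqI:
  assumes "X \<in> pro_objects C" "Y \<in> pro_objects C"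
    and "\<And>j. j \<in> Obj (Shape Y) \<Longrightarrow> \<exists>i f g. represents C X Y h j i f \<and> represents C X Y h' j i g \<and> f = g"
  shows "h = h'"
proof -
  obtain j where "j \<in> Obj (Shape Y)"
    using pro_object_cofiltered(1)[OF assms(2)] by blast
  then have h: "h \<in> hom (pro C) X Y" "h' \<in> hom (pro C) X Y"
    using assms(3) representsD(1) by metis+
  then obtain F F' where F: "h = (X, Y, F)" "F \<in> pro_hom C X Y" "h' = (X, Y, F')" "F' \<in> pro_hom C X Y"
    by (auto simp: pro_homset)
  have "F = F'"
  proof (rule extensionalityI[of _ "Obj (Shape Y)"])
    show "F \<in> extensional (Obj (Shape Y))" "F' \<in> extensional (Obj (Shape Y))"
      using F by (auto simp: pro_hom_def PiE_def)
    fix j assume "j \<in> Obj (Shape Y)"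
    then obtain i f where "represents C X Y h j i f" "represents C X Y h' j i f" using assms(3) by blast
    then show "F j = F' j" using representsD(10) F by (metis snd_conv)
  qed
  then show ?thesis using F by simp
qed

lemma colim_rel_restrict:
  assumes X: "X \<in> pro_objects C" and f: "(i, f) \<in> colim_carrier C X c" and u: "u \<in> hom (Shape X) k i"
  shows "((i, f), (k, f \<cdot>\<^bsub>C\<^esub> ArrMap X u)) \<in> colim_rel C X c"
  unfolding colim_rel_def colim_step_def using f u by blast

lemma represents_restrict:
  assumes h: "represents C X Y h j i f" and u: "u \<in> hom (Shape X) k i"
  shows "represents C X Y h j k (f \<cdot>\<^bsub>C\<^esub> ArrMap X u)"
  using represents_iff_rel[OF h] colim_rel_restrict[OF representsD(2)[OF h] representsD(9)[OF h] u] by blast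

lemma represents_push:
  assumes h: "represents C X Y h j i f" and v: "v \<in> hom (Shape Y) j j'"
  shows "represents C X Y h j' i (ArrMap Y v \<cdot>\<^bsub>C\<^esub> f)"
proof -
  note D = representsD[OF h]
  have "snd (snd h) j' = cls C X (ObjMap Y j') (i, ArrMap Y v \<cdot>\<^bsub>C\<^esub> f)"
    using pro_hom_push[OF D(2,3,5) v D(9,10)] .
  then show ?thesis
    using D(1) hom_obj[OF pro_object_shape(1)[OF D(3)] v] colim_rel_refl by (simp add: represents_def)
qed

text \<open>Equality in the colimit is witnessed by a pair of restrictions.  When the two indices coincide, the pair can be
  equalized in the shape, so that one restriction suffices.\<close>

lemma represents_equalize:
  assumes f: "represents C X Y h j i f" and g: "represents C X Y h j i g"
  obtains k u where "u \<in> hom (Shape X) k i" "f \<cdot>\<^bsub>C\<^esub> ArrMap X u = g \<cdot>\<^bsub>C\<^esub> ArrMap X u"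
proof -
  note X = representsD(2)[OF f] and P = pro_object_shape[OF representsD(2)[OF f]]
  have "refines C X (i, f) (i, g)"
    using represents_iff_rel[OF f] g colim_rel_iff[OF X representsD(9)[OF f]] by blast
  then obtain k u v where u: "u \<in> hom (Shape X) k i" "v \<in> hom (Shape X) k i"
    and e: "f \<cdot>\<^bsub>C\<^esub> ArrMap X u = g \<cdot>\<^bsub>C\<^esub> ArrMap X v"
    by (auto simp: refines_def)
  obtain w a where a: "a \<in> hom (Shape X) w k" "u \<cdot>\<^bsub>Shape X\<^esub> a = v \<cdot>\<^bsub>Shape X\<^esub> a"
    using pro_object_cofiltered(3)[OF X u] by blast
  have "f \<cdot>\<^bsub>C\<^esub> ArrMap X (u \<cdot>\<^bsub>Shape X\<^esub> a) = (f \<cdot>\<^bsub>C\<^esub> ArrMap X u) \<cdot>\<^bsub>C\<^esub> ArrMap X a"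
    using category.comp_assoc[OF P(2) P(4)[OF a(1)] P(4)[OF u(1)] representsD(8)[OF f]] P(5)[OF u(1) a(1)] by simp
  also have "\<dots> = g \<cdot>\<^bsub>C\<^esub> ArrMap X (v \<cdot>\<^bsub>Shape X\<^esub> a)"
    using category.comp_assoc[OF P(2) P(4)[OF a(1)] P(4)[OF u(2)] representsD(8)[OF g]] P(5)[OF u(2) a(1)] e by simp
  finally show ?thesis
    using that category.comp_hom[OF P(1) a(1) u(1)] a(2) by metis
qed

text \<open>The criterion by which all arrows of pro-objects below are constructed: equivalence of the elements of \<open>S j\<close> makes
  the class at \<open>j\<close> independent of the representative, so compatibility may be tested on any of them.\<close>

lemma pro_arr_represents:
  assumes X: "X \<in> pro_objects C" and Y: "Y \<in> pro_objects C"
    and ne: "\<And>j. j \<in> Obj (Shape Y) \<Longrightarrow> S j \<noteq> {}"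
    and car: "\<And>j i f. \<lbrakk>j \<in> Obj (Shape Y); (i, f) \<in> S j\<rbrakk> \<Longrightarrow> (i, f) \<in> colim_carrier C X (ObjMap Y j)"
    and rel: "\<And>j p q. \<lbrakk>j \<in> Obj (Shape Y); p \<in> S j; q \<in> S j\<rbrakk> \<Longrightarrow> (p, q) \<in> colim_rel C X (ObjMap Y j)"
    and cmp: "\<And>j j' v i f. \<lbrakk>v \<in> hom (Shape Y) j j'; (i, f) \<in> S j\<rbrakk> \<Longrightarrow>
      \<exists>p\<in>S j'. (p, (i, ArrMap Y v \<cdot>\<^bsub>C\<^esub> f)) \<in> colim_rel C X (ObjMap Y j')"
  shows "pro_arr C X Y S \<in> hom (pro C) X Y"
    and "\<And>j i f. \<lbrakk>j \<in> Obj (Shape Y); (i, f) \<in> S j\<rbrakk> \<Longrightarrow> represents C X Y (pro_arr C X Y S) j i f"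
proof -
  let ?F = "\<lambda>j\<in>Obj (Shape Y). colim_class C X (ObjMap Y j) (S j)"
  have cl: "?F j = cls C X (ObjMap Y j) p" if "j \<in> Obj (Shape Y)" "p \<in> S j" for j p
    using class_eqI[OF that(2) rel[OF that(1) _ that(2)]] that(1) by simp
  define r where "r j = (SOME p. p \<in> S j)" for j
  have r: "r j \<in> S j" if "j \<in> Obj (Shape Y)" for j
    using ne[OF that] some_in_eq[of "S j"] by (simp add: r_def)
  have car': "r j \<in> colim_carrier C X (ObjMap Y j)" if "j \<in> Obj (Shape Y)" for j
    using car[OF that, of "fst (r j)" "snd (r j)"] r[OF that] by simp
  have "?F \<in> pro_hom C X Y"
  proof (rule pro_homI[OF X Y, where r = r])
    fix j j' v assume v: "v \<in> hom (Shape Y) j j'"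
    then have j: "j \<in> Obj (Shape Y)" "j' \<in> Obj (Shape Y)"
      using hom_obj[OF pro_object_shape(1)[OF Y] v] by auto
    obtain p where "p \<in> S j'" "(p, (fst (r j), ArrMap Y v \<cdot>\<^bsub>C\<^esub> snd (r j))) \<in> colim_rel C X (ObjMap Y j')"
      using cmp[OF v, of "fst (r j)" "snd (r j)"] r[OF j(1)] by auto
    then show "(r j', (fst (r j), ArrMap Y v \<cdot>\<^bsub>C\<^esub> snd (r j))) \<in> colim_rel C X (ObjMap Y j')"
      using rel[OF j(2) r[OF j(2)]] by (blast intro: transD[OF colim_rel_trans])
  qed (use r cl car' in simp_all)
  then show h: "pro_arr C X Y S \<in> hom (pro C) X Y"
    using X Y by (simp add: pro_homset pro_arr_def)
  show "represents C X Y (pro_arr C X Y S) j i f" if "j \<in> Obj (Shape Y)" "(i, f) \<in> S j" for j i f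
    unfolding represents_def using h that cl[OF that] colim_rel_refl by (simp add: pro_arr_def)
qed

text \<open>The case of one representative per component, with components natural along transition arrows.\<close>

lemma levelwise_represents:
  assumes X: "X \<in> pro_objects C" and Y: "Y \<in> pro_objects C"
    and car: "\<And>j. j \<in> Obj (Shape Y) \<Longrightarrow> \<phi> j \<in> Obj (Shape X) \<and> a j \<in> hom C (ObjMap X (\<phi> j)) (ObjMap Y j)"
    and nat: "\<And>j j' v. v \<in> hom (Shape Y) j j' \<Longrightarrow>
      \<exists>u\<in>hom (Shape X) (\<phi> j) (\<phi> j'). a j' \<cdot>\<^bsub>C\<^esub> ArrMap X u = ArrMap Y v \<cdot>\<^bsub>C\<^esub> a j"
  shows "pro_arr C X Y (\<lambda>j. {(\<phi> j, a j)}) \<in> hom (pro C) X Y"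
    and "j \<in> Obj (Shape Y) \<Longrightarrow> represents C X Y (pro_arr C X Y (\<lambda>j. {(\<phi> j, a j)})) j (\<phi> j) (a j)"
proof -
  have c: "(\<phi> j, a j) \<in> colim_carrier C X (ObjMap Y j)" if "j \<in> Obj (Shape Y)" for j
    using car[OF that] by (simp add: colim_carrier_def)
  have n: "((\<phi> j', a j'), (\<phi> j, ArrMap Y v \<cdot>\<^bsub>C\<^esub> a j)) \<in> colim_rel C X (ObjMap Y j')"
    if v: "v \<in> hom (Shape Y) j j'" for j j' v
    using nat[OF v] colim_rel_restrict[OF X c] hom_obj[OF pro_object_shape(1)[OF Y] v] by metis
  show "pro_arr C X Y (\<lambda>j. {(\<phi> j, a j)}) \<in> hom (pro C) X Y"
    by (rule pro_arr_represents(1)[OF X Y]) (auto simp: c n colim_rel_refl)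
  show "j \<in> Obj (Shape Y) \<Longrightarrow> represents C X Y (pro_arr C X Y (\<lambda>j. {(\<phi> j, a j)})) j (\<phi> j) (a j)"
    by (rule pro_arr_represents(2)[OF X Y]) (auto simp: c n colim_rel_refl)
qed

text \<open>A component of \<open>g \<cdot> f\<close> is the class of all composites of representatives.  By \<open>pro_comp_component\<close> these
  composites are equivalent, so any single one may be used.\<close>

lemma represents_comp:
  assumes g: "represents C Y Z g k j b" and f: "represents C X Y f j i a"
  shows "represents C X Z (g \<cdot>\<^bsub>pro C\<^esub> f) k i (b \<cdot>\<^bsub>C\<^esub> a)"
proof -
  define F G where "F = snd (snd f)" and "G = snd (snd g)"
  note Df = representsD[OF f, folded F_def] and Dg = representsD[OF g, folded G_def]
  have D: "X \<in> pro_objects C" "Y \<in> pro_objects C" "Z \<in> pro_objects C" "F \<in> pro_hom C X Y" "G \<in> pro_hom C Y Z"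
    using Df Dg by auto
  define S where "S k = {(i, b \<cdot>\<^bsub>C\<^esub> a) | i a j b. (j, b) \<in> G k \<and> (i, a) \<in> F j}" for k
  have comp: "g \<cdot>\<^bsub>pro C\<^esub> f = pro_arr C X Z S"
    by (subst Df(4), subst Dg(4)) (simp add: pro_def S_def[abs_def])
  have rF: "represents C X Y f j i a \<longleftrightarrow> j \<in> Obj (Shape Y) \<and> (i, a) \<in> F j" for j i a
    using Df(1) by (simp add: represents_def F_def)
  have rG: "represents C Y Z g k j b \<longleftrightarrow> k \<in> Obj (Shape Z) \<and> (j, b) \<in> G k" for k j b
    using Dg(1) by (simp add: represents_def G_def)
  have S_I: "(i, b \<cdot>\<^bsub>C\<^esub> a) \<in> S k" if "represents C Y Z g k j b" "represents C X Y f j i a" for k j b i a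
    using that unfolding rF rG S_def by blast
  have S_E: "\<exists>i a j b. p = (i, b \<cdot>\<^bsub>C\<^esub> a) \<and> represents C Y Z g k j b \<and> represents C X Y f j i a"
    if k: "k \<in> Obj (Shape Z)" and p: "p \<in> S k" for p k
  proof -
    obtain i a j b where p': "p = (i, b \<cdot>\<^bsub>C\<^esub> a)" and ab: "(j, b) \<in> G k" "(i, a) \<in> F j"
      using p unfolding S_def by blast
    have "represents C Y Z g k j b" using rG k ab by simp
    moreover from representsD(7)[OF this] have "represents C X Y f j i a" using rF ab by simp
    ultimately show ?thesis using p' by blast
  qed
  have cl: "colim_class C X (ObjMap Z k) (S k) = cls C X (ObjMap Z k) (i, b \<cdot>\<^bsub>C\<^esub> a)"
    if "represents C Y Z g k j b" "represents C X Y f j i a" for k j b i a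
    using pro_comp_component[OF D(1,2,4) representsD(9,10)[OF that(1)] representsD(9)[OF that(2)]]
      representsD(10)[OF that(2)] by (simp add: S_def F_def G_def)
  have car: "(i, b \<cdot>\<^bsub>C\<^esub> a) \<in> colim_carrier C X (ObjMap Z k)"
    if "represents C Y Z g k j b" "represents C X Y f j i a" for k j b i a
    using carrier_post[OF pro_object_shape(2)[OF D(1)] representsD(9)[OF that(2)] representsD(8)[OF that(1)]] .
  have "represents C X Z (pro_arr C X Z S) k i (b \<cdot>\<^bsub>C\<^esub> a)"
  proof (rule pro_arr_represents(2)[OF D(1,3)])
    fix k assume k: "k \<in> Obj (Shape Z)"
    then obtain j b where "represents C Y Z g k j b" using represents_exists[OF Dg(1)] by metis
    moreover then obtain i a where "represents C X Y f j i a"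
      using represents_exists[OF Df(1)] representsD(7) by metis
    ultimately show "S k \<noteq> {}" using S_I by blast
  next
    fix k i c assume "k \<in> Obj (Shape Z)" "(i, c) \<in> S k"
    then show "(i, c) \<in> colim_carrier C X (ObjMap Z k)" using S_E car by metis
  next
    fix k p q assume "k \<in> Obj (Shape Z)" "p \<in> S k" "q \<in> S k"
    then show "(p, q) \<in> colim_rel C X (ObjMap Z k)" unfolding cls_eq[symmetric] using S_E cl by metis
  next
    fix k k' v i c assume v: "v \<in> hom (Shape Z) k k'" and ic: "(i, c) \<in> S k"
    have "k \<in> Obj (Shape Z)"
      using hom_obj[OF pro_object_shape(1)[OF D(3)] v] by simp
    then obtain a j b where c: "c = b \<cdot>\<^bsub>C\<^esub> a" and r: "represents C Y Z g k j b" "represents C X Y f j i a"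
      using S_E ic by blast
    have "(i, (ArrMap Z v \<cdot>\<^bsub>C\<^esub> b) \<cdot>\<^bsub>C\<^esub> a) \<in> S k'"
      using S_I[OF represents_push[OF r(1) v] r(2)] .
    moreover have "(ArrMap Z v \<cdot>\<^bsub>C\<^esub> b) \<cdot>\<^bsub>C\<^esub> a = ArrMap Z v \<cdot>\<^bsub>C\<^esub> c"
      using category.comp_assoc[OF pro_object_shape(2)[OF D(1)] representsD(8)[OF r(2)] representsD(8)[OF r(1)]
        pro_object_shape(4)[OF D(3) v]] c by simp
    ultimately show "\<exists>p\<in>S k'. (p, (i, ArrMap Z v \<cdot>\<^bsub>C\<^esub> c)) \<in> colim_rel C X (ObjMap Z k')"
      by (intro bexI[of _ "(i, (ArrMap Z v \<cdot>\<^bsub>C\<^esub> b) \<cdot>\<^bsub>C\<^esub> a)"]) (simp_all add: colim_rel_refl)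
  next
    show "k \<in> Obj (Shape Z)" by (rule Dg(6))
    show "(i, b \<cdot>\<^bsub>C\<^esub> a) \<in> S k" using S_I f g by blast
  qed
  then show ?thesis using comp by simp
qed

lemma represents_ident:
  assumes X: "X \<in> pro_objects C"
  shows "Ident (pro C) X \<in> hom (pro C) X X"
    and "i \<in> Obj (Shape X) \<Longrightarrow> represents C X X (Ident (pro C) X) i i (Ident C (ObjMap X i))"
proof -
  note P = pro_object_shape[OF X]
  have id: "Ident (pro C) X = pro_arr C X X (\<lambda>i. {(i, Ident C (ObjMap X i))})"
    by (simp add: pro_def)
  have nat: "\<exists>u\<in>hom (Shape X) j j'. Ident C (ObjMap X j') \<cdot>\<^bsub>C\<^esub> ArrMap X u = ArrMap X v \<cdot>\<^bsub>C\<^esub> Ident C (ObjMap X j)"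
    if v: "v \<in> hom (Shape X) j j'" for v j j'
    using v category.comp_ident_left[OF P(2) P(4)[OF v]] category.comp_ident_right[OF P(2) P(4)[OF v]] by auto
  have car: "j \<in> Obj (Shape X) \<and> Ident C (ObjMap X j) \<in> hom C (ObjMap X j) (ObjMap X j)" if "j \<in> Obj (Shape X)" for j
    using that P(3) category.ident_hom[OF P(2)] by simp
  show "Ident (pro C) X \<in> hom (pro C) X X"
    unfolding id by (rule levelwise_represents(1)[OF X X car nat])
  show "i \<in> Obj (Shape X) \<Longrightarrow> represents C X X (Ident (pro C) X) i i (Ident C (ObjMap X i))"
    unfolding id by (rule levelwise_represents(2)[OF X X car nat])
qed

lemma hom_pro_comp:
  assumes f: "f \<in> hom (pro C) X Y" and g: "g \<in> hom (pro C) Y Z"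
  shows "g \<cdot>\<^bsub>pro C\<^esub> f \<in> hom (pro C) X Z"
proof -
  have "Z \<in> pro_objects C" using g by (auto simp: pro_homset)
  then obtain k where k: "k \<in> Obj (Shape Z)" using pro_object_cofiltered(1) by blast
  obtain j b where b: "represents C Y Z g k j b" using represents_exists[OF g k] .
  obtain i a where a: "represents C X Y f j i a" using represents_exists[OF f representsD(7)[OF b]] .
  show ?thesis by (rule representsD(1)[OF represents_comp[OF b a]])
qed

lemma category_pro: "category (pro C)"
proof
  fix f assume "f \<in> Arr (pro C)"
  then show "Dom (pro C) f \<in> Obj (pro C)" "Cod (pro C) f \<in> Obj (pro C)"
    by (auto simp: pro_def)
next
  fix X assume "X \<in> Obj (pro C)"
  then show "Ident (pro C) X \<in> hom (pro C) X X"
    using represents_ident(1) by (simp add: pro_def)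
next
  fix f g X Y Z assume "f \<in> hom (pro C) X Y" "g \<in> hom (pro C) Y Z"
  then show "g \<cdot>\<^bsub>pro C\<^esub> f \<in> hom (pro C) X Z" by (rule hom_pro_comp)
next
  fix f X Y assume f: "f \<in> hom (pro C) X Y"
  then have XY: "X \<in> pro_objects C" "Y \<in> pro_objects C" by (auto simp: pro_homset)
  note C = pro_object_shape(2)[OF XY(1)]
  show "Ident (pro C) Y \<cdot>\<^bsub>pro C\<^esub> f = f"
  proof (rule pro_arrow_eqI[OF XY])
    fix j assume j: "j \<in> Obj (Shape Y)"
    obtain i a where a: "represents C X Y f j i a" using represents_exists[OF f j] .
    show "\<exists>i a b. represents C X Y (Ident (pro C) Y \<cdot>\<^bsub>pro C\<^esub> f) j i a \<and> represents C X Y f j i b \<and> a = b"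
      using represents_comp[OF represents_ident(2)[OF XY(2) j] a] a
        category.comp_ident_left[OF C representsD(8)[OF a]] by blast
  qed
  show "f \<cdot>\<^bsub>pro C\<^esub> Ident (pro C) X = f"
  proof (rule pro_arrow_eqI[OF XY])
    fix j assume j: "j \<in> Obj (Shape Y)"
    obtain i a where a: "represents C X Y f j i a" using represents_exists[OF f j] .
    show "\<exists>i a b. represents C X Y (f \<cdot>\<^bsub>pro C\<^esub> Ident (pro C) X) j i a \<and> represents C X Y f j i b \<and> a = b"
      using represents_comp[OF a represents_ident(2)[OF XY(1) representsD(7)[OF a]]] a
        category.comp_ident_right[OF C representsD(8)[OF a]] by blast
  qed
next
  fix f g h W X Y Z assume f: "f \<in> hom (pro C) W X" and g: "g \<in> hom (pro C) X Y" and h: "h \<in> hom (pro C) Y Z"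
  then have WZ: "W \<in> pro_objects C" "Z \<in> pro_objects C" by (auto simp: pro_homset)
  show "(h \<cdot>\<^bsub>pro C\<^esub> g) \<cdot>\<^bsub>pro C\<^esub> f = h \<cdot>\<^bsub>pro C\<^esub> g \<cdot>\<^bsub>pro C\<^esub> f"
  proof (rule pro_arrow_eqI[OF WZ])
    fix k assume k: "k \<in> Obj (Shape Z)"
    obtain j c where c: "represents C Y Z h k j c" using represents_exists[OF h k] .
    obtain i b where b: "represents C X Y g j i b" using represents_exists[OF g representsD(7)[OF c]] .
    obtain l a where a: "represents C W X f i l a" using represents_exists[OF f representsD(7)[OF b]] .
    show "\<exists>i a b. represents C W Z ((h \<cdot>\<^bsub>pro C\<^esub> g) \<cdot>\<^bsub>pro C\<^esub> f) k i a \<and>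
        represents C W Z (h \<cdot>\<^bsub>pro C\<^esub> g \<cdot>\<^bsub>pro C\<^esub> f) k i b \<and> a = b"
      using represents_comp[OF represents_comp[OF c b] a] represents_comp[OF c represents_comp[OF b a]]
        category.comp_assoc[OF pro_object_shape(2)[OF WZ(1)] representsD(8)[OF a] representsD(8)[OF b] representsD(8)[OF c]]
      by blast
  qed
qed

section \<open>Tensor products and structure arrows of pro-objects\<close>

lemma pro_tensor_simps [simp]:
  fixes X Y :: "('i::infinite, 'o, 'a) diagram"
  shows "Shape (pro_tensor C X Y) = prod_shape (Shape X) (Shape Y)"
    "ObjMap (pro_tensor C X Y) (idx_pair (i, j)) = ObjMap X i \<otimes>\<^bsub>C\<^esub> ObjMap Y j"
    "ArrMap (pro_tensor C X Y) (idx_pair (u, v)) = ArrMap X u \<boxtimes>\<^bsub>C\<^esub> ArrMap Y v"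
  by (simp_all add: pro_tensor_def)

lemma pro_unit_simps [simp]:
  "Obj (Shape (pro_unit C)) = {idx_star}" "u \<in> hom (Shape (pro_unit C)) i j \<longleftrightarrow> u = idx_star \<and> i = idx_star \<and> j = idx_star"
  "ObjMap (pro_unit C) i = Unit C" "ArrMap (pro_unit C) u = Ident C (Unit C)"
  by (auto simp: pro_unit_def const_diagram_def unit_shape_def hom_def)

lemma shape_ident_comp:
  assumes "X \<in> pro_objects C"
  shows "i \<in> Obj (Shape X) \<Longrightarrow> Ident (Shape X) i \<in> hom (Shape X) i i"
    "u \<in> hom (Shape X) k i \<Longrightarrow> v \<in> hom (Shape X) l k \<Longrightarrow> u \<cdot>\<^bsub>Shape X\<^esub> v \<in> hom (Shape X) l i"
  using category.ident_hom[OF pro_object_shape(1)[OF assms]] category.comp_hom[OF pro_object_shape(1)[OF assms]]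
  by auto

lemma pro_object_arr [simp]:
  assumes "X \<in> pro_objects C" "u \<in> hom (Shape X) k i"
  shows "ArrMap X u \<in> Arr C" "Dom C (ArrMap X u) = ObjMap X k" "Cod C (ArrMap X u) = ObjMap X i"
    "k \<in> Obj (Shape X)" "i \<in> Obj (Shape X)"
  using pro_object_shape(4)[OF assms] hom_obj[OF pro_object_shape(1)[OF assms(1)] assms(2)]
  by (auto simp: hom_def)

lemma represents_arr [simp]:
  assumes "represents C X Y h j i f"
  shows "f \<in> Arr C" "Dom C f = ObjMap X i" "Cod C f = ObjMap Y j"
  using representsD(8)[OF assms] by (auto simp: hom_def)

text \<open>Inverting the horizontal sides of the naturality squares of a levelwise isomorphism gives naturality of the
  inverses, which therefore form an arrow along the inverse reindexing.\<close>

lemma levelwise_inverse: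
  assumes X: "X \<in> pro_objects C" and Y: "Y \<in> pro_objects C"
    and car: "\<And>j. j \<in> Obj (Shape Y) \<Longrightarrow> \<phi> j \<in> Obj (Shape X) \<and> a j \<in> hom C (ObjMap X (\<phi> j)) (ObjMap Y j)"
    and nat: "\<And>j j' v. v \<in> hom (Shape Y) j j' \<Longrightarrow>
      \<exists>u\<in>hom (Shape X) (\<phi> j) (\<phi> j'). a j' \<cdot>\<^bsub>C\<^esub> ArrMap X u = ArrMap Y v \<cdot>\<^bsub>C\<^esub> a j"
    and iso: "\<And>j. j \<in> Obj (Shape Y) \<Longrightarrow> iso_arr C (a j)"
    and idx: "\<And>j. j \<in> Obj (Shape Y) \<Longrightarrow> \<psi> (\<phi> j) = j"
      "\<And>i. i \<in> Obj (Shape X) \<Longrightarrow> \<psi> i \<in> Obj (Shape Y) \<and> \<phi> (\<psi> i) = i"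
    and nat': "\<And>i i' u. u \<in> hom (Shape X) i i' \<Longrightarrow>
      \<exists>v\<in>hom (Shape Y) (\<psi> i) (\<psi> i'). ArrMap Y v \<cdot>\<^bsub>C\<^esub> a (\<psi> i) = a (\<psi> i') \<cdot>\<^bsub>C\<^esub> ArrMap X u"
  shows "inverse_arrows (pro C) (pro_arr C X Y (\<lambda>j. {(\<phi> j, a j)}))
      (pro_arr C Y X (\<lambda>i. {(\<psi> i, inverse_arr C (a (\<psi> i)))}))"
    and "i \<in> Obj (Shape X) \<Longrightarrow>
      represents C Y X (pro_arr C Y X (\<lambda>i. {(\<psi> i, inverse_arr C (a (\<psi> i)))})) i (\<psi> i) (inverse_arr C (a (\<psi> i)))"
proof -
  interpret category C using pro_object_shape(2)[OF X] .
  define h where "h = pro_arr C X Y (\<lambda>j. {(\<phi> j, a j)})"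
  define k where "k = pro_arr C Y X (\<lambda>i. {(\<psi> i, inverse_arr C (a (\<psi> i)))})"
  have a: "a j \<in> Arr C" "Dom C (a j) = ObjMap X (\<phi> j)" "Cod C (a j) = ObjMap Y j" if "j \<in> Obj (Shape Y)" for j
    using car[OF that] by (auto simp: hom_def)
  have h: "h \<in> hom (pro C) X Y" "\<And>j. j \<in> Obj (Shape Y) \<Longrightarrow> represents C X Y h j (\<phi> j) (a j)"
    unfolding h_def by (rule levelwise_represents[OF X Y car nat]; assumption)+
  have kcar: "\<psi> i \<in> Obj (Shape Y) \<and> inverse_arr C (a (\<psi> i)) \<in> hom C (ObjMap Y (\<psi> i)) (ObjMap X i)"
    if "i \<in> Obj (Shape X)" for i
    using idx(2)[OF that] iso a by (simp add: hom_def)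
  have knat: "\<exists>v\<in>hom (Shape Y) (\<psi> i) (\<psi> i'). inverse_arr C (a (\<psi> i')) \<cdot>\<^bsub>C\<^esub> ArrMap Y v = ArrMap X u \<cdot>\<^bsub>C\<^esub> inverse_arr C (a (\<psi> i))"
    if u: "u \<in> hom (Shape X) i i'" for i i' u
  proof -
    obtain v where v: "v \<in> hom (Shape Y) (\<psi> i) (\<psi> i')" "ArrMap Y v \<cdot>\<^bsub>C\<^esub> a (\<psi> i) = a (\<psi> i') \<cdot>\<^bsub>C\<^esub> ArrMap X u"
      using nat'[OF u] by blast
    have i: "i \<in> Obj (Shape X)" "i' \<in> Obj (Shape X)" using pro_object_arr[OF X u] by auto
    have "ArrMap X u \<cdot>\<^bsub>C\<^esub> inverse_arr C (a (\<psi> i)) = inverse_arr C (a (\<psi> i')) \<cdot>\<^bsub>C\<^esub> ArrMap Y v"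
      by (rule inverse_natural)
        (use v(2) iso a idx(2)[OF i(1)] idx(2)[OF i(2)] pro_object_arr[OF X u] pro_object_arr[OF Y v(1)] in simp_all)
    then show ?thesis using v(1) by (metis (no_types))
  qed
  have k: "k \<in> hom (pro C) Y X" "\<And>i. i \<in> Obj (Shape X) \<Longrightarrow> represents C Y X k i (\<psi> i) (inverse_arr C (a (\<psi> i)))"
    unfolding k_def by (rule levelwise_represents[OF Y X kcar knat]; assumption)+
  show "i \<in> Obj (Shape X) \<Longrightarrow>
      represents C Y X (pro_arr C Y X (\<lambda>i. {(\<psi> i, inverse_arr C (a (\<psi> i)))})) i (\<psi> i) (inverse_arr C (a (\<psi> i)))"
    using k(2) by (simp add: k_def)
  have "k \<cdot>\<^bsub>pro C\<^esub> h = Ident (pro C) X"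
  proof (rule pro_arrow_eqI[OF X X])
    fix i assume i: "i \<in> Obj (Shape X)"
    have "represents C X X (k \<cdot>\<^bsub>pro C\<^esub> h) i i (inverse_arr C (a (\<psi> i)) \<cdot>\<^bsub>C\<^esub> a (\<psi> i))"
      using represents_comp[OF k(2)[OF i] h(2)] idx(2)[OF i] by simp
    moreover have "inverse_arr C (a (\<psi> i)) \<cdot>\<^bsub>C\<^esub> a (\<psi> i) = Ident C (ObjMap X i)"
      using idx(2)[OF i] iso a by simp
    ultimately show "\<exists>j f g. represents C X X (k \<cdot>\<^bsub>pro C\<^esub> h) i j f \<and> represents C X X (Ident (pro C) X) i j g \<and> f = g"
      using represents_ident(2)[OF X i] by blast
  qed
  moreover have "h \<cdot>\<^bsub>pro C\<^esub> k = Ident (pro C) Y"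
  proof (rule pro_arrow_eqI[OF Y Y])
    fix j assume j: "j \<in> Obj (Shape Y)"
    have "represents C Y Y (h \<cdot>\<^bsub>pro C\<^esub> k) j j (a j \<cdot>\<^bsub>C\<^esub> inverse_arr C (a j))"
      using represents_comp[OF h(2)[OF j] k(2)] car[OF j] idx(1)[OF j] by simp
    moreover have "a j \<cdot>\<^bsub>C\<^esub> inverse_arr C (a j) = Ident C (ObjMap Y j)"
      using iso[OF j] a[OF j] by simp
    ultimately show "\<exists>i f g. represents C Y Y (h \<cdot>\<^bsub>pro C\<^esub> k) j i f \<and> represents C Y Y (Ident (pro C) Y) j i g \<and> f = g"
      using represents_ident(2)[OF Y j] by blast
  qed
  ultimately show "inverse_arrows (pro C) (pro_arr C X Y (\<lambda>j. {(\<phi> j, a j)}))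
      (pro_arr C Y X (\<lambda>i. {(\<psi> i, inverse_arr C (a (\<psi> i)))}))"
    using h(1) k(1) by (simp add: inverse_arrows_def hom_def h_def[symmetric] k_def[symmetric])
qed

context markov_category
begin

lemma pro_unit_object [simp]: "pro_unit C \<in> pro_objects C"
  unfolding pro_unit_def by (rule const_object[OF category_axioms unit_obj])

lemma pro_tensor_closed [simp]:
  fixes X Y :: "('i::infinite, 'o, 'a) diagram"
  shows "X \<in> pro_objects C \<Longrightarrow> Y \<in> pro_objects C \<Longrightarrow> pro_tensor C X Y \<in> pro_objects C"
  by (rule pro_tensor_object[OF monoidal_category_axioms])

text \<open>The tensor of two arrows is likewise spanned by all tensors of representatives, which are
  equivalent by \<open>tensor_rel\<close>.\<close>

lemma represents_tensor:
  fixes X Y X' Y' :: "('i::infinite, 'o, 'a) diagram"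
  assumes h: "represents C X Y h j i f" and h': "represents C X' Y' h' j' i' f'"
  shows "represents C (pro_tensor C X X') (pro_tensor C Y Y') (pro_tensor_arr C h h')
    (idx_pair (j, j')) (idx_pair (i, i')) (f \<boxtimes> f')"
proof -
  define F F' where "F = snd (snd h)" and "F' = snd (snd h')"
  note D = representsD[OF h, folded F_def] and D' = representsD[OF h', folded F'_def]
  let ?T = "pro_tensor C X X'" and ?U = "pro_tensor C Y Y'"
  have T: "?T \<in> pro_objects C" and U: "?U \<in> pro_objects C" using D D' by simp_all
  define S where "S l = {(idx_pair (i, i'), f \<boxtimes> f') | i f i' f'. (i, f) \<in> F (idx_fst l) \<and> (i', f') \<in> F' (idx_snd l)}" for l
  have tens: "pro_tensor_arr C h h' = pro_arr C ?T ?U S"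
    by (subst D(4), subst D'(4)) (simp add: pro_tensor_arr_def S_def[abs_def])
  have rF: "(i, f) \<in> F j \<longleftrightarrow> represents C X Y h j i f" if "j \<in> Obj (Shape Y)" for j i f
    using D(1) that by (simp add: represents_def F_def)
  have rF': "(i, f) \<in> F' j \<longleftrightarrow> represents C X' Y' h' j i f" if "j \<in> Obj (Shape Y')" for j i f
    using D'(1) that by (simp add: represents_def F'_def)
  have S: "p \<in> S (idx_pair (j, j')) \<longleftrightarrow> (\<exists>i f i' f'. p = (idx_pair (i, i'), f \<boxtimes> f') \<and>
      represents C X Y h j i f \<and> represents C X' Y' h' j' i' f')"
    if "j \<in> Obj (Shape Y)" "j' \<in> Obj (Shape Y')" for p j j'
    unfolding S_def by (simp add: rF[OF that(1)] rF'[OF that(2)])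
  have car: "(idx_pair (i, i'), f \<boxtimes> f') \<in> colim_carrier C ?T (ObjMap Y j \<otimes> ObjMap Y' j')"
    if "represents C X Y h j i f" "represents C X' Y' h' j' i' f'" for i f i' f' j j'
    using tensor_carrier[OF monoidal_category_axioms representsD(9)[OF that(1)] representsD(9)[OF that(2)]] .
  have "represents C ?T ?U (pro_arr C ?T ?U S) (idx_pair (j, j')) (idx_pair (i, i')) (f \<boxtimes> f')"
  proof (rule pro_arr_represents(2)[OF T U])
    fix l assume "l \<in> Obj (Shape ?U)"
    then obtain m m' where l: "l = idx_pair (m, m')" and m: "m \<in> Obj (Shape Y)" "m' \<in> Obj (Shape Y')" by auto
    obtain i f where "represents C X Y h m i f" using represents_exists[OF D(1) m(1)] .
    moreover obtain i' f' where "represents C X' Y' h' m' i' f'" using represents_exists[OF D'(1) m(2)] .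
    ultimately show "S l \<noteq> {}" using S[OF m] l by blast
  next
    fix l k b assume "l \<in> Obj (Shape ?U)" and kb: "(k, b) \<in> S l"
    then obtain m m' where l: "l = idx_pair (m, m')" and m: "m \<in> Obj (Shape Y)" "m' \<in> Obj (Shape Y')" by auto
    show "(k, b) \<in> colim_carrier C ?T (ObjMap ?U l)"
      using kb car unfolding l S[OF m] by auto
  next
    fix l p q assume "l \<in> Obj (Shape ?U)" and pq: "p \<in> S l" "q \<in> S l"
    then obtain m m' where l: "l = idx_pair (m, m')" and m: "m \<in> Obj (Shape Y)" "m' \<in> Obj (Shape Y')" by auto
    obtain i f i' f' where p: "p = (idx_pair (i, i'), f \<boxtimes> f')"
      "represents C X Y h m i f" "represents C X' Y' h' m' i' f'" using pq(1) unfolding l S[OF m] by blast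
    obtain k g k' g' where q: "q = (idx_pair (k, k'), g \<boxtimes> g')"
      "represents C X Y h m k g" "represents C X' Y' h' m' k' g'" using pq(2) unfolding l S[OF m] by blast
    show "(p, q) \<in> colim_rel C ?T (ObjMap ?U l)"
      unfolding p(1) q(1) l pro_tensor_simps
      by (rule tensor_rel[OF monoidal_category_axioms D(2) D'(2) representsD(9)[OF p(2)] representsD(9)[OF p(3)]])
        (use represents_iff_rel[OF p(2)] represents_iff_rel[OF p(3)] q in simp_all)
  next
    fix l l' w k b assume "w \<in> hom (Shape ?U) l l'" and kb: "(k, b) \<in> S l"
    then obtain v v' m m' n n' where w: "w = idx_pair (v, v')" "l = idx_pair (m, m')" "l' = idx_pair (n, n')"
      and v: "v \<in> hom (Shape Y) m n" "v' \<in> hom (Shape Y') m' n'"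
      by (auto simp: prod_shape_hom)
    have m: "m \<in> Obj (Shape Y)" "m' \<in> Obj (Shape Y')" "n \<in> Obj (Shape Y)" "n' \<in> Obj (Shape Y')"
      using pro_object_arr[OF D(3) v(1)] pro_object_arr[OF D'(3) v(2)] by auto
    obtain i f i' f' where p: "(k, b) = (idx_pair (i, i'), f \<boxtimes> f')"
      "represents C X Y h m i f" "represents C X' Y' h' m' i' f'" using kb unfolding w S[OF m(1,2)] by blast
    have "ArrMap ?U w \<cdot> b = (ArrMap Y v \<cdot> f) \<boxtimes> (ArrMap Y' v' \<cdot> f')"
      using p pro_object_arr[OF D(3) v(1)] pro_object_arr[OF D'(3) v(2)] represents_arr[OF p(2)] represents_arr[OF p(3)]
      by (simp add: w)
    moreover have "(k, (ArrMap Y v \<cdot> f) \<boxtimes> (ArrMap Y' v' \<cdot> f')) \<in> S l'"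
      unfolding w S[OF m(3,4)] using represents_push[OF p(2) v(1)] represents_push[OF p(3) v(2)] p(1) by blast
    ultimately show "\<exists>q\<in>S l'. (q, (k, ArrMap ?U w \<cdot> b)) \<in> colim_rel C ?T (ObjMap ?U l')"
      using colim_rel_refl by metis
  next
    show "idx_pair (j, j') \<in> Obj (Shape ?U)" using D(6) D'(6) by simp
    show "(idx_pair (i, i'), f \<boxtimes> f') \<in> S (idx_pair (j, j'))" using S[OF D(6) D'(6)] h h' by blast
  qed
  then show ?thesis using tens by simp
qed

lemma represents_assoc:
  fixes X Y Z :: "('i::infinite, 'o, 'a) diagram"
  assumes "X \<in> pro_objects C" "Y \<in> pro_objects C" "Z \<in> pro_objects C"
  defines "L \<equiv> pro_tensor C (pro_tensor C X Y) Z" and "R \<equiv> pro_tensor C X (pro_tensor C Y Z)"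
  shows "pro_assoc C X Y Z \<in> hom (pro C) L R"
    "\<exists>h. inverse_arrows (pro C) (pro_assoc C X Y Z) h \<and>
      (\<forall>i\<in>Obj (Shape X). \<forall>j\<in>Obj (Shape Y). \<forall>k\<in>Obj (Shape Z).
        represents C R L h (idx_pair (idx_pair (i, j), k)) (idx_pair (i, idx_pair (j, k)))
          (inverse_arr C (Assoc C (ObjMap X i) (ObjMap Y j) (ObjMap Z k))))"
    "\<lbrakk>i \<in> Obj (Shape X); j \<in> Obj (Shape Y); k \<in> Obj (Shape Z)\<rbrakk> \<Longrightarrow>
      represents C L R (pro_assoc C X Y Z) (idx_pair (i, idx_pair (j, k))) (idx_pair (idx_pair (i, j), k))
        (Assoc C (ObjMap X i) (ObjMap Y j) (ObjMap Z k))"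
proof -
  note P = assms(1-3)
  have L: "L \<in> pro_objects C" and R: "R \<in> pro_objects C" using P by (simp_all add: L_def R_def)
  \<comment> \<open>the rebracketings of index triples in both directions\<close>
  define \<phi> where "\<phi> l = (idx_pair (idx_pair (idx_fst l, idx_fst (idx_snd l)), idx_snd (idx_snd l)) :: 'i)" for l
  define \<psi> where "\<psi> l = (idx_pair (idx_fst (idx_fst l), idx_pair (idx_snd (idx_fst l), idx_snd l)) :: 'i)" for l
  define a where "a l = Assoc C (ObjMap X (idx_fst l)) (ObjMap Y (idx_fst (idx_snd l))) (ObjMap Z (idx_snd (idx_snd l)))" for l
  have def: "pro_assoc C X Y Z = pro_arr C L R (\<lambda>l. {(\<phi> l, a l)})"
    by (simp add: pro_assoc_def L_def R_def Let_def \<phi>_def[abs_def] a_def[abs_def])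
  have car: "\<phi> l \<in> Obj (Shape L) \<and> a l \<in> hom C (ObjMap L (\<phi> l)) (ObjMap R l)" if "l \<in> Obj (Shape R)" for l
    using that P assoc_hom by (auto simp: L_def R_def \<phi>_def a_def pro_object_shape)
  have sq: "a (idx_pair (i', idx_pair (j', k'))) \<cdot> ((ArrMap X u \<boxtimes> ArrMap Y v) \<boxtimes> ArrMap Z w) =
      (ArrMap X u \<boxtimes> (ArrMap Y v \<boxtimes> ArrMap Z w)) \<cdot> a (idx_pair (i, idx_pair (j, k)))"
    if "u \<in> hom (Shape X) i i'" "v \<in> hom (Shape Y) j j'" "w \<in> hom (Shape Z) k k'" for u i i' v j j' w k k'
    using assoc_natural pro_object_shape(4)[OF P(1) that(1)] pro_object_shape(4)[OF P(2) that(2)]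
      pro_object_shape(4)[OF P(3) that(3)] by (simp add: a_def)
  have nat: "\<exists>u\<in>hom (Shape L) (\<phi> l) (\<phi> l'). a l' \<cdot> ArrMap L u = ArrMap R v \<cdot> a l" if vh: "v \<in> hom (Shape R) l l'" for l l' v
  proof -
    obtain u i i' t j j' w k k' where v: "v = idx_pair (u, idx_pair (t, w))" "l = idx_pair (i, idx_pair (j, k))"
       "l' = idx_pair (i', idx_pair (j', k'))" and h: "u \<in> hom (Shape X) i i'" "t \<in> hom (Shape Y) j j'" "w \<in> hom (Shape Z) k k'"
      using vh by (auto simp: R_def prod_shape_hom)
    show ?thesis
      by (rule bexI[of _ "idx_pair (idx_pair (u, t), w)"]) (use sq[OF h] h in \<open>auto simp: v L_def R_def \<phi>_def prod_shape_hom\<close>)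
  qed
  have nat': "\<exists>v\<in>hom (Shape R) (\<psi> l) (\<psi> l'). ArrMap R v \<cdot> a (\<psi> l) = a (\<psi> l') \<cdot> ArrMap L u" if uh: "u \<in> hom (Shape L) l l'" for l l' u
  proof -
    obtain r i i' t j j' w k k' where v: "u = idx_pair (idx_pair (r, t), w)" "l = idx_pair (idx_pair (i, j), k)"
       "l' = idx_pair (idx_pair (i', j'), k')" and h: "r \<in> hom (Shape X) i i'" "t \<in> hom (Shape Y) j j'" "w \<in> hom (Shape Z) k k'"
      using uh by (auto simp: L_def prod_shape_hom)
    show ?thesis
      by (rule bexI[of _ "idx_pair (r, idx_pair (t, w))"]) (use sq[OF h] h in \<open>auto simp: v L_def R_def \<psi>_def prod_shape_hom\<close>)
  qed
  have iso: "iso_arr C (a l)" if "l \<in> Obj (Shape R)" for l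
    using that P by (auto simp: R_def a_def pro_object_shape)
  have idx: "\<psi> (\<phi> l) = l" if "l \<in> Obj (Shape R)" for l
    using that by (auto simp: R_def \<phi>_def \<psi>_def)
  have idx': "\<psi> l \<in> Obj (Shape R) \<and> \<phi> (\<psi> l) = l" if "l \<in> Obj (Shape L)" for l
    using that by (auto simp: R_def L_def \<phi>_def \<psi>_def)
  show "pro_assoc C X Y Z \<in> hom (pro C) L R"
    unfolding def by (rule levelwise_represents(1)[OF L R car nat])
  show "\<lbrakk>i \<in> Obj (Shape X); j \<in> Obj (Shape Y); k \<in> Obj (Shape Z)\<rbrakk> \<Longrightarrow>
      represents C L R (pro_assoc C X Y Z) (idx_pair (i, idx_pair (j, k))) (idx_pair (idx_pair (i, j), k))
        (Assoc C (ObjMap X i) (ObjMap Y j) (ObjMap Z k))"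
    unfolding def using levelwise_represents(2)[OF L R car nat, of "idx_pair (i, idx_pair (j, k))"]
    by (simp add: R_def \<phi>_def a_def)
  note inv = levelwise_inverse[OF L R car nat iso idx idx' nat', folded def]
  show "\<exists>h. inverse_arrows (pro C) (pro_assoc C X Y Z) h \<and>
      (\<forall>i\<in>Obj (Shape X). \<forall>j\<in>Obj (Shape Y). \<forall>k\<in>Obj (Shape Z).
        represents C R L h (idx_pair (idx_pair (i, j), k)) (idx_pair (i, idx_pair (j, k)))
          (inverse_arr C (Assoc C (ObjMap X i) (ObjMap Y j) (ObjMap Z k))))"
  proof (intro exI conjI ballI, rule inv(1))
    fix i j k assume "i \<in> Obj (Shape X)" "j \<in> Obj (Shape Y)" "k \<in> Obj (Shape Z)"
    then show "represents C R L (pro_arr C R L (\<lambda>i. {(\<psi> i, inverse_arr C (a (\<psi> i)))}))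
       (idx_pair (idx_pair (i, j), k)) (idx_pair (i, idx_pair (j, k)))
       (inverse_arr C (Assoc C (ObjMap X i) (ObjMap Y j) (ObjMap Z k)))"
      using inv(2)[of "idx_pair (idx_pair (i, j), k)"] by (simp add: L_def \<psi>_def a_def)
  qed
qed

lemma represents_lunit:
  fixes X :: "('i::infinite, 'o, 'a) diagram"
  assumes X: "X \<in> pro_objects C"
  shows "\<exists>h. inverse_arrows (pro C) (pro_lunit C X) h"
    "i \<in> Obj (Shape X) \<Longrightarrow>
      represents C (pro_tensor C (pro_unit C) X) X (pro_lunit C X) i (idx_pair (idx_star, i)) (LUnit C (ObjMap X i))"
    "pro_lunit C X \<in> hom (pro C) (pro_tensor C (pro_unit C) X) X"
proof -
  let ?T = "pro_tensor C (pro_unit C) X"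
  have T: "?T \<in> pro_objects C" using X by simp
  let ?\<phi> = "\<lambda>i. idx_pair (idx_star, i)" and ?a = "\<lambda>i. LUnit C (ObjMap X i)"
  have car: "?\<phi> i \<in> Obj (Shape ?T) \<and> ?a i \<in> hom C (ObjMap ?T (?\<phi> i)) (ObjMap X i)" if "i \<in> Obj (Shape X)" for i
    using that X by (simp add: pro_object_shape hom_def)
  have sq: "LUnit C (ObjMap X j) \<cdot> (Ident C (Unit C) \<boxtimes> ArrMap X v) = ArrMap X v \<cdot> LUnit C (ObjMap X i)"
    if "v \<in> hom (Shape X) i j" for v i j
    using lunit_natural[OF pro_object_shape(4)[OF X that]] .
  have nat: "\<exists>u\<in>hom (Shape ?T) (?\<phi> i) (?\<phi> j). ?a j \<cdot> ArrMap ?T u = ArrMap X v \<cdot> ?a i" if v: "v \<in> hom (Shape X) i j" for i j v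
    by (rule bexI[of _ "idx_pair (idx_star, v)"]) (use v sq[OF v] in \<open>simp_all add: prod_shape_hom\<close>)
  have nat': "\<exists>v\<in>hom (Shape X) (idx_snd i) (idx_snd j). ArrMap X v \<cdot> ?a (idx_snd i) = ?a (idx_snd j) \<cdot> ArrMap ?T u"
    if u: "u \<in> hom (Shape ?T) i j" for i j u
    by (rule bexI[of _ "idx_snd u"]) (use u sq in \<open>auto simp add: prod_shape_hom\<close>)
  show "i \<in> Obj (Shape X) \<Longrightarrow>
      represents C ?T X (pro_lunit C X) i (idx_pair (idx_star, i)) (LUnit C (ObjMap X i))"
    unfolding pro_lunit_def by (rule levelwise_represents(2)[OF T X car nat])
  show "pro_lunit C X \<in> hom (pro C) ?T X"
    unfolding pro_lunit_def by (rule levelwise_represents(1)[OF T X car nat])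
  show "\<exists>h. inverse_arrows (pro C) (pro_lunit C X) h"
    unfolding pro_lunit_def by (rule exI, rule levelwise_inverse(1)[OF T X car nat, where \<psi> = idx_snd])
      (use X nat' in \<open>auto simp: pro_object_shape\<close>)
qed

lemma represents_runit:
  fixes X :: "('i::infinite, 'o, 'a) diagram"
  assumes X: "X \<in> pro_objects C"
  shows "\<exists>h. inverse_arrows (pro C) (pro_runit C X) h"
    "i \<in> Obj (Shape X) \<Longrightarrow>
      represents C (pro_tensor C X (pro_unit C)) X (pro_runit C X) i (idx_pair (i, idx_star)) (RUnit C (ObjMap X i))"
    "pro_runit C X \<in> hom (pro C) (pro_tensor C X (pro_unit C)) X"
proof -
  let ?T = "pro_tensor C X (pro_unit C)"
  have T: "?T \<in> pro_objects C" using X by simp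
  let ?\<phi> = "\<lambda>i. idx_pair (i, idx_star)" and ?a = "\<lambda>i. RUnit C (ObjMap X i)"
  have car: "?\<phi> i \<in> Obj (Shape ?T) \<and> ?a i \<in> hom C (ObjMap ?T (?\<phi> i)) (ObjMap X i)" if "i \<in> Obj (Shape X)" for i
    using that X by (simp add: pro_object_shape hom_def)
  have sq: "RUnit C (ObjMap X j) \<cdot> (ArrMap X v \<boxtimes> Ident C (Unit C)) = ArrMap X v \<cdot> RUnit C (ObjMap X i)"
    if "v \<in> hom (Shape X) i j" for v i j
    using runit_natural[OF pro_object_shape(4)[OF X that]] .
  have nat: "\<exists>u\<in>hom (Shape ?T) (?\<phi> i) (?\<phi> j). ?a j \<cdot> ArrMap ?T u = ArrMap X v \<cdot> ?a i" if v: "v \<in> hom (Shape X) i j" for i j v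
    by (rule bexI[of _ "idx_pair (v, idx_star)"]) (use v sq[OF v] in \<open>simp_all add: prod_shape_hom\<close>)
  have nat': "\<exists>v\<in>hom (Shape X) (idx_fst i) (idx_fst j). ArrMap X v \<cdot> ?a (idx_fst i) = ?a (idx_fst j) \<cdot> ArrMap ?T u"
    if u: "u \<in> hom (Shape ?T) i j" for i j u
    by (rule bexI[of _ "idx_fst u"]) (use u sq in \<open>auto simp add: prod_shape_hom\<close>)
  show "i \<in> Obj (Shape X) \<Longrightarrow>
      represents C ?T X (pro_runit C X) i (idx_pair (i, idx_star)) (RUnit C (ObjMap X i))"
    unfolding pro_runit_def by (rule levelwise_represents(2)[OF T X car nat])
  show "pro_runit C X \<in> hom (pro C) ?T X"
    unfolding pro_runit_def by (rule levelwise_represents(1)[OF T X car nat])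
  show "\<exists>h. inverse_arrows (pro C) (pro_runit C X) h"
    unfolding pro_runit_def by (rule exI, rule levelwise_inverse(1)[OF T X car nat, where \<psi> = idx_fst])
      (use X nat' in \<open>auto simp: pro_object_shape\<close>)
qed

lemma represents_swap:
  fixes X Y :: "('i::infinite, 'o, 'a) diagram"
  assumes X: "X \<in> pro_objects C" and Y: "Y \<in> pro_objects C"
  shows "pro_swap C X Y \<in> hom (pro C) (pro_tensor C X Y) (pro_tensor C Y X)"
    "\<lbrakk>i \<in> Obj (Shape X); j \<in> Obj (Shape Y)\<rbrakk> \<Longrightarrow>
      represents C (pro_tensor C X Y) (pro_tensor C Y X) (pro_swap C X Y)
        (idx_pair (j, i)) (idx_pair (i, j)) (Swap C (ObjMap X i) (ObjMap Y j))"
proof -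
  let ?T = "pro_tensor C X Y" and ?U = "pro_tensor C Y X"
  have T: "?T \<in> pro_objects C" and U: "?U \<in> pro_objects C" using X Y by simp_all
  define \<phi> where "\<phi> l = (idx_pair (idx_snd l, idx_fst l) :: 'i)" for l
  define a where "a l = Swap C (ObjMap X (idx_snd l)) (ObjMap Y (idx_fst l))" for l
  have def: "pro_swap C X Y = pro_arr C ?T ?U (\<lambda>l. {(\<phi> l, a l)})"
    by (simp add: pro_swap_def Let_def \<phi>_def[abs_def] a_def[abs_def])
  have car: "\<phi> l \<in> Obj (Shape ?T) \<and> a l \<in> hom C (ObjMap ?T (\<phi> l)) (ObjMap ?U l)" if "l \<in> Obj (Shape ?U)" for l
    using that X Y swap_hom by (auto simp: \<phi>_def a_def pro_object_shape)
  have nat: "\<exists>u\<in>hom (Shape ?T) (\<phi> l) (\<phi> l'). a l' \<cdot> ArrMap ?T u = ArrMap ?U v \<cdot> a l" if "v \<in> hom (Shape ?U) l l'" for l l' v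
  proof -
    obtain s j j' t i i' where v: "v = idx_pair (s, t)" "l = idx_pair (j, i)" "l' = idx_pair (j', i')"
      and h: "s \<in> hom (Shape Y) j j'" "t \<in> hom (Shape X) i i'"
      using \<open>v \<in> _\<close> by (auto simp: prod_shape_hom)
    show ?thesis
      by (rule bexI[of _ "idx_pair (t, s)"])
        (use swap_natural[OF pro_object_shape(4)[OF X h(2)] pro_object_shape(4)[OF Y h(1)]] h in
          \<open>auto simp: v \<phi>_def a_def prod_shape_hom\<close>)
  qed
  show "pro_swap C X Y \<in> hom (pro C) ?T ?U"
    unfolding def by (rule levelwise_represents(1)[OF T U car nat])
  show "\<lbrakk>i \<in> Obj (Shape X); j \<in> Obj (Shape Y)\<rbrakk> \<Longrightarrow>
      represents C ?T ?U (pro_swap C X Y) (idx_pair (j, i)) (idx_pair (i, j)) (Swap C (ObjMap X i) (ObjMap Y j))"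
    unfolding def using levelwise_represents(2)[OF T U car nat, of "idx_pair (j, i)"] by (simp add: \<phi>_def a_def)
qed

text \<open>Any span \<open>i \<leftarrow> k \<rightarrow> i'\<close> may be used to compute the copy map at \<open>(i, i')\<close>: the transition arrows of \<open>X\<close> are
  deterministic, so the choices agree over a common refinement of two spans (\<open>pro_copy_class\<close>).  The freedom to
  choose the span is what makes the comonoid axioms easy to check.\<close>

lemma represents_copy:
  fixes X :: "('i::infinite, 'o, 'a) diagram"
  assumes X: "X \<in> pro_objects (det C)"
  shows "pro_copy C X \<in> hom (pro C) X (pro_tensor C X X)"
    "\<lbrakk>u \<in> hom (Shape X) k i; v \<in> hom (Shape X) k i'\<rbrakk> \<Longrightarrow>
      represents C X (pro_tensor C X X) (pro_copy C X) (idx_pair (i, i')) k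
        ((ArrMap X u \<boxtimes> ArrMap X v) \<cdot> Copy C (ObjMap X k))"
proof -
  note X' = pro_objects_det[OF category_axioms X]
  note P = pro_object_shape[OF X']
  let ?T = "pro_tensor C X X"
  have T: "?T \<in> pro_objects C" using X' by simp
  define S where "S l = {(k, (ArrMap X u \<boxtimes> ArrMap X v) \<cdot> Copy C (ObjMap X k)) | k u v.
            u \<in> hom (Shape X) k (idx_fst l) \<and> v \<in> hom (Shape X) k (idx_snd l)}" for l
  have def: "pro_copy C X = pro_arr C X ?T S"
    by (simp add: pro_copy_def S_def[abs_def])
  have S: "S (idx_pair (i, i')) = {(k, (ArrMap X u \<boxtimes> ArrMap X v) \<cdot> Copy C (ObjMap X k)) | k u v.
            u \<in> hom (Shape X) k i \<and> v \<in> hom (Shape X) k i'}" for i i'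
    by (simp add: S_def)
  note cls = pro_copy_class[OF markov_category_axioms X, folded S]
  have ne: "S l \<noteq> {}" if lT: "l \<in> Obj (Shape ?T)" for l
  proof -
    obtain i i' where l: "l = idx_pair (i, i')" and i: "i \<in> Obj (Shape X)" "i' \<in> Obj (Shape X)" using lT by auto
    then show ?thesis using pro_object_cofiltered(2)[OF X' i] unfolding l S by blast
  qed
  have car: "(k, f) \<in> colim_carrier C X (ObjMap ?T l)" if lT: "l \<in> Obj (Shape ?T)" and kf: "(k, f) \<in> S l" for l k f
  proof -
    obtain i i' where l: "l = idx_pair (i, i')" using lT by auto
    show ?thesis using kf cls(2) unfolding l S pro_tensor_simps by blast
  qed
  have rel: "(p, q) \<in> colim_rel C X (ObjMap ?T l)" if lT: "l \<in> Obj (Shape ?T)" and pq: "p \<in> S l" "q \<in> S l" for l p q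
  proof -
    obtain i i' where l: "l = idx_pair (i, i')" using lT by auto
    have "cls C X (ObjMap ?T l) p = colim_class C X (ObjMap ?T l) (S l)" if "p \<in> S l" for p
      using that cls(1) unfolding l S pro_tensor_simps by blast
    then show ?thesis using pq unfolding cls_eq[symmetric] by simp
  qed
  have cmp: "\<exists>p\<in>S l'. (p, (k, ArrMap ?T w \<cdot> f)) \<in> colim_rel C X (ObjMap ?T l')"
    if w: "w \<in> hom (Shape ?T) l l'" and f: "(k, f) \<in> S l" for l l' w k f
  proof -
    obtain s i j t i' j' where w: "w = idx_pair (s, t)" "l = idx_pair (i, i')" "l' = idx_pair (j, j')"
      and s: "s \<in> hom (Shape X) i j" and t: "t \<in> hom (Shape X) i' j'"
      using w by (auto simp: prod_shape_hom)
    obtain u v where u: "u \<in> hom (Shape X) k i" and v: "v \<in> hom (Shape X) k i'"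
      and f: "f = (ArrMap X u \<boxtimes> ArrMap X v) \<cdot> Copy C (ObjMap X k)"
      using f by (auto simp: w S)
    have "ArrMap ?T w \<cdot> f = (ArrMap X (s \<cdot>\<^bsub>Shape X\<^esub> u) \<boxtimes> ArrMap X (t \<cdot>\<^bsub>Shape X\<^esub> v)) \<cdot> Copy C (ObjMap X k)"
      using pro_object_arr[OF X' s] pro_object_arr[OF X' t] pro_object_arr[OF X' u] pro_object_arr[OF X' v]
      by (simp add: w f P(3) P(5)[OF s u] P(5)[OF t v])
    then have "(k, ArrMap ?T w \<cdot> f) \<in> S l'"
      using shape_ident_comp(2)[OF X' s u] shape_ident_comp(2)[OF X' t v] by (auto simp: w S)
    then show ?thesis by (rule bexI[rotated]) (rule colim_rel_refl)
  qed
  show "pro_copy C X \<in> hom (pro C) X ?T"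
    unfolding def by (rule pro_arr_represents(1)[OF X' T ne car rel cmp])
  show "represents C X ?T (pro_copy C X) (idx_pair (i, i')) k ((ArrMap X u \<boxtimes> ArrMap X v) \<cdot> Copy C (ObjMap X k))"
    if "u \<in> hom (Shape X) k i" "v \<in> hom (Shape X) k i'"
    unfolding def
    by (rule pro_arr_represents(2)[OF X' T ne car rel cmp]) (use that pro_object_arr[OF X'] in \<open>auto simp: S\<close>)
qed

lemma represents_copy_diagonal:
  fixes X :: "('i::infinite, 'o, 'a) diagram"
  assumes X: "X \<in> pro_objects (det C)" and i: "i \<in> Obj (Shape X)"
  shows "represents C X (pro_tensor C X X) (pro_copy C X) (idx_pair (i, i)) i (Copy C (ObjMap X i))"
proof -
  note X' = pro_objects_det[OF category_axioms X]
  show ?thesis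
    using represents_copy(2)[OF X shape_ident_comp(1)[OF X' i] shape_ident_comp(1)[OF X' i]] i X'
    by (simp add: pro_object_shape)
qed

text \<open>Restricted to a common index, two representatives are parallel arrows into the terminal object of \<open>C\<close>.\<close>

lemma into_pro_unit_eq:
  fixes X :: "('i, 'o, 'a) diagram"
  assumes h: "h \<in> hom (pro C) X (pro_unit C)" and h': "h' \<in> hom (pro C) X (pro_unit C)"
  shows "h = h'"
proof -
  have X: "X \<in> pro_objects C" using h by (auto simp: pro_homset)
  show ?thesis
  proof (rule pro_arrow_eqI[OF X pro_unit_object])
    fix j :: 'i assume j: "j \<in> Obj (Shape (pro_unit C))"
    obtain i f where f: "represents C X (pro_unit C) h j i f" using represents_exists[OF h j] .
    obtain i' f' where f': "represents C X (pro_unit C) h' j i' f'" using represents_exists[OF h' j] .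
    obtain k u v where u: "u \<in> hom (Shape X) k i" and v: "v \<in> hom (Shape X) k i'"
      using pro_object_cofiltered(2)[OF X representsD(7)[OF f] representsD(7)[OF f']] by blast
    have "f \<cdot> ArrMap X u = f' \<cdot> ArrMap X v"
      by (rule into_unit_eq)
        (use represents_arr[OF f] represents_arr[OF f'] pro_object_arr[OF X u] pro_object_arr[OF X v] in simp_all)
    then show "\<exists>i f g. represents C X (pro_unit C) h j i f \<and> represents C X (pro_unit C) h' j i g \<and> f = g"
      using represents_restrict[OF f u] represents_restrict[OF f' v] by blast
  qed
qed

lemma represents_del:
  fixes X :: "('i, 'o, 'a) diagram"
  assumes X: "X \<in> pro_objects C"
  shows "pro_del C X \<in> hom (pro C) X (pro_unit C)"
    "i \<in> Obj (Shape X) \<Longrightarrow> represents C X (pro_unit C) (pro_del C X) idx_star i (Del C (ObjMap X i))"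
proof -
  let ?S = "{(i, Del C (ObjMap X i)) |i. i \<in> Obj (Shape X)}"
  have car: "(i, Del C (ObjMap X i)) \<in> colim_carrier C X (Unit C)" if "i \<in> Obj (Shape X)" for i
    using that del_hom pro_object_shape(3)[OF X] by (simp add: colim_carrier_def)
  have rel: "((i, Del C (ObjMap X i)), (i', Del C (ObjMap X i'))) \<in> colim_rel C X (Unit C)"
    if i: "i \<in> Obj (Shape X)" "i' \<in> Obj (Shape X)" for i i'
  proof -
    obtain k u v where u: "u \<in> hom (Shape X) k i" and v: "v \<in> hom (Shape X) k i'"
      using pro_object_cofiltered(2)[OF X i] by blast
    have "Del C (ObjMap X i) \<cdot> ArrMap X u = Del C (ObjMap X i') \<cdot> ArrMap X v"
      by (rule into_unit_eq)
        (use pro_object_arr[OF X u] pro_object_arr[OF X v] i pro_object_shape(3)[OF X] in simp_all)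
    then show ?thesis
      using u v car[OF i(2)] by (auto simp: colim_rel_iff[OF X car[OF i(1)]] refines_def)
  qed
  have cmp: "\<exists>p\<in>?S. (p, (i, ArrMap (pro_unit C) v \<cdot> f)) \<in> colim_rel C X (Unit C)" if "(i, f) \<in> ?S" for v :: 'i and i f
  proof -
    have "i \<in> Obj (Shape X)" "f = Del C (ObjMap X i)" using that by auto
    then have "ArrMap (pro_unit C) v \<cdot> f = f" using pro_object_shape(3)[OF X] by simp
    then have "(i, ArrMap (pro_unit C) v \<cdot> f) \<in> ?S" using that by simp
    then show ?thesis by (rule bexI[rotated]) (rule colim_rel_refl)
  qed
  have rep: "pro_del C X \<in> hom (pro C) X (pro_unit C)"
    "\<And>i. i \<in> Obj (Shape X) \<Longrightarrow> represents C X (pro_unit C) (pro_del C X) idx_star i (Del C (ObjMap X i))"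
    unfolding pro_del_def
    by (rule pro_arr_represents[OF X pro_unit_object];
        use car rel cmp pro_object_cofiltered(1)[OF X] in \<open>fastforce simp: pro_unit_simps\<close>)+
  then show "pro_del C X \<in> hom (pro C) X (pro_unit C)"
    "i \<in> Obj (Shape X) \<Longrightarrow> represents C X (pro_unit C) (pro_del C X) idx_star i (Del C (ObjMap X i))"
    by auto
qed

end

section \<open>The Markov category of pro-deterministic objects\<close>

lemma prodet_simps:
  "Dom (prodet C) = Dom (pro C)" "Cod (prodet C) = Cod (pro C)"
  "Ident (prodet C) = Ident (pro C)" "Comp (prodet C) = Comp (pro C)"
  "TensorObj (prodet C) = pro_tensor C" "TensorArr (prodet C) = pro_tensor_arr C"
  "Unit (prodet C) = pro_unit C" "Assoc (prodet C) = pro_assoc C" "LUnit (prodet C) = pro_lunit C"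
  "RUnit (prodet C) = pro_runit C" "Swap (prodet C) = pro_swap C"
  "Copy (prodet C) = pro_copy C" "Del (prodet C) = pro_del C"
  by (simp_all add: prodet_def prodet_cat_def full_subcat_def)

lemma pro_arrow_component_eqI:
  assumes "represents C X Y h j i f" "represents C X Y h' j i g" "f = g"
  shows "\<exists>i f g. represents C X Y h j i f \<and> represents C X Y h' j i g \<and> f = g"
  using assms by blast

lemma cofiltered_three:
  assumes X: "X \<in> pro_objects C" and i: "i \<in> Obj (Shape X)" "i' \<in> Obj (Shape X)" "i'' \<in> Obj (Shape X)"
  obtains k u u' u'' where "u \<in> hom (Shape X) k i" "u' \<in> hom (Shape X) k i'" "u'' \<in> hom (Shape X) k i''"
proof -
  obtain m a b where m: "a \<in> hom (Shape X) m i" "b \<in> hom (Shape X) m i'"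
    using pro_object_cofiltered(2)[OF X i(1,2)] by blast
  obtain k e c where k: "e \<in> hom (Shape X) k m" "c \<in> hom (Shape X) k i''"
    using pro_object_cofiltered(2)[OF X pro_object_arr(4)[OF X m(1)] i(3)] by blast
  show ?thesis
    using that[OF shape_ident_comp(2)[OF X m(1) k(1)] shape_ident_comp(2)[OF X m(2) k(1)] k(2)] .
qed

context markov_category
begin

lemma prodet_obj [simp]: "Obj (prodet C) = pro_objects (det C)"
proof -
  have "X \<in> pro_objects (det C) \<longleftrightarrow> X \<in> pro_objects C \<and> is_functor (Shape X) (det C) (ObjMap X) (ArrMap X)"
    for X :: "('i, 'o, 'a) diagram"
    using pro_objects_det[OF category_axioms, of X] by (auto simp: pro_objects_def)
  then show ?thesis by (auto simp: prodet_def prodet_cat_def full_subcat_def pro_def)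
qed

lemma prodet_hom:
  "f \<in> hom (prodet C) X Y \<longleftrightarrow> X \<in> pro_objects (det C) \<and> Y \<in> pro_objects (det C) \<and> f \<in> hom (pro C) X Y"
proof -
  have "X \<in> pro_objects (det C) \<longleftrightarrow> X \<in> pro_objects C \<and> is_functor (Shape X) (det C) (ObjMap X) (ArrMap X)"
    for X :: "('i, 'o, 'a) diagram"
    using pro_objects_det[OF category_axioms, of X] by (auto simp: pro_objects_def)
  then show ?thesis
    by (auto simp: prodet_def prodet_cat_def full_subcat_def pro_def hom_def)
qed

lemma prodet_object_pro [simp]: "X \<in> pro_objects (det C) \<Longrightarrow> X \<in> pro_objects C"
  by (rule pro_objects_det[OF category_axioms])

lemma pro_objects_detI:
  assumes X: "X \<in> pro_objects C"
    and det: "\<And>i j u. u \<in> hom (Shape X) i j \<Longrightarrow> deterministic C (ArrMap X u)"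
  shows "X \<in> pro_objects (det C)"
proof -
  have "ArrMap X u \<in> hom (det C) (ObjMap X (Dom (Shape X) u)) (ObjMap X (Cod (Shape X) u))"
    if u: "u \<in> Arr (Shape X)" for u
  proof -
    have "u \<in> hom (Shape X) (Dom (Shape X) u) (Cod (Shape X) u)" using u by (simp add: hom_def)
    from det[OF this] pro_object_arr[OF X this] show ?thesis by (simp add: hom_def det_def)
  qed
  then show ?thesis
    using X category_det[OF markov_category_axioms]
    unfolding pro_objects_def is_functor_def det_simps mem_Collect_eq by (elim conjE) (intro conjI ballI; simp)
qed

lemma prodet_object_deterministic:
  assumes "X \<in> pro_objects (det C)" "u \<in> hom (Shape X) i j"
  shows "deterministic C (ArrMap X u)"
  using pro_object_shape(4)[OF assms] by (simp add: hom_def det_def)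

lemma pro_unit_det [simp]: "pro_unit C \<in> pro_objects (det C)"
  using const_object[OF category_det[OF markov_category_axioms], of "Unit C"] by (simp add: pro_unit_def)

lemma pro_tensor_det [simp]:
  fixes X Y :: "('i::infinite, 'o, 'a) diagram"
  assumes X: "X \<in> pro_objects (det C)" and Y: "Y \<in> pro_objects (det C)"
  shows "pro_tensor C X Y \<in> pro_objects (det C)"
proof (rule pro_objects_detI)
  show "pro_tensor C X Y \<in> pro_objects C" using X Y by simp
  fix w l m assume "w \<in> hom (Shape (pro_tensor C X Y)) l m"
  then obtain u v i j i' j' where w: "w = idx_pair (u, v)" and u: "u \<in> hom (Shape X) i i'" and v: "v \<in> hom (Shape Y) j j'"
    by (auto simp: prod_shape_hom)
  show "deterministic C (ArrMap (pro_tensor C X Y) w)"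
    unfolding w pro_tensor_simps
    by (rule deterministic_tensor)
      (use pro_object_arr[OF prodet_object_pro[OF X] u] pro_object_arr[OF prodet_object_pro[OF Y] v]
        prodet_object_deterministic[OF X u] prodet_object_deterministic[OF Y v] in simp_all)
qed

lemma category_prodet: "category (prodet C)"
proof
  fix f :: "('i, 'o, 'a) pro_arrow" assume "f \<in> Arr (prodet C)"
  then have "f \<in> hom (prodet C) (Dom (prodet C) f) (Cod (prodet C) f)" by (simp add: hom_def)
  then show "Dom (prodet C) f \<in> Obj (prodet C)" "Cod (prodet C) f \<in> Obj (prodet C)" by (auto simp: prodet_hom)
next
  show "\<And>x. x \<in> Obj (prodet C) \<Longrightarrow> Ident (prodet C) x \<in> hom (prodet C) x x"
    by (simp add: prodet_hom prodet_simps represents_ident(1))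
  fix f g h :: "('i, 'o, 'a) pro_arrow" and w x y z :: "('i, 'o, 'a) diagram"
  show "\<lbrakk>f \<in> hom (prodet C) x y; g \<in> hom (prodet C) y z\<rbrakk> \<Longrightarrow> g \<cdot>\<^bsub>prodet C\<^esub> f \<in> hom (prodet C) x z"
    by (auto simp: prodet_hom prodet_simps intro: category.comp_hom[OF category_pro])
  show "f \<in> hom (prodet C) x y \<Longrightarrow> Ident (prodet C) y \<cdot>\<^bsub>prodet C\<^esub> f = f"
    by (auto simp: prodet_hom prodet_simps intro: category.comp_ident_left[OF category_pro])
  show "f \<in> hom (prodet C) x y \<Longrightarrow> f \<cdot>\<^bsub>prodet C\<^esub> Ident (prodet C) x = f"
    by (auto simp: prodet_hom prodet_simps intro: category.comp_ident_right[OF category_pro])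
  show "\<lbrakk>f \<in> hom (prodet C) w x; g \<in> hom (prodet C) x y; h \<in> hom (prodet C) y z\<rbrakk>
      \<Longrightarrow> (h \<cdot>\<^bsub>prodet C\<^esub> g) \<cdot>\<^bsub>prodet C\<^esub> f = h \<cdot>\<^bsub>prodet C\<^esub> g \<cdot>\<^bsub>prodet C\<^esub> f"
    by (auto simp: prodet_hom prodet_simps intro: category.comp_assoc[OF category_pro])
qed

text \<open>\<open>ProDet(C)\<close> is full in \<open>Pro(C)\<close>, so inverses taken in \<open>Pro(C)\<close> serve in \<open>ProDet(C)\<close>.\<close>

lemma prodet_inverse_arrows:
  assumes "inverse_arrows (pro C) f g" "f \<in> hom (prodet C) X Y"
  shows "inverse_arrows (prodet C) f g"
proof -
  have f: "X \<in> pro_objects (det C)" "Y \<in> pro_objects (det C)" "f \<in> hom (pro C) X Y"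
    using assms(2) by (auto simp: prodet_hom)
  then have "g \<in> hom (pro C) Y X" using assms(1) by (auto simp: inverse_arrows_def hom_def)
  then have "g \<in> hom (prodet C) Y X" using f by (simp add: prodet_hom)
  then show ?thesis
    using assms by (auto simp: inverse_arrows_def hom_def prodet_simps)
qed

lemma tensor_arr_hom:
  fixes X Y X' Y' :: "('i::infinite, 'o, 'a) diagram"
  assumes h: "h \<in> hom (pro C) X Y" and h': "h' \<in> hom (pro C) X' Y'"
  shows "pro_tensor_arr C h h' \<in> hom (pro C) (pro_tensor C X X') (pro_tensor C Y Y')"
proof -
  have "Y \<in> pro_objects C" "Y' \<in> pro_objects C" using h h' by (auto simp: pro_homset)
  then obtain j j' where j: "j \<in> Obj (Shape Y)" "j' \<in> Obj (Shape Y')" using pro_object_cofiltered(1) by blast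
  obtain i f where f: "represents C X Y h j i f" using represents_exists[OF h j(1)] .
  obtain i' f' where f': "represents C X' Y' h' j' i' f'" using represents_exists[OF h' j(2)] .
  show ?thesis by (rule representsD(1)[OF represents_tensor[OF f f']])
qed

text \<open>Each equation is checked at one index of the target.  Both sides have representatives at the same
  index of the source, and equating them is the corresponding axiom of \<open>C\<close>.  The chains of representation
  rules below follow the composites on the two sides.\<close>

lemma monoidal_category_prodet: "monoidal_category (prodet C :: (('i::infinite, 'o, 'a) diagram, ('i, 'o, 'a) pro_arrow) markov)"
proof (intro monoidal_category.intro category_prodet monoidal_category_axioms.intro, unfold prodet_simps prodet_obj prodet_hom)
  note co = represents_comp and te = represents_tensor and id = represents_ident(2) and as = represents_assoc(3)
  fix a b c d :: "('i, 'o, 'a) diagram"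
  {
    fix f g assume "a \<in> pro_objects (det C) \<and> b \<in> pro_objects (det C) \<and> f \<in> hom (pro C) a b"
      "c \<in> pro_objects (det C) \<and> d \<in> pro_objects (det C) \<and> g \<in> hom (pro C) c d"
    then show "pro_tensor C a c \<in> pro_objects (det C) \<and> pro_tensor C b d \<in> pro_objects (det C) \<and>
      pro_tensor_arr C f g \<in> hom (pro C) (pro_tensor C a c) (pro_tensor C b d)"
      by (simp add: tensor_arr_hom)
  next
    fix f g f' g' and a' b' c' :: "('i, 'o, 'a) diagram"
    assume f: "a \<in> pro_objects (det C) \<and> b \<in> pro_objects (det C) \<and> f \<in> hom (pro C) a b"
      and g: "b \<in> pro_objects (det C) \<and> c \<in> pro_objects (det C) \<and> g \<in> hom (pro C) b c"
      and f': "a' \<in> pro_objects (det C) \<and> b' \<in> pro_objects (det C) \<and> f' \<in> hom (pro C) a' b'"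
      and g': "b' \<in> pro_objects (det C) \<and> c' \<in> pro_objects (det C) \<and> g' \<in> hom (pro C) b' c'"
    show "pro_tensor_arr C (g \<cdot>\<^bsub>pro C\<^esub> f) (g' \<cdot>\<^bsub>pro C\<^esub> f') = pro_tensor_arr C g g' \<cdot>\<^bsub>pro C\<^esub> pro_tensor_arr C f f'"
    proof (rule pro_arrow_eqI)
      show "pro_tensor C a a' \<in> pro_objects C" "pro_tensor C c c' \<in> pro_objects C" using f g f' g' by simp_all
      fix l assume "l \<in> Obj (Shape (pro_tensor C c c'))"
      then obtain k k' where l: "l = idx_pair (k, k')" and k: "k \<in> Obj (Shape c)" "k' \<in> Obj (Shape c')" by auto
      obtain j G where G: "represents C b c g k j G" using represents_exists[OF _ k(1)] g by metis
      obtain i F where F: "represents C a b f j i F" using represents_exists[OF _ representsD(7)[OF G]] f by metis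
      obtain j' G' where G': "represents C b' c' g' k' j' G'" using represents_exists[OF _ k(2)] g' by metis
      obtain i' F' where F': "represents C a' b' f' j' i' F'" using represents_exists[OF _ representsD(7)[OF G']] f' by metis
      show "\<exists>i u v. represents C (pro_tensor C a a') (pro_tensor C c c') (pro_tensor_arr C (g \<cdot>\<^bsub>pro C\<^esub> f) (g' \<cdot>\<^bsub>pro C\<^esub> f')) l i u \<and>
         represents C (pro_tensor C a a') (pro_tensor C c c') (pro_tensor_arr C g g' \<cdot>\<^bsub>pro C\<^esub> pro_tensor_arr C f f') l i v \<and> u = v"
        unfolding l
        by (rule pro_arrow_component_eqI[OF te[OF co[OF G F] co[OF G' F']] co[OF te[OF G G'] te[OF F F']]])
          (rule tensor_comp[OF representsD(8)[OF F] representsD(8)[OF G] representsD(8)[OF F'] representsD(8)[OF G']])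
    qed
  next
    fix f g h and a' b' c' :: "('i, 'o, 'a) diagram"
    assume f: "a \<in> pro_objects (det C) \<and> a' \<in> pro_objects (det C) \<and> f \<in> hom (pro C) a a'"
      and g: "b \<in> pro_objects (det C) \<and> b' \<in> pro_objects (det C) \<and> g \<in> hom (pro C) b b'"
      and h: "c \<in> pro_objects (det C) \<and> c' \<in> pro_objects (det C) \<and> h \<in> hom (pro C) c c'"
    then have O: "a \<in> pro_objects C" "b \<in> pro_objects C" "c \<in> pro_objects C"
      "a' \<in> pro_objects C" "b' \<in> pro_objects C" "c' \<in> pro_objects C" by auto
    show "pro_assoc C a' b' c' \<cdot>\<^bsub>pro C\<^esub> pro_tensor_arr C (pro_tensor_arr C f g) h =
       pro_tensor_arr C f (pro_tensor_arr C g h) \<cdot>\<^bsub>pro C\<^esub> pro_assoc C a b c"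
    proof (rule pro_arrow_eqI)
      show "pro_tensor C (pro_tensor C a b) c \<in> pro_objects C" "pro_tensor C a' (pro_tensor C b' c') \<in> pro_objects C"
        using O by simp_all
      fix l assume "l \<in> Obj (Shape (pro_tensor C a' (pro_tensor C b' c')))"
      then obtain i j k where l: "l = idx_pair (i, idx_pair (j, k))"
        and i: "i \<in> Obj (Shape a')" "j \<in> Obj (Shape b')" "k \<in> Obj (Shape c')" by auto
      obtain p F where F: "represents C a a' f i p F" using represents_exists[OF _ i(1)] f by metis
      obtain q G where G: "represents C b b' g j q G" using represents_exists[OF _ i(2)] g by metis
      obtain r H where H: "represents C c c' h k r H" using represents_exists[OF _ i(3)] h by metis
      show "\<exists>i u v. represents C (pro_tensor C (pro_tensor C a b) c) (pro_tensor C a' (pro_tensor C b' c'))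
          (pro_assoc C a' b' c' \<cdot>\<^bsub>pro C\<^esub> pro_tensor_arr C (pro_tensor_arr C f g) h) l i u \<and>
         represents C (pro_tensor C (pro_tensor C a b) c) (pro_tensor C a' (pro_tensor C b' c'))
          (pro_tensor_arr C f (pro_tensor_arr C g h) \<cdot>\<^bsub>pro C\<^esub> pro_assoc C a b c) l i v \<and> u = v"
        unfolding l
        by (rule pro_arrow_component_eqI[OF co[OF as[OF O(4-6) i] te[OF te[OF F G] H]]
              co[OF te[OF F te[OF G H]] as[OF O(1-3) representsD(7)[OF F] representsD(7)[OF G] representsD(7)[OF H]]]])
          (rule assoc_natural[OF representsD(8)[OF F] representsD(8)[OF G] representsD(8)[OF H]])
    qed
  next
    fix f assume f: "a \<in> pro_objects (det C) \<and> b \<in> pro_objects (det C) \<and> f \<in> hom (pro C) a b"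
    then have O: "a \<in> pro_objects C" "b \<in> pro_objects C" by auto
    show "pro_lunit C b \<cdot>\<^bsub>pro C\<^esub> pro_tensor_arr C (Ident (pro C) (pro_unit C)) f = f \<cdot>\<^bsub>pro C\<^esub> pro_lunit C a"
    proof (rule pro_arrow_eqI)
      show "pro_tensor C (pro_unit C) a \<in> pro_objects C" "b \<in> pro_objects C" using O by simp_all
      fix j assume j: "j \<in> Obj (Shape b)"
      obtain i F where F: "represents C a b f j i F" using represents_exists[OF _ j] f by metis
      have s: "idx_star \<in> Obj (Shape (pro_unit C))" by simp
      show "\<exists>i u v. represents C (pro_tensor C (pro_unit C) a) b
          (pro_lunit C b \<cdot>\<^bsub>pro C\<^esub> pro_tensor_arr C (Ident (pro C) (pro_unit C)) f) j i u \<and>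
         represents C (pro_tensor C (pro_unit C) a) b (f \<cdot>\<^bsub>pro C\<^esub> pro_lunit C a) j i v \<and> u = v"
        by (rule pro_arrow_component_eqI[OF co[OF represents_lunit(2)[OF O(2) j] te[OF id[OF pro_unit_object s] F]]
              co[OF F represents_lunit(2)[OF O(1) representsD(7)[OF F]]]])
          (use lunit_natural[OF representsD(8)[OF F]] in simp)
    qed
    show "pro_runit C b \<cdot>\<^bsub>pro C\<^esub> pro_tensor_arr C f (Ident (pro C) (pro_unit C)) = f \<cdot>\<^bsub>pro C\<^esub> pro_runit C a"
    proof (rule pro_arrow_eqI)
      show "pro_tensor C a (pro_unit C) \<in> pro_objects C" "b \<in> pro_objects C" using O by simp_all
      fix j assume j: "j \<in> Obj (Shape b)"
      obtain i F where F: "represents C a b f j i F" using represents_exists[OF _ j] f by metis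
      have s: "idx_star \<in> Obj (Shape (pro_unit C))" by simp
      show "\<exists>i u v. represents C (pro_tensor C a (pro_unit C)) b
          (pro_runit C b \<cdot>\<^bsub>pro C\<^esub> pro_tensor_arr C f (Ident (pro C) (pro_unit C))) j i u \<and>
         represents C (pro_tensor C a (pro_unit C)) b (f \<cdot>\<^bsub>pro C\<^esub> pro_runit C a) j i v \<and> u = v"
        by (rule pro_arrow_component_eqI[OF co[OF represents_runit(2)[OF O(2) j] te[OF F id[OF pro_unit_object s]]]
              co[OF F represents_runit(2)[OF O(1) representsD(7)[OF F]]]])
          (use runit_natural[OF representsD(8)[OF F]] in simp)
    qed
  }
  show "pro_unit C \<in> pro_objects (det C)" by simp
  assume a: "a \<in> pro_objects (det C)"
  show lh: "pro_tensor C (pro_unit C) a \<in> pro_objects (det C) \<and> a \<in> pro_objects (det C) \<and>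
     pro_lunit C a \<in> hom (pro C) (pro_tensor C (pro_unit C) a) a"
    using a represents_lunit(3)[OF prodet_object_pro[OF a]] by simp
  show "iso_arr (prodet C) (pro_lunit C a)"
  proof -
    obtain h where "inverse_arrows (pro C) (pro_lunit C a) h" using represents_lunit(1)[OF prodet_object_pro[OF a]] by blast
    then show ?thesis unfolding iso_arr_def using prodet_inverse_arrows[unfolded prodet_hom, OF _ lh] by blast
  qed
  show rh: "pro_tensor C a (pro_unit C) \<in> pro_objects (det C) \<and> a \<in> pro_objects (det C) \<and>
     pro_runit C a \<in> hom (pro C) (pro_tensor C a (pro_unit C)) a"
    using a represents_runit(3)[OF prodet_object_pro[OF a]] by simp
  show "iso_arr (prodet C) (pro_runit C a)"
  proof -
    obtain h where "inverse_arrows (pro C) (pro_runit C a) h" using represents_runit(1)[OF prodet_object_pro[OF a]] by blast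
    then show ?thesis unfolding iso_arr_def using prodet_inverse_arrows[unfolded prodet_hom, OF _ rh] by blast
  qed
  assume b: "b \<in> pro_objects (det C)"
  note O = prodet_object_pro[OF a] prodet_object_pro[OF b]
  show "pro_tensor C a b \<in> pro_objects (det C)" using a b by simp
  show "pro_tensor_arr C (Ident (pro C) a) (Ident (pro C) b) = Ident (pro C) (pro_tensor C a b)"
  proof (rule pro_arrow_eqI)
    show T: "pro_tensor C a b \<in> pro_objects C" "pro_tensor C a b \<in> pro_objects C" using a b by simp_all
    fix l assume lT: "l \<in> Obj (Shape (pro_tensor C a b))"
    then obtain i j where l: "l = idx_pair (i, j)" and i: "i \<in> Obj (Shape a)" "j \<in> Obj (Shape b)" by auto
    show "\<exists>i u v. represents C (pro_tensor C a b) (pro_tensor C a b) (pro_tensor_arr C (Ident (pro C) a) (Ident (pro C) b)) l i u \<and>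
      represents C (pro_tensor C a b) (pro_tensor C a b) (Ident (pro C) (pro_tensor C a b)) l i v \<and> u = v"
      using lT unfolding l
      by (intro pro_arrow_component_eqI[OF te[OF id[OF O(1) i(1)] id[OF O(2) i(2)]] id[OF T(1)]])
        (use i O in \<open>simp_all add: pro_object_shape\<close>)
  qed
  show "pro_tensor_arr C (Ident (pro C) a) (pro_lunit C b) \<cdot>\<^bsub>pro C\<^esub> pro_assoc C a (pro_unit C) b =
      pro_tensor_arr C (pro_runit C a) (Ident (pro C) b)"
  proof (rule pro_arrow_eqI)
    show "pro_tensor C (pro_tensor C a (pro_unit C)) b \<in> pro_objects C" "pro_tensor C a b \<in> pro_objects C" using O by simp_all
    fix l assume "l \<in> Obj (Shape (pro_tensor C a b))"
    then obtain i j where l: "l = idx_pair (i, j)" and i: "i \<in> Obj (Shape a)" "j \<in> Obj (Shape b)" by auto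
    have s: "idx_star \<in> Obj (Shape (pro_unit C))" by simp
    show "\<exists>i u v. represents C (pro_tensor C (pro_tensor C a (pro_unit C)) b) (pro_tensor C a b)
        (pro_tensor_arr C (Ident (pro C) a) (pro_lunit C b) \<cdot>\<^bsub>pro C\<^esub> pro_assoc C a (pro_unit C) b) l i u \<and>
      represents C (pro_tensor C (pro_tensor C a (pro_unit C)) b) (pro_tensor C a b)
        (pro_tensor_arr C (pro_runit C a) (Ident (pro C) b)) l i v \<and> u = v"
      unfolding l
      by (rule pro_arrow_component_eqI[OF
            co[OF te[OF id[OF O(1) i(1)] represents_lunit(2)[OF O(2) i(2)]] as[OF O(1) pro_unit_object O(2) i(1) s i(2)]]
            te[OF represents_runit(2)[OF O(1) i(1)] id[OF O(2) i(2)]]])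
        (use i O in \<open>simp add: pro_object_shape triangle\<close>)
  qed
  assume c: "c \<in> pro_objects (det C)"
  note O = O prodet_object_pro[OF c]
  show ah: "pro_tensor C (pro_tensor C a b) c \<in> pro_objects (det C) \<and> pro_tensor C a (pro_tensor C b c) \<in> pro_objects (det C) \<and>
    pro_assoc C a b c \<in> hom (pro C) (pro_tensor C (pro_tensor C a b) c) (pro_tensor C a (pro_tensor C b c))"
    using a b c represents_assoc(1)[OF O] by simp
  show "iso_arr (prodet C) (pro_assoc C a b c)"
  proof -
    obtain h where "inverse_arrows (pro C) (pro_assoc C a b c) h" using represents_assoc(2)[OF O] by blast
    then show ?thesis unfolding iso_arr_def using prodet_inverse_arrows[unfolded prodet_hom, OF _ ah] by blast
  qed
  assume d: "d \<in> pro_objects (det C)"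
  note O = O prodet_object_pro[OF d]
  show "pro_assoc C a b (pro_tensor C c d) \<cdot>\<^bsub>pro C\<^esub> pro_assoc C (pro_tensor C a b) c d =
    pro_tensor_arr C (Ident (pro C) a) (pro_assoc C b c d) \<cdot>\<^bsub>pro C\<^esub> pro_assoc C a (pro_tensor C b c) d \<cdot>\<^bsub>pro C\<^esub>
      pro_tensor_arr C (pro_assoc C a b c) (Ident (pro C) d)" (is "?L = ?R")
  proof (rule pro_arrow_eqI)
    let ?S = "pro_tensor C (pro_tensor C (pro_tensor C a b) c) d" and ?T = "pro_tensor C a (pro_tensor C b (pro_tensor C c d))"
    show "?S \<in> pro_objects C" "?T \<in> pro_objects C" using O by simp_all
    fix l assume "l \<in> Obj (Shape ?T)"
    then obtain i j k m where l: "l = idx_pair (i, idx_pair (j, idx_pair (k, m)))"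
      and i: "i \<in> Obj (Shape a)" "j \<in> Obj (Shape b)" "k \<in> Obj (Shape c)" "m \<in> Obj (Shape d)" by auto
    have T: "pro_tensor C a b \<in> pro_objects C" "pro_tensor C b c \<in> pro_objects C" "pro_tensor C c d \<in> pro_objects C"
      using O by simp_all
    have ij: "idx_pair (i, j) \<in> Obj (Shape (pro_tensor C a b))" "idx_pair (j, k) \<in> Obj (Shape (pro_tensor C b c))"
      "idx_pair (k, m) \<in> Obj (Shape (pro_tensor C c d))" using i by simp_all
    show "\<exists>i u v. represents C ?S ?T ?L l i u \<and> represents C ?S ?T ?R l i v \<and> u = v"
      unfolding l
      by (rule pro_arrow_component_eqI[OF
            co[OF as[OF O(1,2) T(3) i(1,2) ij(3)] as[OF T(1) O(3,4) ij(1) i(3,4)]]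
            co[OF te[OF id[OF O(1) i(1)] as[OF O(2,3,4) i(2,3,4)]]
              co[OF as[OF O(1) T(2) O(4) i(1) ij(2) i(4)] te[OF as[OF O(1,2,3) i(1,2,3)] id[OF O(4) i(4)]]]]])
        (use i O in \<open>simp add: pro_object_shape pentagon\<close>)
  qed
qed

end

context markov_category
begin

lemma symmetric_monoidal_category_prodet:
  "symmetric_monoidal_category (prodet C :: (('i::infinite, 'o, 'a) diagram, ('i, 'o, 'a) pro_arrow) markov)"
proof (intro symmetric_monoidal_category.intro monoidal_category_prodet symmetric_monoidal_category_axioms.intro,
    unfold prodet_simps prodet_obj prodet_hom)
  note co = represents_comp and te = represents_tensor and id = represents_ident(2) and as = represents_assoc(3)
    and sw = represents_swap(2)
  fix a b c :: "('i, 'o, 'a) diagram"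
  {
    fix f g and a' b' :: "('i, 'o, 'a) diagram"
    assume f: "a \<in> pro_objects (det C) \<and> a' \<in> pro_objects (det C) \<and> f \<in> hom (pro C) a a'"
      and g: "b \<in> pro_objects (det C) \<and> b' \<in> pro_objects (det C) \<and> g \<in> hom (pro C) b b'"
    then have O: "a \<in> pro_objects C" "b \<in> pro_objects C" "a' \<in> pro_objects C" "b' \<in> pro_objects C" by auto
    show "pro_swap C a' b' \<cdot>\<^bsub>pro C\<^esub> pro_tensor_arr C f g = pro_tensor_arr C g f \<cdot>\<^bsub>pro C\<^esub> pro_swap C a b" (is "?L = ?R")
    proof (rule pro_arrow_eqI)
      let ?S = "pro_tensor C a b" and ?T = "pro_tensor C b' a'"
      show "?S \<in> pro_objects C" "?T \<in> pro_objects C" using O by simp_all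
      fix l assume "l \<in> Obj (Shape ?T)"
      then obtain i j where l: "l = idx_pair (j, i)" and i: "i \<in> Obj (Shape a')" "j \<in> Obj (Shape b')" by auto
      obtain p F where F: "represents C a a' f i p F" using represents_exists[OF _ i(1)] f by metis
      obtain q G where G: "represents C b b' g j q G" using represents_exists[OF _ i(2)] g by metis
      show "\<exists>i u v. represents C ?S ?T ?L l i u \<and> represents C ?S ?T ?R l i v \<and> u = v"
        unfolding l
        by (rule pro_arrow_component_eqI[OF co[OF sw[OF O(3,4) i] te[OF F G]]
              co[OF te[OF G F] sw[OF O(1,2) representsD(7)[OF F] representsD(7)[OF G]]]])
          (rule swap_natural[OF representsD(8)[OF F] representsD(8)[OF G]])
    qed
  }
  assume a: "a \<in> pro_objects (det C)" and b: "b \<in> pro_objects (det C)"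
  note O = prodet_object_pro[OF a] prodet_object_pro[OF b]
  show "pro_tensor C a b \<in> pro_objects (det C) \<and> pro_tensor C b a \<in> pro_objects (det C) \<and>
    pro_swap C a b \<in> hom (pro C) (pro_tensor C a b) (pro_tensor C b a)"
    using a b represents_swap(1)[OF O] by simp
  show "pro_swap C b a \<cdot>\<^bsub>pro C\<^esub> pro_swap C a b = Ident (pro C) (pro_tensor C a b)" (is "?L = ?R")
  proof (rule pro_arrow_eqI)
    let ?S = "pro_tensor C a b"
    show S: "?S \<in> pro_objects C" "?S \<in> pro_objects C" using O by simp_all
    fix l assume lS: "l \<in> Obj (Shape ?S)"
    then obtain i j where l: "l = idx_pair (i, j)" and i: "i \<in> Obj (Shape a)" "j \<in> Obj (Shape b)" by auto
    show "\<exists>i u v. represents C ?S ?S ?L l i u \<and> represents C ?S ?S ?R l i v \<and> u = v"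
      unfolding l
      by (rule pro_arrow_component_eqI[OF co[OF sw[OF O(2,1) i(2,1)] sw[OF O i]] id[OF S(1) lS[unfolded l]]])
        (use i O in \<open>simp add: pro_object_shape swap_swap\<close>)
  qed
  assume c: "c \<in> pro_objects (det C)"
  note O = O prodet_object_pro[OF c]
  show "pro_assoc C b c a \<cdot>\<^bsub>pro C\<^esub> pro_swap C a (pro_tensor C b c) \<cdot>\<^bsub>pro C\<^esub> pro_assoc C a b c =
    pro_tensor_arr C (Ident (pro C) b) (pro_swap C a c) \<cdot>\<^bsub>pro C\<^esub> pro_assoc C b a c \<cdot>\<^bsub>pro C\<^esub>
      pro_tensor_arr C (pro_swap C a b) (Ident (pro C) c)" (is "?L = ?R")
  proof (rule pro_arrow_eqI)
    let ?S = "pro_tensor C (pro_tensor C a b) c" and ?T = "pro_tensor C b (pro_tensor C c a)"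
    show "?S \<in> pro_objects C" "?T \<in> pro_objects C" using O by simp_all
    fix l assume "l \<in> Obj (Shape ?T)"
    then obtain i j k where l: "l = idx_pair (j, idx_pair (k, i))"
      and i: "i \<in> Obj (Shape a)" "j \<in> Obj (Shape b)" "k \<in> Obj (Shape c)" by auto
    have T: "pro_tensor C b c \<in> pro_objects C" using O by simp
    have jk: "idx_pair (j, k) \<in> Obj (Shape (pro_tensor C b c))" using i by simp
    show "\<exists>i u v. represents C ?S ?T ?L l i u \<and> represents C ?S ?T ?R l i v \<and> u = v"
      unfolding l
      by (rule pro_arrow_component_eqI[OF
            co[OF as[OF O(2,3,1) i(2,3,1)] co[OF sw[OF O(1) T i(1) jk] as[OF O i]]]
            co[OF te[OF id[OF O(2) i(2)] sw[OF O(1,3) i(1,3)]]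
              co[OF as[OF O(2,1,3) i(2,1,3)] te[OF sw[OF O(1,2) i(1,2)] id[OF O(3) i(3)]]]]])
        (use i O in \<open>simp add: pro_object_shape hexagon\<close>)
  qed
qed

text \<open>In \<open>ProDet(C)\<close> the inverse of an associator is its unique inverse arrow, hence the levelwise one.
  Therefore \<open>interchange\<close> is levelwise too.\<close>

lemma represents_interchange:
  fixes X X' Y Y' :: "('i::infinite, 'o, 'a) diagram"
  assumes X: "X \<in> pro_objects (det C)" "X' \<in> pro_objects (det C)" "Y \<in> pro_objects (det C)" "Y' \<in> pro_objects (det C)"
    and i: "i \<in> Obj (Shape X)" "i' \<in> Obj (Shape X')" "j \<in> Obj (Shape Y)" "j' \<in> Obj (Shape Y')"
  shows "represents C (pro_tensor C (pro_tensor C X X') (pro_tensor C Y Y'))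
      (pro_tensor C (pro_tensor C X Y) (pro_tensor C X' Y')) (interchange (prodet C) X X' Y Y')
      (idx_pair (idx_pair (i, j), idx_pair (i', j'))) (idx_pair (idx_pair (i, i'), idx_pair (j, j')))
      (interchange C (ObjMap X i) (ObjMap X' i') (ObjMap Y j) (ObjMap Y' j'))"
proof -
  have inv: "represents C (pro_tensor C U (pro_tensor C V W)) (pro_tensor C (pro_tensor C U V) W)
      (inverse_arr (prodet C) (pro_assoc C U V W))
      (idx_pair (idx_pair (p, q), r)) (idx_pair (p, idx_pair (q, r))) (inverse_arr C (Assoc C (ObjMap U p) (ObjMap V q) (ObjMap W r)))"
    if U: "U \<in> pro_objects (det C)" "V \<in> pro_objects (det C)" "W \<in> pro_objects (det C)"
     and p: "p \<in> Obj (Shape U)" "q \<in> Obj (Shape V)" "r \<in> Obj (Shape W)" for U V W :: "('i, 'o, 'a) diagram" and p q r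
  proof -
    note O = U[THEN prodet_object_pro]
    obtain h where h: "inverse_arrows (pro C) (pro_assoc C U V W) h"
      "represents C (pro_tensor C U (pro_tensor C V W)) (pro_tensor C (pro_tensor C U V) W) h
        (idx_pair (idx_pair (p, q), r)) (idx_pair (p, idx_pair (q, r))) (inverse_arr C (Assoc C (ObjMap U p) (ObjMap V q) (ObjMap W r)))"
      using represents_assoc(2)[OF O] p by blast
    have "pro_assoc C U V W \<in> hom (prodet C) (pro_tensor C (pro_tensor C U V) W) (pro_tensor C U (pro_tensor C V W))"
      using represents_assoc(1)[OF O] U by (simp add: prodet_hom)
    then have "inverse_arr (prodet C) (pro_assoc C U V W) = h"
      by (rule category.inverse_arr_eq[OF category_prodet prodet_inverse_arrows[OF h(1)]])
    then show ?thesis using h(2) by simp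
  qed
  note O = X[THEN prodet_object_pro]
  note co = represents_comp and te = represents_tensor and id = represents_ident(2) and as = represents_assoc(3)
    and sw = represents_swap(2)
  have T: "pro_tensor C X' Y' \<in> pro_objects (det C)" "pro_tensor C Y Y' \<in> pro_objects C" using X by simp_all
  have I: "idx_pair (i', j') \<in> Obj (Shape (pro_tensor C X' Y'))" "idx_pair (j, j') \<in> Obj (Shape (pro_tensor C Y Y'))"
    using i by simp_all
  show ?thesis
    unfolding interchange_def prodet_simps
    using co[OF inv[OF X(1,3) T(1) i(1,3) I(1)]
        co[OF te[OF id[OF O(1) i(1)] co[OF as[OF O(3,2,4) i(3,2,4)] co[OF te[OF sw[OF O(2,3) i(2,3)] id[OF O(4) i(4)]] inv[OF X(2,3,4) i(2,3,4)]]]]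
          as[OF O(1,2) T(2) i(1,2) I(2)]]]
    by simp
qed

text \<open>Coassociativity of the copy map of \<open>X\<close> at \<open>(i, (i', i''))\<close>, computed at an index \<open>k\<close> over \<open>i\<close>, \<open>i'\<close> and \<open>i''\<close>:
  \<open>u\<close>, \<open>u'\<close>, \<open>u''\<close> are the transition arrows out of \<open>x = X\<^sub>k\<close>, and naturality of the associator reduces it to
  coassociativity for \<open>x\<close>.\<close>

lemma copy_coassoc_restricted:
  assumes "u \<in> Arr C" "u' \<in> Arr C" "u'' \<in> Arr C" "Dom C u = x" "Dom C u' = x" "Dom C u'' = x"
  shows "Assoc C (Cod C u) (Cod C u') (Cod C u'') \<cdot> (((u \<boxtimes> u') \<cdot> Copy C x) \<boxtimes> u'') \<cdot> Copy C x =
    (u \<boxtimes> ((u' \<boxtimes> u'') \<cdot> Copy C x)) \<cdot> Copy C x"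
proof -
  have x: "x \<in> Obj C" using assms dom_obj by blast
  have "Assoc C (Cod C u) (Cod C u') (Cod C u'') \<cdot> (((u \<boxtimes> u') \<cdot> Copy C x) \<boxtimes> u'') \<cdot> Copy C x =
     Assoc C (Cod C u) (Cod C u') (Cod C u'') \<cdot> ((u \<boxtimes> u') \<boxtimes> u'') \<cdot> (Copy C x \<boxtimes> Ident C x) \<cdot> Copy C x"
    using assms x by simp
  also have "\<dots> = (u \<boxtimes> (u' \<boxtimes> u'')) \<cdot> Assoc C x x x \<cdot> (Copy C x \<boxtimes> Ident C x) \<cdot> Copy C x"
    using comp_cong_prefix[OF associator_natural[OF assms(1-3)]] assms x by (simp del: comp_tensor_prefix)
  also have "\<dots> = (u \<boxtimes> ((u' \<boxtimes> u'') \<cdot> Copy C x)) \<cdot> Copy C x"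
    using assms x by (simp add: copy_coassoc)
  finally show ?thesis .
qed

text \<open>The analogous reduction, by naturality of \<open>interchange\<close>, for the copy map of \<open>X \<otimes> Y\<close> at \<open>((i, j), (i', j'))\<close>, with
  \<open>x = X\<^sub>k\<close> and \<open>y = Y\<^sub>m\<close>.\<close>

lemma copy_tensor_restricted:
  assumes "u \<in> Arr C" "u' \<in> Arr C" "v \<in> Arr C" "v' \<in> Arr C" "Dom C u = x" "Dom C u' = x" "Dom C v = y" "Dom C v' = y"
  shows "((u \<boxtimes> v) \<boxtimes> (u' \<boxtimes> v')) \<cdot> Copy C (x \<otimes> y) =
    interchange C (Cod C u) (Cod C u') (Cod C v) (Cod C v') \<cdot> (((u \<boxtimes> u') \<cdot> Copy C x) \<boxtimes> ((v \<boxtimes> v') \<cdot> Copy C y))"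
proof -
  have x: "x \<in> Obj C" "y \<in> Obj C" using assms dom_obj by blast+
  have "interchange C (Cod C u) (Cod C u') (Cod C v) (Cod C v') \<cdot> (((u \<boxtimes> u') \<cdot> Copy C x) \<boxtimes> ((v \<boxtimes> v') \<cdot> Copy C y)) =
     interchange C (Cod C u) (Cod C u') (Cod C v) (Cod C v') \<cdot> ((u \<boxtimes> u') \<boxtimes> (v \<boxtimes> v')) \<cdot> (Copy C x \<boxtimes> Copy C y)"
    using assms x by simp
  also have "\<dots> = ((u \<boxtimes> v) \<boxtimes> (u' \<boxtimes> v')) \<cdot> interchange C x x y y \<cdot> (Copy C x \<boxtimes> Copy C y)"
    using comp_cong_prefix[OF interchange_natural[OF assms(1-4)], of "Copy C x \<boxtimes> Copy C y"] assms x
    by (simp del: comp_tensor comp_tensor_prefix)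
  finally show ?thesis using x by (simp add: copy_tensor)
qed

theorem markov_category_prodet:
  "markov_category (prodet C :: (('i::infinite, 'o, 'a) diagram, ('i, 'o, 'a) pro_arrow) markov)"
proof (intro markov_category.intro symmetric_monoidal_category_prodet markov_category_axioms.intro)
  let ?D = "prodet C :: (('i, 'o, 'a) diagram, ('i, 'o, 'a) pro_arrow) markov"
  interpret D: symmetric_monoidal_category ?D by (rule symmetric_monoidal_category_prodet)
  note co = represents_comp and te = represents_tensor and id = represents_ident(2) and as = represents_assoc(3)
    and sw = represents_swap(2) and cp = represents_copy(2)
  have into_unit: "f = g" if "f \<in> hom ?D X (Unit ?D)" "g \<in> hom ?D X (Unit ?D)" for f g X
    using that into_pro_unit_eq unfolding prodet_hom prodet_simps by blast
  have copy: "Copy ?D X \<in> hom ?D X (X \<otimes>\<^bsub>?D\<^esub> X)" and del: "Del ?D X \<in> hom ?D X (Unit ?D)"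
    if "X \<in> Obj ?D" for X
    using that by (simp_all add: prodet_hom prodet_simps represents_copy(1) represents_del(1))
  show "terminal_obj ?D (Unit ?D)"
    unfolding terminal_obj_def using D.unit_obj del into_unit by blast
  fix a b :: "('i, 'o, 'a) diagram"
  {
    assume a: "a \<in> Obj ?D"
    show "Copy ?D a \<in> hom ?D a (a \<otimes>\<^bsub>?D\<^esub> a)" "Del ?D a \<in> hom ?D a (Unit ?D)"
      using copy del a by auto
    have aD: "a \<in> pro_objects (det C)" using a by simp
    note O = prodet_object_pro[OF aD]
    note P = pro_object_shape[OF O]
    show "Assoc ?D a a a \<cdot>\<^bsub>?D\<^esub> (Copy ?D a \<boxtimes>\<^bsub>?D\<^esub> Ident ?D a) \<cdot>\<^bsub>?D\<^esub> Copy ?D a =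
      (Ident ?D a \<boxtimes>\<^bsub>?D\<^esub> Copy ?D a) \<cdot>\<^bsub>?D\<^esub> Copy ?D a" (is "?L = ?R")
      unfolding prodet_simps
    proof (rule pro_arrow_eqI[OF O])
      let ?T = "pro_tensor C a (pro_tensor C a a)"
      show "?T \<in> pro_objects C" using O by simp
      fix l assume "l \<in> Obj (Shape ?T)"
      then obtain i j k where l: "l = idx_pair (i, idx_pair (j, k))"
        and i: "i \<in> Obj (Shape a)" "j \<in> Obj (Shape a)" "k \<in> Obj (Shape a)" by auto
      obtain m u v w where u: "u \<in> hom (Shape a) m i" and v: "v \<in> hom (Shape a) m j" and w: "w \<in> hom (Shape a) m k"
        using cofiltered_three[OF O i] .
      have m: "m \<in> Obj (Shape a)" using pro_object_arr[OF O u] by simp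
      \<comment> \<open>on either side the copy map applied first is taken at a span with one identity leg\<close>
      note 1 = shape_ident_comp(1)[OF O m]
      show "\<exists>i f g. represents C a ?T (pro_assoc C a a a \<cdot>\<^bsub>pro C\<^esub> pro_tensor_arr C (pro_copy C a) (Ident (pro C) a) \<cdot>\<^bsub>pro C\<^esub> pro_copy C a) l i f \<and>
          represents C a ?T (pro_tensor_arr C (Ident (pro C) a) (pro_copy C a) \<cdot>\<^bsub>pro C\<^esub> pro_copy C a) l i g \<and> f = g"
        unfolding l
        by (rule pro_arrow_component_eqI[OF
              co[OF as[OF O O O i] co[OF te[OF cp[OF aD u v] id[OF O i(3)]] cp[OF aD 1 w]]]
              co[OF te[OF id[OF O i(1)] cp[OF aD v w]] cp[OF aD u 1]]])
          (use copy_coassoc_restricted[of "ArrMap a u" "ArrMap a v" "ArrMap a w" "ObjMap a m"] O m i P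
            pro_object_arr[OF O u] pro_object_arr[OF O v] pro_object_arr[OF O w] in simp)
    qed
    show "LUnit ?D a \<cdot>\<^bsub>?D\<^esub> (Del ?D a \<boxtimes>\<^bsub>?D\<^esub> Ident ?D a) \<cdot>\<^bsub>?D\<^esub> Copy ?D a = Ident ?D a"
      unfolding prodet_simps
    proof (rule pro_arrow_eqI[OF O O])
      fix i assume i: "i \<in> Obj (Shape a)"
      show "\<exists>j f g. represents C a a (pro_lunit C a \<cdot>\<^bsub>pro C\<^esub> pro_tensor_arr C (pro_del C a) (Ident (pro C) a) \<cdot>\<^bsub>pro C\<^esub> pro_copy C a) i j f \<and>
        represents C a a (Ident (pro C) a) i j g \<and> f = g"
        by (rule pro_arrow_component_eqI[OF
              co[OF represents_lunit(2)[OF O i] co[OF te[OF represents_del(2)[OF O i] id[OF O i]] represents_copy_diagonal[OF aD i]]]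
              id[OF O i]])
          (use P(3)[OF i] copy_counit_left in simp)
    qed
    show "RUnit ?D a \<cdot>\<^bsub>?D\<^esub> (Ident ?D a \<boxtimes>\<^bsub>?D\<^esub> Del ?D a) \<cdot>\<^bsub>?D\<^esub> Copy ?D a = Ident ?D a"
      unfolding prodet_simps
    proof (rule pro_arrow_eqI[OF O O])
      fix i assume i: "i \<in> Obj (Shape a)"
      show "\<exists>j f g. represents C a a (pro_runit C a \<cdot>\<^bsub>pro C\<^esub> pro_tensor_arr C (Ident (pro C) a) (pro_del C a) \<cdot>\<^bsub>pro C\<^esub> pro_copy C a) i j f \<and>
        represents C a a (Ident (pro C) a) i j g \<and> f = g"
        by (rule pro_arrow_component_eqI[OF
              co[OF represents_runit(2)[OF O i] co[OF te[OF id[OF O i] represents_del(2)[OF O i]] represents_copy_diagonal[OF aD i]]]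
              id[OF O i]])
          (use P(3)[OF i] copy_counit_right in simp)
    qed
    show "Swap ?D a a \<cdot>\<^bsub>?D\<^esub> Copy ?D a = Copy ?D a"
      unfolding prodet_simps
    proof (rule pro_arrow_eqI[OF O])
      show "pro_tensor C a a \<in> pro_objects C" using O by simp
      fix l assume "l \<in> Obj (Shape (pro_tensor C a a))"
      then obtain i j where l: "l = idx_pair (i, j)" and i: "i \<in> Obj (Shape a)" "j \<in> Obj (Shape a)" by auto
      obtain k u v where u: "u \<in> hom (Shape a) k i" and v: "v \<in> hom (Shape a) k j"
        using pro_object_cofiltered(2)[OF O i] by blast
      have k: "ObjMap a k \<in> Obj C" using pro_object_arr[OF O u] P(3) by simp
      have "Swap C (ObjMap a j) (ObjMap a i) \<cdot> (ArrMap a v \<boxtimes> ArrMap a u) \<cdot> Copy C (ObjMap a k) =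
         (ArrMap a u \<boxtimes> ArrMap a v) \<cdot> Swap C (ObjMap a k) (ObjMap a k) \<cdot> Copy C (ObjMap a k)"
        using comp_cong_prefix[OF swap_natural_arr[of "ArrMap a v" "ArrMap a u"]]
          pro_object_arr[OF O u] pro_object_arr[OF O v] k i P(3) by simp
      then show "\<exists>i f g. represents C a (pro_tensor C a a) (pro_swap C a a \<cdot>\<^bsub>pro C\<^esub> pro_copy C a) l i f \<and>
          represents C a (pro_tensor C a a) (pro_copy C a) l i g \<and> f = g"
        unfolding l
        by (intro pro_arrow_component_eqI[OF co[OF sw[OF O O i(2,1)] cp[OF aD v u]] cp[OF aD u v]])
          (simp add: copy_commute[OF k])
    qed
    {
      assume b: "b \<in> Obj ?D"
      have bD: "b \<in> pro_objects (det C)" using b by simp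
      note O' = prodet_object_pro[OF bD]
      have abD: "pro_tensor C a b \<in> pro_objects (det C)" using aD bD by simp
      show "Copy ?D (a \<otimes>\<^bsub>?D\<^esub> b) = interchange ?D a a b b \<cdot>\<^bsub>?D\<^esub> (Copy ?D a \<boxtimes>\<^bsub>?D\<^esub> Copy ?D b)"
        unfolding prodet_simps
      proof (rule pro_arrow_eqI)
        let ?S = "pro_tensor C a b" and ?T = "pro_tensor C (pro_tensor C a b) (pro_tensor C a b)"
        show "?S \<in> pro_objects C" "?T \<in> pro_objects C" using O O' by simp_all
        fix l assume "l \<in> Obj (Shape ?T)"
        then obtain i j i' j' where l: "l = idx_pair (idx_pair (i, j), idx_pair (i', j'))"
          and i: "i \<in> Obj (Shape a)" "i' \<in> Obj (Shape a)" and j: "j \<in> Obj (Shape b)" "j' \<in> Obj (Shape b)" by auto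
        obtain k u u' where u: "u \<in> hom (Shape a) k i" and u': "u' \<in> hom (Shape a) k i'"
          using pro_object_cofiltered(2)[OF O i] by blast
        obtain m v v' where v: "v \<in> hom (Shape b) m j" and v': "v' \<in> hom (Shape b) m j'"
          using pro_object_cofiltered(2)[OF O' j] by blast
        have uv: "idx_pair (u, v) \<in> hom (Shape ?S) (idx_pair (k, m)) (idx_pair (i, j))"
           "idx_pair (u', v') \<in> hom (Shape ?S) (idx_pair (k, m)) (idx_pair (i', j'))"
          using u v u' v' by (auto simp: prod_shape_hom)
        show "\<exists>i f g. represents C ?S ?T (pro_copy C ?S) l i f \<and>
            represents C ?S ?T (interchange (prodet C) a a b b \<cdot>\<^bsub>pro C\<^esub> pro_tensor_arr C (pro_copy C a) (pro_copy C b)) l i g \<and> f = g"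
          unfolding l
          by (rule pro_arrow_component_eqI[OF cp[OF abD uv]
                co[OF represents_interchange[OF aD aD bD bD i j] te[OF cp[OF aD u u'] cp[OF bD v v']]]])
            (use copy_tensor_restricted[of "ArrMap a u" "ArrMap a u'" "ArrMap b v" "ArrMap b v'" "ObjMap a k" "ObjMap b m"]
              pro_object_arr[OF O u] pro_object_arr[OF O u'] pro_object_arr[OF O' v] pro_object_arr[OF O' v'] in simp)
      qed
      show "Del ?D (a \<otimes>\<^bsub>?D\<^esub> b) = LUnit ?D (Unit ?D) \<cdot>\<^bsub>?D\<^esub> (Del ?D a \<boxtimes>\<^bsub>?D\<^esub> Del ?D b)"
        by (rule into_unit[OF del[OF D.tensor_obj[OF a b]]
            D.comp_hom[OF D.tensor_hom[OF del[OF a] del[OF b]] D.lunit_hom[OF D.unit_obj]]])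
    }
  }
  show "Del ?D (Unit ?D) = Ident ?D (Unit ?D)"
    using del[OF D.unit_obj] D.ident_hom[OF D.unit_obj] by (rule into_unit)
  show "Copy ?D (Unit ?D) = inverse_arr ?D (LUnit ?D (Unit ?D))"
  proof -
    \<comment> \<open>copying the unit is a right inverse of the left unitor by terminality, and the unitor is invertible\<close>
    let ?I = "Unit ?D" and ?l = "LUnit ?D (Unit ?D)"
    note l = D.lunit_hom[OF D.unit_obj] and c = copy[OF D.unit_obj]
    have "?l \<cdot>\<^bsub>?D\<^esub> Copy ?D ?I = Ident ?D ?I"
      by (rule into_unit[OF D.comp_hom[OF c l] D.ident_hom[OF D.unit_obj]])
    then have "inverse_arr ?D ?l \<cdot>\<^bsub>?D\<^esub> ?l \<cdot>\<^bsub>?D\<^esub> Copy ?D ?I = inverse_arr ?D ?l \<cdot>\<^bsub>?D\<^esub> Ident ?D ?I" by simp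
    moreover have "inverse_arr ?D ?l \<cdot>\<^bsub>?D\<^esub> ?l \<cdot>\<^bsub>?D\<^esub> Copy ?D ?I = (inverse_arr ?D ?l \<cdot>\<^bsub>?D\<^esub> ?l) \<cdot>\<^bsub>?D\<^esub> Copy ?D ?I"
      using c l D.lunit_iso[OF D.unit_obj] D.unit_obj by (intro D.assoc_arr[symmetric]) (auto simp: hom_def)
    ultimately show ?thesis
      using c l D.lunit_iso[OF D.unit_obj] by (auto simp: hom_def)
  qed
qed

end

section \<open>Deterministic arrows of pro-deterministic objects\<close>

context markov_category
begin

text \<open>Both relations are witnessed by restrictions to a common index along transition arrows, which lie in \<open>det C\<close>.
  Hence \<open>Pro(det C) \<rightarrow> Pro(C)\<close> is faithful.\<close>

lemma colim_rel_det_iff: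
  assumes X: "X \<in> pro_objects (det C)" and p: "p \<in> colim_carrier (det C) X c" and q: "q \<in> colim_carrier (det C) X c"
  shows "(p, q) \<in> colim_rel (det C) X c \<longleftrightarrow> (p, q) \<in> colim_rel C X c"
  using colim_rel_iff[OF X p] colim_rel_iff[OF prodet_object_pro[OF X] colim_carrier_det[OF p]] q colim_carrier_det[OF q]
  by (simp add: refines_def)

lemma represents_pro_det_incl:
  assumes h: "represents (det C) X Y h j i f"
  shows "represents C X Y (pro_det_incl C h) j i f"
proof -
  define F where "F = snd (snd h)"
  note D = representsD[OF h, folded F_def]
  have def: "pro_det_incl C h = pro_arr C X Y F"
    by (subst D(4)) (simp add: pro_det_incl_def)
  have rF: "(i, f) \<in> F j \<longleftrightarrow> represents (det C) X Y h j i f" if "j \<in> Obj (Shape Y)" for j i f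
    using D(1) that by (simp add: represents_def F_def)
  have "represents C X Y (pro_arr C X Y F) j i f"
  proof (rule pro_arr_represents(2)[OF prodet_object_pro[OF D(2)] prodet_object_pro[OF D(3)]])
    fix j assume j: "j \<in> Obj (Shape Y)"
    obtain i f where "represents (det C) X Y h j i f" using represents_exists[OF D(1) j] .
    then show "F j \<noteq> {}" using rF[OF j] by blast
  next
    fix j i f assume j: "j \<in> Obj (Shape Y)" and "(i, f) \<in> F j"
    then have "represents (det C) X Y h j i f" using rF[OF j] by simp
    then show "(i, f) \<in> colim_carrier C X (ObjMap Y j)"
      by (rule colim_carrier_det[OF representsD(9)])
  next
    fix j p q assume j: "j \<in> Obj (Shape Y)" and "p \<in> F j" "q \<in> F j"
    then have r: "represents (det C) X Y h j (fst p) (snd p)" "represents (det C) X Y h j (fst q) (snd q)"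
      by (simp_all add: rF[OF j, symmetric])
    have "((fst p, snd p), (fst q, snd q)) \<in> colim_rel (det C) X (ObjMap Y j)"
      using represents_iff_rel[OF r(1)] r(2) by simp
    then show "(p, q) \<in> colim_rel C X (ObjMap Y j)"
      using colim_rel_det by simp
  next
    fix j j' v i f assume v: "v \<in> hom (Shape Y) j j'" and f: "(i, f) \<in> F j"
    have j: "j \<in> Obj (Shape Y)" "j' \<in> Obj (Shape Y)" using pro_object_arr[OF D(3) v] by auto
    have "represents (det C) X Y h j i f" using rF[OF j(1)] f by simp
    from represents_push[OF this v] have "represents (det C) X Y h j' i (ArrMap Y v \<cdot> f)" by simp
    then have "(i, ArrMap Y v \<cdot> f) \<in> F j'" using rF[OF j(2)] by simp
    then show "\<exists>p\<in>F j'. (p, (i, ArrMap Y v \<cdot> f)) \<in> colim_rel C X (ObjMap Y j')"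
      by (rule bexI[rotated]) (rule colim_rel_refl)
  next
    show "j \<in> Obj (Shape Y)" by (rule D(6))
    then show "(i, f) \<in> F j" using rF h by simp
  qed
  then show ?thesis using def by simp
qed

lemma pro_det_incl_hom:
  assumes "h \<in> hom (pro (det C)) X Y"
  shows "pro_det_incl C h \<in> hom (pro C) X Y"
proof -
  have "Y \<in> pro_objects (det C)" using assms by (auto simp: pro_homset)
  then obtain j where j: "j \<in> Obj (Shape Y)" using pro_object_cofiltered(1) by blast
  obtain i f where f: "represents (det C) X Y h j i f" using represents_exists[OF assms j] .
  show ?thesis by (rule representsD(1)[OF represents_pro_det_incl[OF f]])
qed

lemma pro_det_incl_inj:
  assumes h: "h \<in> hom (pro (det C)) X Y" and h': "h' \<in> hom (pro (det C)) X Y"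
    and eq: "pro_det_incl C h = pro_det_incl C h'"
  shows "h = h'"
proof -
  have O: "X \<in> pro_objects (det C)" "Y \<in> pro_objects (det C)" using h by (auto simp: pro_homset)
  show ?thesis
  proof (rule pro_arrow_eqI[OF O])
    fix j assume j: "j \<in> Obj (Shape Y)"
    obtain i f where f: "represents (det C) X Y h j i f" using represents_exists[OF h j] .
    obtain i' f' where f': "represents (det C) X Y h' j i' f'" using represents_exists[OF h' j] .
    have "((i', f'), (i, f)) \<in> colim_rel C X (ObjMap Y j)"
      by (rule iffD1[OF represents_iff_rel[OF represents_pro_det_incl[OF f']] represents_pro_det_incl[OF f, unfolded eq]])
    then have "represents (det C) X Y h' j i f"
      using represents_iff_rel[OF f'] colim_rel_det_iff[OF O(1) representsD(9)[OF f'] representsD(9)[OF f]] by simp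
    with f show "\<exists>i f g. represents (det C) X Y h j i f \<and> represents (det C) X Y h' j i g \<and> f = g" by blast
  qed
qed

lemma pro_det_incl_ident:
  assumes "X \<in> pro_objects (det C)"
  shows "pro_det_incl C (Ident (pro (det C)) X) = Ident (pro C) X"
proof (rule pro_arrow_eqI[OF prodet_object_pro[OF assms] prodet_object_pro[OF assms]])
  fix i assume i: "i \<in> Obj (Shape X)"
  show "\<exists>j f g. represents C X X (pro_det_incl C (Ident (pro (det C)) X)) i j f \<and> represents C X X (Ident (pro C) X) i j g \<and> f = g"
    by (rule pro_arrow_component_eqI[OF represents_pro_det_incl[OF represents_ident(2)[OF assms i]]
          represents_ident(2)[OF prodet_object_pro[OF assms] i]]) simp
qed

lemma pro_det_incl_comp:
  assumes f: "f \<in> hom (pro (det C)) X Y" and g: "g \<in> hom (pro (det C)) Y Z"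
  shows "pro_det_incl C (g \<cdot>\<^bsub>pro (det C)\<^esub> f) = pro_det_incl C g \<cdot>\<^bsub>pro C\<^esub> pro_det_incl C f"
proof -
  have O: "X \<in> pro_objects C" "Z \<in> pro_objects C" using f g by (auto simp: pro_homset)
  show ?thesis
  proof (rule pro_arrow_eqI[OF O])
    fix k assume k: "k \<in> Obj (Shape Z)"
    obtain j b where b: "represents (det C) Y Z g k j b" using represents_exists[OF g k] .
    obtain i a where a: "represents (det C) X Y f j i a" using represents_exists[OF f representsD(7)[OF b]] .
    show "\<exists>i u v. represents C X Z (pro_det_incl C (g \<cdot>\<^bsub>pro (det C)\<^esub> f)) k i u \<and>
        represents C X Z (pro_det_incl C g \<cdot>\<^bsub>pro C\<^esub> pro_det_incl C f) k i v \<and> u = v"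
      by (rule pro_arrow_component_eqI[OF represents_pro_det_incl[OF represents_comp[OF b a]]
          represents_comp[OF represents_pro_det_incl[OF b] represents_pro_det_incl[OF a]]]) simp
  qed
qed

text \<open>At an index \<open>(j, j')\<close> of \<open>Y \<otimes> Y\<close> everything can be computed from a single representative of \<open>h\<close>, taken at an index
  \<open>m\<close> over both \<open>j\<close> and \<open>j'\<close>; the claim is then determinism of that representative.\<close>

lemma pro_det_incl_deterministic:
  fixes X Y :: "('i::infinite, 'o, 'a) diagram"
  assumes h: "h \<in> hom (pro (det C)) X Y"
  shows "deterministic (prodet C) (pro_det_incl C h)"
proof -
  let ?h = "pro_det_incl C h"
  have O: "X \<in> pro_objects (det C)" "Y \<in> pro_objects (det C)" using h by (auto simp: pro_homset)
  note X = prodet_object_pro[OF O(1)] and Y = prodet_object_pro[OF O(2)]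
  have "pro_copy C Y \<cdot>\<^bsub>pro C\<^esub> ?h = pro_tensor_arr C ?h ?h \<cdot>\<^bsub>pro C\<^esub> pro_copy C X" (is "?L = ?R")
  proof (rule pro_arrow_eqI[OF X])
    show "pro_tensor C Y Y \<in> pro_objects C" using Y by simp
    fix l assume "l \<in> Obj (Shape (pro_tensor C Y Y))"
    then obtain j j' where l: "l = idx_pair (j, j')" and j: "j \<in> Obj (Shape Y)" "j' \<in> Obj (Shape Y)" by auto
    obtain m v v' where v: "v \<in> hom (Shape Y) m j" and v': "v' \<in> hom (Shape Y) m j'"
      using pro_object_cofiltered(2)[OF Y j] by blast
    obtain i f where f: "represents (det C) X Y h m i f" using represents_exists[OF h pro_object_arr(4)[OF Y v]] .
    note r = represents_pro_det_incl[OF f]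
    have i: "i \<in> Obj (Shape X)" using representsD(7)[OF f] .
    have "Copy C (ObjMap Y m) \<cdot> f = (f \<boxtimes> f) \<cdot> Copy C (ObjMap X i)"
      using representsD(8)[OF f] by (simp add: det_hom)
    then have "((ArrMap Y v \<boxtimes> ArrMap Y v') \<cdot> Copy C (ObjMap Y m)) \<cdot> f =
        ((ArrMap Y v \<cdot> f) \<boxtimes> (ArrMap Y v' \<cdot> f)) \<cdot> Copy C (ObjMap X i)"
      using represents_arr[OF r] pro_object_arr[OF Y v] pro_object_arr[OF Y v'] pro_object_shape(3)[OF X i]
        pro_object_shape(3)[OF Y, of m] by simp
    then show "\<exists>i f g. represents C X (pro_tensor C Y Y) ?L l i f \<and> represents C X (pro_tensor C Y Y) ?R l i g \<and> f = g"
      unfolding l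
      by (rule pro_arrow_component_eqI[OF represents_comp[OF represents_copy(2)[OF O(2) v v'] r]
          represents_comp[OF represents_tensor[OF represents_push[OF r v] represents_push[OF r v']]
            represents_copy_diagonal[OF O(1) i]]])
  qed
  then show ?thesis
    using pro_det_incl_hom[OF h] by (auto simp: deterministic_def prodet_simps hom_def)
qed

text \<open>The key point: at a diagonal index \<open>(j, j)\<close>, the equation saying that \<open>h\<close> is deterministic holds in a
  filtered colimit, hence after restriction along some \<open>X\<^sub>u\<close>.  As \<open>X\<^sub>u\<close> is itself deterministic, it can be moved
  across the copy map, and the equation becomes determinism of the restricted representative.\<close>

lemma deterministic_representative:
  fixes X Y :: "('i::infinite, 'o, 'a) diagram"
  assumes X: "X \<in> pro_objects (det C)" and Y: "Y \<in> pro_objects (det C)" and h: "h \<in> hom (pro C) X Y"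
    and det: "deterministic (prodet C) h" and j: "j \<in> Obj (Shape Y)"
  obtains i f where "represents C X Y h j i f" "f \<in> hom (det C) (ObjMap X i) (ObjMap Y j)"
proof -
  note XC = prodet_object_pro[OF X] and YC = prodet_object_pro[OF Y]
  have eq: "pro_copy C Y \<cdot>\<^bsub>pro C\<^esub> h = pro_tensor_arr C h h \<cdot>\<^bsub>pro C\<^esub> pro_copy C X"
    using det h by (auto simp: deterministic_def prodet_simps hom_def)
  obtain i f where f: "represents C X Y h j i f" using represents_exists[OF h j] .
  note i = representsD(7)[OF f]
  have l: "represents C X (pro_tensor C Y Y) (pro_copy C Y \<cdot>\<^bsub>pro C\<^esub> h) (idx_pair (j, j)) i (Copy C (ObjMap Y j) \<cdot> f)"
    by (rule represents_comp[OF represents_copy_diagonal[OF Y j] f])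
  have r: "represents C X (pro_tensor C Y Y) (pro_copy C Y \<cdot>\<^bsub>pro C\<^esub> h) (idx_pair (j, j)) i
      ((f \<boxtimes> f) \<cdot> Copy C (ObjMap X i))"
    unfolding eq by (rule represents_comp[OF represents_tensor[OF f f] represents_copy_diagonal[OF X i]])
  obtain k u where u: "u \<in> hom (Shape X) k i"
    and e: "(Copy C (ObjMap Y j) \<cdot> f) \<cdot> ArrMap X u = ((f \<boxtimes> f) \<cdot> Copy C (ObjMap X i)) \<cdot> ArrMap X u"
    using represents_equalize[OF l r] .
  note r = represents_restrict[OF f u]
  have ob: "ObjMap X i \<in> Obj C" "ObjMap X k \<in> Obj C" "ObjMap Y j \<in> Obj C"
    using pro_object_arr[OF XC u] pro_object_shape(3)[OF XC] pro_object_shape(3)[OF YC j] by auto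
  have du: "Copy C (ObjMap X i) \<cdot> ArrMap X u = (ArrMap X u \<boxtimes> ArrMap X u) \<cdot> Copy C (ObjMap X k)"
    using pro_object_shape(4)[OF X u] by (simp add: det_hom)
  have "Copy C (ObjMap Y j) \<cdot> f \<cdot> ArrMap X u = (f \<boxtimes> f) \<cdot> Copy C (ObjMap X i) \<cdot> ArrMap X u"
    using e ob represents_arr[OF f] pro_object_arr[OF XC u] by simp
  also have "\<dots> = ((f \<cdot> ArrMap X u) \<boxtimes> (f \<cdot> ArrMap X u)) \<cdot> Copy C (ObjMap X k)"
    unfolding du using ob represents_arr[OF f] pro_object_arr[OF XC u] by simp
  finally show ?thesis
    using that[OF r] representsD(8)[OF r] by (simp add: det_hom)
qed

text \<open>The preimage is spanned by all deterministic representatives of \<open>h\<close>.\<close>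

lemma pro_det_incl_surj:
  fixes X Y :: "('i::infinite, 'o, 'a) diagram"
  assumes X: "X \<in> pro_objects (det C)" and Y: "Y \<in> pro_objects (det C)" and h: "h \<in> hom (pro C) X Y"
    and det: "deterministic (prodet C) h"
  obtains h' where "h' \<in> hom (pro (det C)) X Y" "pro_det_incl C h' = h"
proof -
  note XC = prodet_object_pro[OF X] and YC = prodet_object_pro[OF Y]
  define S where "S j = {(i, f). represents C X Y h j i f \<and> f \<in> hom (det C) (ObjMap X i) (ObjMap Y j)}" for j
  have car: "(i, f) \<in> colim_carrier (det C) X (ObjMap Y j)" if "j \<in> Obj (Shape Y)" "(i, f) \<in> S j" for j i f
    using that(2) representsD(7)[of C X Y h j i f] by (simp add: S_def colim_carrier_def)
  have rel: "(p, q) \<in> colim_rel (det C) X (ObjMap Y j)" if "j \<in> Obj (Shape Y)" "p \<in> S j" "q \<in> S j" for j p q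
  proof -
    have "(p, q) \<in> colim_rel C X (ObjMap Y j)"
      using that(2,3) represents_iff_rel[of C X Y h j "fst p" "snd p" "fst q" "snd q"] by (simp add: S_def case_prod_beta)
    then show ?thesis
      using colim_rel_det_iff[OF X] car[OF that(1), of "fst p" "snd p"] car[OF that(1), of "fst q" "snd q"] that by simp
  qed
  have ne: "S j \<noteq> {}" if jY: "j \<in> Obj (Shape Y)" for j
  proof -
    obtain i f where "represents C X Y h j i f" "f \<in> hom (det C) (ObjMap X i) (ObjMap Y j)"
      using deterministic_representative[OF X Y h det jY] .
    then have "(i, f) \<in> S j" by (simp add: S_def)
    then show ?thesis by blast
  qed
  have cmp: "\<exists>p\<in>S j'. (p, (i, ArrMap Y v \<cdot>\<^bsub>det C\<^esub> f)) \<in> colim_rel (det C) X (ObjMap Y j')"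
    if v: "v \<in> hom (Shape Y) j j'" and f: "(i, f) \<in> S j" for j j' v i f
  proof -
    have fr: "represents C X Y h j i f" and fd: "f \<in> hom (det C) (ObjMap X i) (ObjMap Y j)"
      using f by (simp_all add: S_def)
    have "represents C X Y h j' i (ArrMap Y v \<cdot> f)" by (rule represents_push[OF fr v])
    moreover have "ArrMap Y v \<cdot>\<^bsub>det C\<^esub> f \<in> hom (det C) (ObjMap X i) (ObjMap Y j')"
      by (rule category.comp_hom[OF category_det[OF markov_category_axioms] fd pro_object_shape(4)[OF Y v]])
    ultimately have "(i, ArrMap Y v \<cdot>\<^bsub>det C\<^esub> f) \<in> S j'" by (simp add: S_def)
    then show ?thesis by (rule bexI[rotated]) (rule colim_rel_refl)
  qed
  let ?h = "pro_arr (det C) X Y S"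
  have R: "?h \<in> hom (pro (det C)) X Y" "\<And>j i f. \<lbrakk>j \<in> Obj (Shape Y); (i, f) \<in> S j\<rbrakk> \<Longrightarrow> represents (det C) X Y ?h j i f"
    by (rule pro_arr_represents[OF X Y ne car rel cmp]; assumption)+
  have "pro_det_incl C ?h = h"
  proof (rule pro_arrow_eqI[OF XC YC])
    fix j assume j: "j \<in> Obj (Shape Y)"
    obtain i f where f: "(i, f) \<in> S j" using ne[OF j] by fast
    then have "represents C X Y h j i f" by (simp add: S_def)
    moreover have "represents C X Y (pro_det_incl C ?h) j i f"
      by (rule represents_pro_det_incl, rule R(2)[OF j f])
    ultimately show "\<exists>i f g. represents C X Y (pro_det_incl C ?h) j i f \<and> represents C X Y h j i g \<and> f = g" by blast
  qed
  moreover have "?h \<in> hom (pro (det C)) X Y" by (rule R(1))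
  ultimately show ?thesis using that by blast
qed

theorem pro_det_cat_iso:
  "is_cat_iso (pro (det C)) (det (prodet C)) (\<lambda>X :: ('i::infinite, 'o, 'a) diagram. X) (pro_det_incl C)"
proof -
  let ?D = "prodet C :: (('i, 'o, 'a) diagram, ('i, 'o, 'a) pro_arrow) markov"
  let ?P = "pro (det C) :: (('i, 'o, 'a) diagram, ('i, 'o, 'a) pro_arrow) cat"
  have Arr: "f \<in> hom ?P (Dom ?P f) (Cod ?P f)" if "f \<in> Arr ?P" for f
    using that by (simp add: hom_def)
  have img: "pro_det_incl C f \<in> hom (det ?D) X Y" if f: "f \<in> hom ?P X Y" for f X Y
  proof -
    have "X \<in> pro_objects (det C)" "Y \<in> pro_objects (det C)" using f by (auto simp: pro_homset)
    then have "pro_det_incl C f \<in> hom ?D X Y" using pro_det_incl_hom[OF f] by (simp add: prodet_hom)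
    then show ?thesis using pro_det_incl_deterministic[OF f] by (simp add: det_def hom_def)
  qed
  have obj: "Obj (det ?D) = Obj ?P" by (simp add: pro_def)
  have is_fun: "is_functor ?P (det ?D) (\<lambda>X. X) (pro_det_incl C)"
    unfolding is_functor_def
  proof (intro conjI ballI impI)
    show "category ?P" by (rule category_pro)
    show "category (det ?D)" by (rule category_det[OF markov_category_prodet])
    fix X assume "X \<in> Obj ?P"
    then show "X \<in> Obj (det ?D)" "pro_det_incl C (Ident ?P X) = Ident (det ?D) X"
      using obj by (simp_all add: pro_det_incl_ident prodet_simps)
  next
    fix f assume "f \<in> Arr ?P"
    then show "pro_det_incl C f \<in> hom (det ?D) (Dom ?P f) (Cod ?P f)" using img[OF Arr] by blast
  next
    fix f g assume "f \<in> Arr ?P" "g \<in> Arr ?P" "Dom ?P g = Cod ?P f"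
    then show "pro_det_incl C (g \<cdot>\<^bsub>?P\<^esub> f) = pro_det_incl C g \<cdot>\<^bsub>det ?D\<^esub> pro_det_incl C f"
      using pro_det_incl_comp[of f "Dom ?P f" "Cod ?P f" g "Cod ?P g"] by (simp add: prodet_simps hom_def)
  qed
  have "bij_betw (pro_det_incl C) (Arr ?P) (Arr (det ?D))"
  proof (rule bij_betw_imageI)
    show "inj_on (pro_det_incl C) (Arr ?P)"
    proof (rule inj_onI)
      fix f g assume fg: "f \<in> Arr ?P" "g \<in> Arr ?P" and eq: "pro_det_incl C f = pro_det_incl C g"
      have "g \<in> hom ?P (Dom ?P f) (Cod ?P f)"
        using img[OF Arr[OF fg(1)]] img[OF Arr[OF fg(2)]] eq fg(2) by (simp add: hom_def)
      then show "f = g" by (rule pro_det_incl_inj[OF Arr[OF fg(1)] _ eq])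
    qed
    show "pro_det_incl C ` Arr ?P = Arr (det ?D)"
    proof (intro equalityI subsetI)
      fix h assume "h \<in> pro_det_incl C ` Arr ?P"
      then show "h \<in> Arr (det ?D)" using img[OF Arr] by (auto simp: hom_def)
    next
      fix h assume "h \<in> Arr (det ?D)"
      then have h: "h \<in> hom ?D (Dom ?D h) (Cod ?D h)" and det: "deterministic ?D h"
        by (auto simp: det_def hom_def)
      obtain h' where "h' \<in> hom ?P (Dom ?D h) (Cod ?D h)" "pro_det_incl C h' = h"
        using pro_det_incl_surj[OF _ _ _ det] h unfolding prodet_hom by metis
      then show "h \<in> pro_det_incl C ` Arr ?P" by (auto simp: hom_def)
    qed
  qed
  then show ?thesis
    unfolding is_cat_iso_def using is_fun obj by (simp add: bij_betw_def)
qed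

end

theorem lemma1:
  fixes C :: "('o, 'a) markov"
  assumes "markov_category C"
  shows "markov_category (prodet C :: (('i::infinite, 'o, 'a) diagram, ('i, 'o, 'a) pro_arrow) markov) \<and>
    is_cat_iso (pro (det C)) (det (prodet C)) (\<lambda>X :: ('i, 'o, 'a) diagram. X) (pro_det_incl C)"
  using markov_category.markov_category_prodet[OF assms] markov_category.pro_det_cat_iso[OF assms] by blast

end
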